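(* For any integer $n\ge 4$, there exists a finite simplicial biconnected graph $\Gamma_n$ such that $$|V(\Gamma_n)|=n+2,\qquad \operatorname{diam}(\Gamma_n)=\operatorname{diam}(\overline{\Gamma_n})=2,\qquad \mathcal L_{(\Gamma_n^e,d_e)}(A(\Gamma_n))\le \frac{2}{n-3},$$ where $\mathcal L_{(\Gamma_n^e,d_e)}(A(\Gamma_n))$ is the minimal asymptotic translation length of the action of the right-angled Artin group $A(\Gamma_n)$ on its extension graph $(\Gamma_n^e,d_e)$.
   Context: Graphs are simplicial (no loops, no multiple edges). For a graph $\Gamma$, $V(\Gamma)$ and $E(\Gamma)$ are the vertex and edge sets, and $\bar\Gamma$ (or $\overline{\Gamma}$) is the complement graph (same vertices; two distinct vertices are adjacent in $\bar\Gamma$ iff they are not adjacent in $\Gamma$). $\Gamma$ is biconnected if both $\Gamma$ and $\bar\Gamma$ are connected. The diameter $\operatorname{diam}$ of a graph is the maximum over pairs of vertices of the graph distance (length of a shortest path). The right-angled Artin group on a finite simplicial graph $\Gamma$ is $A(\Gamma)=\langle v\in V(\Gamma) : v_iv_j=v_jv_i \text{ if } \{v_i,v_j\}\in E(\Gamma)\rangle$. Write $v^g=g^{-1}vg$. The extension graph $\Gamma^e$ has vertex set $V(\Gamma^e)=\{v^g : v\in V(\Gamma), g\in A(\Gamma)\}\subset A(\Gamma)$, and two distinct vertices $v_1^{g_1},v_2^{g_2}$ are adjacent iff they commute in $A(\Gamma)$. $d_e$ denotes the graph metric on $\Gamma^e$ (length of a shortest path); $\Gamma^e$ is connected when $\Gamma$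 is biconnected with at least two vertices. $A(\Gamma)$ acts on $\Gamma^e$ from the right by conjugation, $x\cdot g=g^{-1}xg$ for $x\in V(\Gamma^e)$, by isometries. For a group $G$ acting by isometries from the right on a connected metric space $(X,d)$ and $g\in G$, the asymptotic translation length is $\tau_{(X,d)}(g)=\lim_{k\to\infty} d(xg^k,x)/k$ for $x\in X$ (the limit exists and is independent of $x$). The minimal asymptotic translation length is $\mathcal L_{(X,d)}(G)=\min\{\tau_{(X,d)}(g): g\in G,\ \tau_{(X,d)}(g)>0\}$. *)

theory Defs
  imports
    Complex_Main
    "HOL-Algebra.Group"
    "Graph_Theory.Pair_Digraph"
    "Graph_Theory.Digraph_Component"
    "Graph_Theory.Shortest_Path"
begin

section \<open>Graphs\<close>

text \<open>
  Simplicial graphs are symmetric, loop-free \<^typ>\<open>'a pair_pre_digraph\<close>s: an edge is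
  represented by its two orientations. The locale \<^locale>\<open>pair_graph\<close> collects
  these conditions together with finiteness.
\<close>

definition complement_graph :: "'a pair_pre_digraph \<Rightarrow> 'a pair_pre_digraph" where
  "complement_graph \<Gamma> =
     \<lparr>pverts = pverts \<Gamma>,
      parcs = {(u, v). u \<in> pverts \<Gamma> \<and> v \<in> pverts \<Gamma> \<and> u \<noteq> v \<and> (u, v) \<notin> parcs \<Gamma>}\<rparr>"

definition biconnected :: "'a pair_pre_digraph \<Rightarrow> bool" where
  "biconnected \<Gamma> \<longleftrightarrow>
     Digraph_Component.connected (with_proj \<Gamma>) \<and>
     Digraph_Component.connected (with_proj (complement_graph \<Gamma>))"

text \<open>Length of a shortest path, with value \<open>\<infinity>\<close> if there is none.\<close>

definition graph_dist :: "'a pair_pre_digraph \<Rightarrow> 'a \<Rightarrow> 'a \<Rightarrow> ereal" where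
  "graph_dist \<Gamma> u v = wf_digraph.\<mu> (with_proj \<Gamma>) (\<lambda>_. 1) u v"

text \<open>Only meaningful for finite nonempty graphs, because of \<^const>\<open>Max\<close>.\<close>

definition diam :: "'a pair_pre_digraph \<Rightarrow> ereal" where
  "diam \<Gamma> = Max {graph_dist \<Gamma> u v | u v. u \<in> pverts \<Gamma> \<and> v \<in> pverts \<Gamma>}"


section \<open>Groups given by generators and relations\<close>

text \<open>
  The letter \<open>(s, True)\<close> stands for the generator \<open>s\<close> and \<open>(s, False)\<close> for its formal
  inverse. A relation \<open>l = r\<close> is a pair of words \<open>(l, r)\<close>.
\<close>

type_synonym 'a word = "('a \<times> bool) list"

abbreviation words :: "'a set \<Rightarrow> 'a word set" where
  "words S \<equiv> lists (S \<times> UNIV)"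

inductive_set presentation_cong ::
  "'a set \<Rightarrow> ('a word \<times> 'a word) set \<Rightarrow> ('a word \<times> 'a word) set"
  for S :: "'a set" and R :: "('a word \<times> 'a word) set" where
  refl: "w \<in> words S \<Longrightarrow> (w, w) \<in> presentation_cong S R"
| sym: "(u, v) \<in> presentation_cong S R \<Longrightarrow> (v, u) \<in> presentation_cong S R"
| trans: "\<lbrakk>(u, v) \<in> presentation_cong S R; (v, w) \<in> presentation_cong S R\<rbrakk>
    \<Longrightarrow> (u, w) \<in> presentation_cong S R"
| append: "\<lbrakk>(u, u') \<in> presentation_cong S R; (v, v') \<in> presentation_cong S R\<rbrakk>
    \<Longrightarrow> (u @ v, u' @ v') \<in> presentation_cong S R"
| cancel: "s \<in> S \<Longrightarrow> ([(s, b), (s, \<not> b)], []) \<in> presentation_cong S R"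
| relation: "\<lbrakk>(l, r) \<in> R; l \<in> words S; r \<in> words S\<rbrakk> \<Longrightarrow> (l, r) \<in> presentation_cong S R"

definition presented_group :: "'a set \<Rightarrow> ('a word \<times> 'a word) set \<Rightarrow> 'a word set monoid" where
  "presented_group S R =
     \<lparr>carrier = words S // presentation_cong S R,
      monoid.mult = (\<lambda>A B. \<Union>u\<in>A. \<Union>v\<in>B. presentation_cong S R `` {u @ v}),
      monoid.one = presentation_cong S R `` {[]}\<rparr>"

lemma presentation_cong_words:
  assumes "(u, v) \<in> presentation_cong S R"
  shows "u \<in> words S" and "v \<in> words S"
proof -
  from assms have "u \<in> words S \<and> v \<in> words S"
    by induction auto
  then show "u \<in> words S" "v \<in> words S" by auto
qed

lemma equiv_presentation_cong: "equiv (words S) (presentation_cong S R)"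
  by (auto intro!: equivI refl_onI symI transI
      intro: presentation_cong.refl presentation_cong.sym presentation_cong.trans
      dest: presentation_cong_words)

lemma presentation_class_eq:
  "(u, v) \<in> presentation_cong S R \<Longrightarrow>
    presentation_cong S R `` {u} = presentation_cong S R `` {v}"
  by (rule equiv_class_eq [OF equiv_presentation_cong])

lemma presented_group_mult:
  assumes "u \<in> words S" and "v \<in> words S"
  shows "presentation_cong S R `` {u} \<otimes>\<^bsub>presented_group S R\<^esub> presentation_cong S R `` {v} =
    presentation_cong S R `` {u @ v}"
proof -
  have "presentation_cong S R `` {u' @ v'} = presentation_cong S R `` {u @ v}"
    if "u' \<in> presentation_cong S R `` {u}" "v' \<in> presentation_cong S R `` {v}" for u' v'
    using that
    by (intro presentation_class_eq presentation_cong.append) (auto intro: presentation_cong.sym)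
  moreover have "u \<in> presentation_cong S R `` {u}" "v \<in> presentation_cong S R `` {v}"
    using assms by (auto intro: presentation_cong.refl)
  ultimately show ?thesis
    unfolding presented_group_def monoid.simps by blast
qed

lemma presentation_cong_inverse:
  "w \<in> words S \<Longrightarrow> (rev (map (\<lambda>(s, b). (s, \<not> b)) w) @ w, []) \<in> presentation_cong S R"
proof (induction w)
  case Nil
  show ?case by (auto intro: presentation_cong.refl)
next
  case (Cons x w)
  let ?C = "presentation_cong S R" and ?i = "\<lambda>w. rev (map (\<lambda>(s, b). (s, \<not> b)) w)"
  obtain s b where x: "x = (s, b)" and s: "s \<in> S" and w: "w \<in> words S"
    using Cons.prems by (cases x) auto
  have iw: "?i w \<in> words S" using w by (induction w) auto
  have "([(s, \<not> b), (s, b)], []) \<in> ?C"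
    using presentation_cong.cancel [OF s, of "\<not> b" R] by simp
  from presentation_cong.append
    [OF presentation_cong.refl [OF iw] presentation_cong.append [OF this presentation_cong.refl [OF w]]]
  have "(?i (x # w) @ x # w, ?i w @ w) \<in> ?C" by (simp add: x)
  then show ?case using Cons.IH [OF w] by (rule presentation_cong.trans)
qed

lemma group_presented_group: "group (presented_group S R)"
proof -
  let ?c = "\<lambda>w. presentation_cong S R `` {w}" and ?G = "presented_group S R"
  have carrier: "carrier ?G = ?c ` words S"
    by (auto simp: presented_group_def quotient_def)
  have one: "\<one>\<^bsub>?G\<^esub> = ?c []"
    by (simp add: presented_group_def)
  have inverse: "\<exists>y\<in>carrier ?G. y \<otimes>\<^bsub>?G\<^esub> ?c w = \<one>\<^bsub>?G\<^esub>" if w: "w \<in> words S" for w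
  proof
    let ?i = "rev (map (\<lambda>(s, b). (s, \<not> b)) w)"
    have i: "?i \<in> words S" using w by (induction w) auto
    then show "?c ?i \<in> carrier ?G" by (simp add: carrier)
    show "?c ?i \<otimes>\<^bsub>?G\<^esub> ?c w = \<one>\<^bsub>?G\<^esub>"
      unfolding presented_group_mult [OF i w] one
      by (intro presentation_class_eq presentation_cong_inverse w)
  qed
  show ?thesis
  proof (rule groupI)
    fix x y assume "x \<in> carrier ?G" "y \<in> carrier ?G"
    then obtain u v where "u \<in> words S" "v \<in> words S" "x = ?c u" "y = ?c v"
      by (auto simp only: carrier)
    then show "x \<otimes>\<^bsub>?G\<^esub> y \<in> carrier ?G"
      by (simp only: presented_group_mult carrier) (auto simp del: Image_singleton_iff)
  next
    show "\<one>\<^bsub>?G\<^esub> \<in> carrier ?G"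
      unfolding one carrier by (rule imageI) simp
  next
    fix x y z assume "x \<in> carrier ?G" "y \<in> carrier ?G" "z \<in> carrier ?G"
    then obtain u v w where "u \<in> words S" "v \<in> words S" "w \<in> words S"
        "x = ?c u" "y = ?c v" "z = ?c w"
      by (auto simp only: carrier)
    moreover from this have "u @ v \<in> words S" "v @ w \<in> words S" by auto
    ultimately show "x \<otimes>\<^bsub>?G\<^esub> y \<otimes>\<^bsub>?G\<^esub> z = x \<otimes>\<^bsub>?G\<^esub> (y \<otimes>\<^bsub>?G\<^esub> z)"
      by (simp only: presented_group_mult append_assoc)
  next
    fix x assume "x \<in> carrier ?G"
    then obtain u where "u \<in> words S" "x = ?c u"
      by (auto simp only: carrier)
    then show "\<one>\<^bsub>?G\<^esub> \<otimes>\<^bsub>?G\<^esub> x = x" and "\<exists>y\<in>carrier ?G. y \<otimes>\<^bsub>?G\<^esub> x = \<one>\<^bsub>?G\<^esub>"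
      using presented_group_mult [of "[]" S u R] inverse [of u] by (simp_all add: one)
  qed
qed


section \<open>Right-angled Artin groups and extension graphs\<close>

definition raag_relations :: "'a pair_pre_digraph \<Rightarrow> ('a word \<times> 'a word) set" where
  "raag_relations \<Gamma> =
     {([(u, True), (v, True)], [(v, True), (u, True)]) | u v. (u, v) \<in> parcs \<Gamma>}"

definition raag :: "'a pair_pre_digraph \<Rightarrow> 'a word set monoid" where
  "raag \<Gamma> = presented_group (pverts \<Gamma>) (raag_relations \<Gamma>)"

text \<open>The element of the group represented by a vertex; a class of words.\<close>

definition raag_gen :: "'a pair_pre_digraph \<Rightarrow> 'a \<Rightarrow> 'a word set" where
  "raag_gen \<Gamma> v = presentation_cong (pverts \<Gamma>) (raag_relations \<Gamma>) `` {[(v, True)]}"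

definition conj_act :: "('g, 'b) monoid_scheme \<Rightarrow> 'g \<Rightarrow> 'g \<Rightarrow> 'g" where
  "conj_act G x g = inv\<^bsub>G\<^esub> g \<otimes>\<^bsub>G\<^esub> x \<otimes>\<^bsub>G\<^esub> g"

definition ext_verts :: "'a pair_pre_digraph \<Rightarrow> 'a word set set" where
  "ext_verts \<Gamma> = {conj_act (raag \<Gamma>) (raag_gen \<Gamma> v) g | v g. v \<in> pverts \<Gamma> \<and> g \<in> carrier (raag \<Gamma>)}"

definition extension_graph :: "'a pair_pre_digraph \<Rightarrow> 'a word set pair_pre_digraph" where
  "extension_graph \<Gamma> =
     \<lparr>pverts = ext_verts \<Gamma>,
      parcs = {(x, y). x \<in> ext_verts \<Gamma> \<and> y \<in> ext_verts \<Gamma> \<and> x \<noteq> y \<and>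
        x \<otimes>\<^bsub>raag \<Gamma>\<^esub> y = y \<otimes>\<^bsub>raag \<Gamma>\<^esub> x}\<rparr>"

definition ext_dist :: "'a pair_pre_digraph \<Rightarrow> 'a word set \<Rightarrow> 'a word set \<Rightarrow> real" where
  "ext_dist \<Gamma> x y = real_of_ereal (graph_dist (extension_graph \<Gamma>) x y)"


section \<open>Asymptotic translation lengths\<close>

text \<open>
  \<open>act x g\<close> is a right action of \<open>G\<close> on \<open>X\<close> by isometries of the metric \<open>d\<close>. The limit is
  required to be the same for all base points.
\<close>

definition asymp_translation_length ::
  "('g, 'b) monoid_scheme \<Rightarrow> 'x set \<Rightarrow> ('x \<Rightarrow> 'x \<Rightarrow> real) \<Rightarrow> ('x \<Rightarrow> 'g \<Rightarrow> 'x) \<Rightarrow> 'g \<Rightarrow> real" where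
  "asymp_translation_length G X d act g =
     (THE t. \<forall>x\<in>X. (\<lambda>k::nat. d (act x (g [^]\<^bsub>G\<^esub> k)) x / real k) \<longlonglongrightarrow> t)"

text \<open>
  The minimum of a set that is in general infinite, hence \<^const>\<open>Least\<close> rather than
  \<^const>\<open>Min\<close>: unlike an infimum, it has to be attained.
\<close>

definition min_asymp_translation_length ::
  "('g, 'b) monoid_scheme \<Rightarrow> 'x set \<Rightarrow> ('x \<Rightarrow> 'x \<Rightarrow> real) \<Rightarrow> ('x \<Rightarrow> 'g \<Rightarrow> 'x) \<Rightarrow> real" where
  "min_asymp_translation_length G X d act =
     (LEAST t. t \<in> {asymp_translation_length G X d act g | g.
        g \<in> carrier G \<and> asymp_translation_length G X d act g > 0})"

definition raag_min_translation_length :: "'a pair_pre_digraph \<Rightarrow> real" where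
  "raag_min_translation_length \<Gamma> =
     min_asymp_translation_length (raag \<Gamma>) (pverts (extension_graph \<Gamma>)) (ext_dist \<Gamma>) (conj_act (raag \<Gamma>))"

end

theory Submission
  imports Defs "HOL-Library.Sublist"
begin

text \<open>
  Throughout, \<open>\<Lambda>\<close> denotes the complement graph of \<open>\<Gamma>\<close>: two distinct
  generators are adjacent in \<open>\<Lambda>\<close> exactly if they do not commute.

  A path in the extension graph is a factorisation. Two distinct commuting conjugates
  \<open>u\<^sup>g\<close>, \<open>v\<^sup>h\<close> of generators have a common conjugator and
  \<open>u\<close>, \<open>v\<close> are adjacent (\<open>common_conjugator\<close>), and the centraliser of
  \<open>v\<close> is generated by the star of \<open>v\<close> (\<open>centralizer_letter\<close>). Hence a
  path of length \<open>m\<close> that ends at \<open>v\<^sup>g\<close> writes \<open>g\<close> as a product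
  of \<open>m + 1\<close> elements of star subgroups, and while a factor from the star of \<open>v\<close>
  is being multiplied, no letter that is a \<open>\<Lambda>\<close>-neighbour of \<open>v\<close> is
  written.

  This bounds translation lengths from below. Let \<open>l\<close> be a cyclically reduced word, and for an
  element \<open>g\<close> let the progress of \<open>x\<close> be the number of letters \<open>x\<close> in
  the longest common suffix, up to commutations, of \<open>g\<close> and a power of \<open>l\<close>.
  Factors without the letter \<open>x\<close> leave it unchanged (\<open>progress_state_mult\<close>). If
  \<open>x\<close>, \<open>y\<close> are adjacent in \<open>\<Lambda>\<close>, then the order of the letters
  \<open>x\<close>, \<open>y\<close> in the power is fixed, so the difference of their progress, counted in
  periods of \<open>l\<close>, stays in an interval of length 1 (\<open>staircase\<close>). After centring,
  the progress of the ends of a \<open>\<Lambda>\<close>-path with \<open>r\<close> edges therefore differs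
  by at most \<open>r/2\<close>. If the support of \<open>l\<close> contains such a path and every generator
  has a \<open>\<Lambda>\<close>-neighbour on it, then reading the progress at a neighbour of
  \<open>v\<close> is a function on the vertices \<open>v\<^sup>g\<close> of the extension graph with
  Lipschitz constant \<open>r/2\<close> that grows by \<open>k\<close> from \<open>v\<close> to
  \<open>v\<close> conjugated by \<open>l\<^sup>k\<close>. So the translation length of \<open>l\<close> is
  at least \<open>2/r\<close>.

  On the other hand, \<open>l\<close> has bounded orbits if some generator has no
  \<open>\<Lambda>\<close>-neighbour in its support, or if its support is a join; and an element whose
  \<open>D\<close>-th power is a product of two elements from the star subgroups of two adjacent vertices
  has translation length at most \<open>2/D\<close>. Therefore, if every remaining support contains a
  \<open>\<Lambda>\<close>-path as above with \<open>r = D\<close>, and one element has such a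
  \<open>D\<close>-th power, then the minimum exists and equals \<open>2/D\<close>
  (\<open>min_translation_length_eq\<close>).

  For \<open>n \<ge> 5\<close> this applies with \<open>D = n - 3\<close> to the following
  \<open>\<Lambda>\<close>: a path \<open>0, \<dots>, n - 1\<close> and two further vertices, one joined to
  all path vertices but \<open>2\<close>, the other to all but \<open>1\<close> and \<open>3\<close>. A
  dominating support that is not a join and avoids the two further vertices contains the whole path
  \<open>1, \<dots>, n - 2\<close>, which has \<open>n - 3\<close> edges; every other dominating support
  contains a dominating path with just two edges. The word \<open>1 2 \<cdots> (n - 2)\<close> attains the
  bound: its power of exponent \<open>n - 3\<close> is a product of two triangular words, the first without
  the last letter and the second without the first letter (\<open>path_power\<close>). For \<open>n =
  4\<close> two edges are too many. Here \<open>\<Lambda>\<close> is a pentagon with one vertex doubled, and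
  the progress is read as the average of two positions on a path with two edges, which halves the Lipschitz
  constant (\<open>averaged_cherryI\<close>).
\<close>

section \<open>Reduced words and their projections\<close>

abbreviation inv_letter :: "'a \<times> bool \<Rightarrow> 'a \<times> bool" where
  "inv_letter a \<equiv> (fst a, \<not> snd a)"

definition pair_proj :: "'a \<Rightarrow> 'a \<Rightarrow> 'a word \<Rightarrow> 'a word" where
  "pair_proj x y w = filter (\<lambda>z. fst z = x \<or> fst z = y) w"

lemma pair_proj_simps [simp]:
  "pair_proj x y [] = []"
  "pair_proj x y (a # w) = (if fst a = x \<or> fst a = y then a # pair_proj x y w else pair_proj x y w)"
  "pair_proj x y (v @ w) = pair_proj x y v @ pair_proj x y w"
  by (auto simp: pair_proj_def)

lemma pair_proj_eq_Nil: "pair_proj x y w = [] \<longleftrightarrow> (\<forall>z\<in>set w. fst z \<noteq> x \<and> fst z \<noteq> y)"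
  by (auto simp: pair_proj_def filter_empty_conv)

lemma set_pair_proj: "set (pair_proj x y w) = {z \<in> set w. fst z = x \<or> fst z = y}"
  by (auto simp: pair_proj_def)

locale commutation =
  fixes com :: "'a \<Rightarrow> 'a \<Rightarrow> bool"
  assumes com_sym: "com u v \<Longrightarrow> com v u"
    and com_irrefl: "\<not> com u u"
begin

definition reduced :: "'a word \<Rightarrow> bool" where
  "reduced w \<longleftrightarrow> \<not> (\<exists>w0 a w1 w2. w = w0 @ a # w1 @ inv_letter a # w2 \<and>
      (\<forall>z\<in>set w1. com (fst a) (fst z)))"

lemma reducedD:
  "reduced w \<Longrightarrow> w = w0 @ a # w1 @ inv_letter a # w2 \<Longrightarrow> \<forall>z\<in>set w1. com (fst a) (fst z) \<Longrightarrow> False"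
  unfolding reduced_def by blast

text \<open>
  A word up to commutations is determined by its projections to the pairs of letters that do not commute,
  the pairs \<open>(x, x)\<close> included. Group elements are handled through these families of
  projections.
\<close>

definition projs :: "'a word \<Rightarrow> 'a \<Rightarrow> 'a \<Rightarrow> 'a word" where
  "projs w = (\<lambda>x y. if com x y then [] else pair_proj x y w)"

definition on_top :: "'a \<times> bool \<Rightarrow> ('a \<Rightarrow> 'a \<Rightarrow> 'a word) \<Rightarrow> bool" where
  "on_top a P \<longleftrightarrow> (\<forall>y. \<not> com (fst a) y \<longrightarrow> (\<exists>t. P (fst a) y = a # t))"

text \<open>
  Left multiplication by a letter: it cancels if its inverse heads all projections in which it takes part,
  and is prepended otherwise.
\<close>

definition push :: "'a \<times> bool \<Rightarrow> ('a \<Rightarrow> 'a \<Rightarrow> 'a word) \<Rightarrow> 'a \<Rightarrow> 'a \<Rightarrow> 'a word" where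
  "push a P = (\<lambda>x y. if (x = fst a \<or> y = fst a) \<and> \<not> com x y
     then (if on_top (inv_letter a) P then tl (P x y) else a # P x y) else P x y)"

text \<open>
  If the letter heads all its projections, then everything before its first occurrence commutes with it: an
  earlier letter not commuting with it would head their common projection.
\<close>

lemma on_top_projs:
  "on_top a (projs w) \<longleftrightarrow> (\<exists>w1 w2. w = w1 @ a # w2 \<and> (\<forall>z\<in>set w1. com (fst a) (fst z)))"
proof
  assume top: "on_top a (projs w)"
  then obtain t where t: "pair_proj (fst a) (fst a) w = a # t"
    using com_irrefl by (auto simp: on_top_def projs_def)
  then obtain w1 w2 where w: "w = w1 @ a # w2" and w1: "\<forall>z\<in>set w1. fst z \<noteq> fst a"
    by (auto simp: pair_proj_def filter_eq_Cons_iff)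
  have "com (fst a) (fst z)" if z: "z \<in> set w1" for z
  proof (rule ccontr)
    assume nc: "\<not> com (fst a) (fst z)"
    then obtain s where s: "pair_proj (fst a) (fst z) w = a # s"
      using top by (auto simp: on_top_def projs_def)
    have "pair_proj (fst a) (fst z) w1 \<noteq> []"
      using z by (auto simp: pair_proj_eq_Nil)
    then have "hd (pair_proj (fst a) (fst z) w) \<in> set w1"
      unfolding w using hd_in_set [of "pair_proj (fst a) (fst z) w1"] by (auto simp: set_pair_proj)
    then show False using s w1 by auto
  qed
  with w show "\<exists>w1 w2. w = w1 @ a # w2 \<and> (\<forall>z\<in>set w1. com (fst a) (fst z))" by blast
next
  assume "\<exists>w1 w2. w = w1 @ a # w2 \<and> (\<forall>z\<in>set w1. com (fst a) (fst z))"
  then obtain w1 w2 where w: "w = w1 @ a # w2" and w1: "\<forall>z\<in>set w1. com (fst a) (fst z)"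
    by blast
  have "pair_proj (fst a) y w1 = []" if "\<not> com (fst a) y" for y
    using that w1 com_irrefl by (auto simp: pair_proj_eq_Nil)
  then show "on_top a (projs w)" by (auto simp: on_top_def projs_def w)
qed

lemma projs_move:
  assumes "\<forall>z\<in>set w1. com (fst a) (fst z)"
  shows "projs (w1 @ a # w2) = projs (a # w1 @ w2)"
proof -
  have "pair_proj x y w1 = []" if "\<not> com x y" "fst a = x \<or> fst a = y" for x y
    using assms that com_irrefl com_sym by (fastforce simp: pair_proj_eq_Nil)
  then show ?thesis by (auto simp: projs_def fun_eq_iff)
qed

lemma push_cons: "\<not> on_top (inv_letter a) (projs w) \<Longrightarrow> push a (projs w) = projs (a # w)"
  by (auto simp: push_def projs_def fun_eq_iff)

lemma push_cancel:
  assumes "\<forall>z\<in>set w1. com (fst a) (fst z)"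
  shows "push a (projs (w1 @ inv_letter a # w2)) = projs (w1 @ w2)"
proof -
  have "on_top (inv_letter a) (projs (w1 @ inv_letter a # w2))"
    using assms unfolding on_top_projs by auto
  moreover have "projs (w1 @ inv_letter a # w2) = projs (inv_letter a # w1 @ w2)"
    using assms by (intro projs_move) auto
  ultimately show ?thesis
    by (auto simp: push_def fun_eq_iff) (auto simp: projs_def)
qed

lemma reduced_Nil [simp]: "reduced []"
  by (simp add: reduced_def)

lemma reduced_append: "reduced (v @ w) \<Longrightarrow> reduced v \<and> reduced w"
  unfolding reduced_def by (metis append.assoc append_Cons)

lemma reduced_Cons:
  "reduced (a # w) \<longleftrightarrow> reduced w \<and> \<not> on_top (inv_letter a) (projs w)"
proof
  assume r: "reduced (a # w)"
  then have "reduced w" using reduced_append [of "[a]" w] by simp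
  moreover have "\<not> on_top (inv_letter a) (projs w)"
    using r unfolding on_top_projs reduced_def by (metis append_Nil fst_conv)
  ultimately show "reduced w \<and> \<not> on_top (inv_letter a) (projs w)" ..
next
  assume r: "reduced w \<and> \<not> on_top (inv_letter a) (projs w)"
  show "reduced (a # w)" unfolding reduced_def
  proof clarify
    fix w0 u b w1 w2
    assume eq: "a # w = w0 @ (u, b) # w1 @ inv_letter (u, b) # w2"
      and c: "\<forall>z\<in>set w1. com (fst (u, b)) (fst z)"
    show False
    proof (cases w0)
      case Nil
      then show False using r eq c unfolding on_top_projs by auto
    next
      case (Cons a' w0')
      then have "w = w0' @ (u, b) # w1 @ inv_letter (u, b) # w2" using eq by simp
      then show False using r c by (blast dest: reducedD)
    qed
  qed
qed

lemma reduced_rev: "reduced (rev w) \<longleftrightarrow> reduced w"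
proof -
  have "reduced (rev w)" if r: "reduced w" for w
    unfolding reduced_def
  proof clarify
    fix w0 u b w1 w2
    assume eq: "rev w = w0 @ (u, b) # w1 @ inv_letter (u, b) # w2"
      and c: "\<forall>z\<in>set w1. com (fst (u, b)) (fst z)"
    from arg_cong [OF eq, of rev]
    have "w = rev w2 @ (u, \<not> b) # rev w1 @ inv_letter (u, \<not> b) # rev w0" by simp
    then show False using r c unfolding reduced_def by (metis fst_conv set_rev)
  qed
  from this [of w] this [of "rev w"] show ?thesis by auto
qed

lemma reduced_remove:
  assumes r: "reduced (w1 @ a # w2)" and c: "\<forall>z\<in>set w1. com (fst a) (fst z)"
  shows "reduced (w1 @ w2)"
  using assms
proof (induction w1)
  case Nil
  then show ?case using reduced_append [of "[a]"] by simp
next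
  case (Cons z w1)
  have red: "reduced (w1 @ w2)" using Cons by (auto simp: reduced_Cons)
  have "\<not> on_top (inv_letter z) (projs (w1 @ w2))"
  proof
    assume "on_top (inv_letter z) (projs (w1 @ w2))"
    moreover have "projs (w1 @ a # w2) = projs (a # w1 @ w2)"
      using Cons.prems by (intro projs_move) auto
    moreover have "com (fst z) (fst a)" using Cons.prems com_sym by auto
    ultimately have "on_top (inv_letter z) (projs (w1 @ a # w2))"
      by (auto simp: on_top_def projs_def com_irrefl)
    then show False using Cons.prems by (simp add: reduced_Cons)
  qed
  with red show ?case by (simp add: reduced_Cons)
qed

text \<open>
  On projections of words that are not reduced, pushing a letter and then its inverse may fail to be
  the identity: with \<open>a'\<close> the inverse of \<open>a\<close>, pushing \<open>a\<close> and then
  \<open>a'\<close> onto \<open>a' a\<close> leaves nothing. This is why the action is restricted to reduced words.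
\<close>

definition states :: "('a \<Rightarrow> 'a \<Rightarrow> 'a word) set" where
  "states = projs ` Collect reduced"

lemma push_states:
  assumes "P \<in> states"
  shows "push a P \<in> states"
proof -
  obtain w where w: "reduced w" and P: "P = projs w" using assms by (auto simp: states_def)
  show ?thesis
  proof (cases "on_top (inv_letter a) P")
    case True
    then obtain w1 w2 where e: "w = w1 @ inv_letter a # w2" "\<forall>z\<in>set w1. com (fst a) (fst z)"
      unfolding P on_top_projs by auto
    then have "reduced (w1 @ w2)" using w reduced_remove [of w1 "inv_letter a" w2] by simp
    moreover have "push a P = projs (w1 @ w2)" unfolding P e(1) by (rule push_cancel [OF e(2)])
    ultimately show ?thesis by (auto simp: states_def)
  next
    case False
    then show ?thesis using w push_cons [of a w] reduced_Cons [of a w] unfolding P states_def by auto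
  qed
qed

text \<open>
  Suppose that \<open>a\<close> is on top, so that the inverse removes it. Pushing \<open>a\<close> back moves it to
  the front past letters that commute with it, which does not change the projections. It cannot cancel
  then, since otherwise the original word would not have been reduced.
\<close>

lemma push_push_inv:
  assumes "P \<in> states"
  shows "push a (push (inv_letter a) P) = P"
proof -
  obtain w where w: "reduced w" and P: "P = projs w" using assms by (auto simp: states_def)
  show ?thesis
  proof (cases "on_top a P")
    case True
    then obtain w1 w2 where e: "w = w1 @ a # w2" and c: "\<forall>z\<in>set w1. com (fst a) (fst z)"
      unfolding P on_top_projs by auto
    have Q: "push (inv_letter a) P = projs (w1 @ w2)"
      using push_cancel [of w1 "inv_letter a" w2] c unfolding P e by simp
    have m: "projs w = projs (a # w1 @ w2)" unfolding e by (rule projs_move [OF c])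
    have "\<not> on_top (inv_letter a) (projs (w1 @ w2))"
    proof
      assume "on_top (inv_letter a) (projs (w1 @ w2))"
      then obtain m1 m2 where m: "w1 @ w2 = m1 @ inv_letter a # m2" "\<forall>z\<in>set m1. com (fst a) (fst z)"
        unfolding on_top_projs by auto
      have "inv_letter a \<notin> set w1" using c com_irrefl by fastforce
      then obtain m' where "w2 = m' @ inv_letter a # m2" "m1 = w1 @ m'"
        using m(1) by (auto simp: append_eq_append_conv2 Cons_eq_append_conv append_eq_Cons_conv)
      then have "w = w1 @ a # m' @ inv_letter a # m2" "\<forall>z\<in>set m'. com (fst a) (fst z)"
        using e m(2) by auto
      moreover have "reduced (a # m' @ inv_letter a # m2)"
        using w reduced_append [of w1] calculation(1) by auto
      ultimately show False using reducedD [of _ "[]" a m' m2] by simp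
    qed
    then show ?thesis unfolding Q using push_cons m P by simp
  next
    case False
    then have "push (inv_letter a) P = projs (inv_letter a # w)"
      unfolding P using push_cons [of "inv_letter a" w] by simp
    then show ?thesis using push_cancel [of "[]" a w] P by simp
  qed
qed

text \<open>
  Commuting letters are never projected together, so the two operations modify disjoint sets of pairs, and
  neither affects the test made by the other.
\<close>

lemma push_commute:
  assumes "com (fst a) (fst b)"
  shows "push a (push b P) = push b (push a P)"
proof -
  have n: "\<not> com (fst a) y \<Longrightarrow> y \<noteq> fst b" "\<not> com (fst b) y \<Longrightarrow> y \<noteq> fst a"
    "\<not> com y (fst a) \<Longrightarrow> y \<noteq> fst b" "\<not> com y (fst b) \<Longrightarrow> y \<noteq> fst a" "fst a \<noteq> fst b" for y
    using assms com_sym com_irrefl by auto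
  have "on_top c (push b P) = on_top c P" if "fst c = fst a" for c
    using n that by (auto simp: on_top_def push_def)
  moreover have "on_top c (push a P) = on_top c P" if "fst c = fst b" for c
    using n that by (auto simp: on_top_def push_def)
  ultimately have t: "on_top (inv_letter a) (push b P) = on_top (inv_letter a) P"
    "on_top (inv_letter b) (push a P) = on_top (inv_letter b) P" by auto
  show ?thesis
  proof (intro ext)
    fix x y
    show "push a (push b P) x y = push b (push a P) x y"
      unfolding push_def [of a "push b P"] push_def [of b "push a P"] t
      using n unfolding push_def by auto
  qed
qed

lemma foldr_push_states: "P \<in> states \<Longrightarrow> foldr push w P \<in> states"
  by (induction w) (auto intro: push_states)

lemma foldr_push_reduced: "reduced w \<Longrightarrow> foldr push w (projs []) = projs w"
  by (induction w) (auto simp: reduced_Cons push_cons)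

lemma projs_Nil_states: "projs [] \<in> states"
  by (auto simp: states_def)

end

section \<open>Classes of words in a right-angled Artin group\<close>

abbreviation inv_word :: "'a word \<Rightarrow> 'a word" where
  "inv_word w \<equiv> rev (map inv_letter w)"

lemma (in group) commute_inv:
  assumes "x \<in> carrier G" "y \<in> carrier G" "x \<otimes> y = y \<otimes> x"
  shows "inv x \<otimes> y = y \<otimes> inv x"
proof -
  have "x \<otimes> (y \<otimes> inv x) = y"
    using assms by (simp add: m_assoc [symmetric]) (simp add: m_assoc)
  then have "y \<otimes> inv x = inv x \<otimes> y"
    using assms by (subst inv_solve_left) auto
  then show ?thesis by simp
qed

lemma (in group) conj_act_mult:
  assumes "x \<in> carrier G" "g \<in> carrier G" "h \<in> carrier G"
  shows "conj_act G x (g \<otimes> h) = conj_act G (conj_act G x g) h"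
  using assms by (simp add: conj_act_def inv_mult_group m_assoc)

lemma (in group) conj_act_closed [simp]:
  "x \<in> carrier G \<Longrightarrow> g \<in> carrier G \<Longrightarrow> conj_act G x g \<in> carrier G"
  by (simp add: conj_act_def)

lemma (in group) conj_act_one [simp]: "x \<in> carrier G \<Longrightarrow> conj_act G x \<one> = x"
  by (simp add: conj_act_def)

lemma (in group) conj_act_hom:
  assumes "x \<in> carrier G" "y \<in> carrier G" "g \<in> carrier G"
  shows "conj_act G (x \<otimes> y) g = conj_act G x g \<otimes> conj_act G y g"
  using assms by (simp add: conj_act_def m_assoc) (simp add: m_assoc [symmetric])

lemma (in group) conj_act_eq_iff:
  assumes "x \<in> carrier G" "y \<in> carrier G" "g \<in> carrier G"
  shows "conj_act G x g = conj_act G y g \<longleftrightarrow> x = y"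
  using assms by (auto simp: conj_act_def)

lemma (in group) conj_act_fixed_iff:
  assumes "x \<in> carrier G" "g \<in> carrier G"
  shows "conj_act G x g = x \<longleftrightarrow> x \<otimes> g = g \<otimes> x"
proof -
  have "inv g \<otimes> (x \<otimes> g) = x \<longleftrightarrow> x \<otimes> g = g \<otimes> x"
    using assms by (subst eq_commute, subst inv_solve_left) auto
  then show ?thesis using assms by (simp add: conj_act_def m_assoc)
qed

sublocale pair_graph \<subseteq> commutation "\<lambda>u v. (u, v) \<in> parcs G"
  by unfold_locales (auto intro: arcs_symmetric dest: no_loops')

context pair_graph
begin

abbreviation com :: "'a \<Rightarrow> 'a \<Rightarrow> bool" where
  "com u v \<equiv> (u, v) \<in> parcs G"

abbreviation Wds :: "'a word set" where
  "Wds \<equiv> words (pverts G)"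

abbreviation A :: "'a word set monoid" where
  "A \<equiv> raag G"

definition cls :: "'a word \<Rightarrow> 'a word set" where
  "cls w = presentation_cong (pverts G) (raag_relations G) `` {w}"

sublocale A: group "raag G"
  unfolding raag_def by (rule group_presented_group)

lemma cls_closed [simp]: "w \<in> Wds \<Longrightarrow> cls w \<in> carrier A"
  by (auto simp: cls_def raag_def presented_group_def quotient_def)

lemma carrier_cls: "x \<in> carrier A \<Longrightarrow> \<exists>w\<in>Wds. x = cls w"
  by (auto simp: cls_def raag_def presented_group_def quotient_def)

lemma cls_append: "u \<in> Wds \<Longrightarrow> v \<in> Wds \<Longrightarrow> cls (u @ v) = cls u \<otimes>\<^bsub>A\<^esub> cls v"
  unfolding cls_def raag_def by (rule presented_group_mult [symmetric])

lemma cls_Nil: "cls [] = \<one>\<^bsub>A\<^esub>"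
  by (simp add: cls_def raag_def presented_group_def)

lemma cls_Cons: "a # w \<in> Wds \<Longrightarrow> cls (a # w) = cls [a] \<otimes>\<^bsub>A\<^esub> cls w"
  using cls_append [of "[a]" w] by simp

lemma cls_eq_iff:
  "u \<in> Wds \<Longrightarrow> v \<in> Wds \<Longrightarrow>
    cls u = cls v \<longleftrightarrow> (u, v) \<in> presentation_cong (pverts G) (raag_relations G)"
  unfolding cls_def by (rule eq_equiv_class_iff [OF equiv_presentation_cong])

lemma inv_word_Wds [simp]: "w \<in> Wds \<Longrightarrow> inv_word w \<in> Wds"
  by (induction w) auto

lemma cls_inv_word:
  assumes "w \<in> Wds"
  shows "cls (inv_word w) = inv\<^bsub>A\<^esub> cls w"
proof -
  have "(\<lambda>(s, b). (s, \<not> b)) = (inv_letter :: 'a \<times> bool \<Rightarrow> 'a \<times> bool)" by auto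
  then have "cls (inv_word w @ w) = cls []"
    using presentation_cong_inverse [OF assms, of "raag_relations G"] assms
    by (subst cls_eq_iff) (auto simp del: rev_map)
  then have "cls (inv_word w) \<otimes>\<^bsub>A\<^esub> cls w = \<one>\<^bsub>A\<^esub>"
    using assms by (simp add: cls_append cls_Nil del: rev_map)
  then show ?thesis using assms by (intro A.inv_equality [symmetric]) auto
qed

lemma cls_inv_letter: "fst a \<in> pverts G \<Longrightarrow> cls [inv_letter a] = inv\<^bsub>A\<^esub> cls [a]"
  using cls_inv_word [of "[a]"] by (cases a) auto

lemma pow_Wds [simp]: "w \<in> Wds \<Longrightarrow> concat (replicate k w) \<in> Wds"
  by (induction k) auto

lemma cls_pow: "w \<in> Wds \<Longrightarrow> cls w [^]\<^bsub>A\<^esub> (k::nat) = cls (concat (replicate k w))"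
proof (induction k)
  case 0
  then show ?case by (simp add: cls_Nil)
next
  case (Suc k)
  then show ?case using pow_Wds [OF Suc.prems, of k]
    by (simp only: A.nat_pow_Suc2 cls_closed replicate_Suc concat.simps cls_append)
qed

lemma raag_gen_cls: "raag_gen G v = cls [(v, True)]"
  by (simp add: raag_gen_def cls_def)

text \<open>
  The relations only concern positive letters; in a group, commuting passes to inverses.
\<close>

lemma cls_letters_commute:
  assumes ab: "com (fst a) (fst b) \<or> fst a = fst b" and v: "fst a \<in> pverts G" "fst b \<in> pverts G"
  shows "cls [a] \<otimes>\<^bsub>A\<^esub> cls [b] = cls [b] \<otimes>\<^bsub>A\<^esub> cls [a]"
proof -
  let ?p = "\<lambda>c. cls [(fst c, True)]"
  have W: "[(fst a, True)] \<in> Wds" "[(fst b, True)] \<in> Wds" using v by auto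
  have pos: "?p a \<otimes>\<^bsub>A\<^esub> ?p b = ?p b \<otimes>\<^bsub>A\<^esub> ?p a"
  proof (cases "fst a = fst b")
    case False
    then have "com (fst a) (fst b)" using ab by simp
    then have "cls ([(fst a, True)] @ [(fst b, True)]) = cls ([(fst b, True)] @ [(fst a, True)])"
      using v by (subst cls_eq_iff) (auto intro!: presentation_cong.relation simp: raag_relations_def)
    then show ?thesis using W by (simp only: cls_append)
  qed simp
  have neg: "cls [c] = ?p c \<or> cls [c] = inv\<^bsub>A\<^esub> ?p c" if "fst c \<in> pverts G" for c
    using that cls_inv_letter [of "(fst c, True)"] by (cases c; cases "snd c") auto
  have c: "?p a \<in> carrier A" "?p b \<in> carrier A" using W by auto
  have l: "inv\<^bsub>A\<^esub> ?p a \<otimes>\<^bsub>A\<^esub> ?p b = ?p b \<otimes>\<^bsub>A\<^esub> inv\<^bsub>A\<^esub> ?p a"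
    using A.commute_inv [OF c pos] .
  have r: "inv\<^bsub>A\<^esub> ?p b \<otimes>\<^bsub>A\<^esub> ?p a = ?p a \<otimes>\<^bsub>A\<^esub> inv\<^bsub>A\<^esub> ?p b"
    using A.commute_inv [OF c(2) c(1) pos [symmetric]] .
  have lr: "inv\<^bsub>A\<^esub> ?p a \<otimes>\<^bsub>A\<^esub> inv\<^bsub>A\<^esub> ?p b = inv\<^bsub>A\<^esub> ?p b \<otimes>\<^bsub>A\<^esub> inv\<^bsub>A\<^esub> ?p a"
    using A.commute_inv [OF c(1) A.inv_closed [OF c(2)] r [symmetric]] .
  show ?thesis using neg [OF v(1)] neg [OF v(2)] pos l r lr by auto
qed

lemma cls_commute:
  assumes "u \<in> Wds" "w \<in> Wds" "\<forall>a\<in>set u. \<forall>b\<in>set w. com (fst a) (fst b) \<or> fst a = fst b"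
  shows "cls u \<otimes>\<^bsub>A\<^esub> cls w = cls w \<otimes>\<^bsub>A\<^esub> cls u"
proof -
  have letter: "cls [a] \<otimes>\<^bsub>A\<^esub> cls w = cls w \<otimes>\<^bsub>A\<^esub> cls [a]"
    if "fst a \<in> pverts G" "w \<in> Wds" "\<forall>b\<in>set w. com (fst a) (fst b) \<or> fst a = fst b" for a w
    using that(2,3)
  proof (induction w rule: list.induct)
    case Nil
    then show ?case using that(1) by (cases a) (simp add: cls_Nil)
  next
    case (Cons b w)
    have W: "[a] \<in> Wds" "[b] \<in> Wds" "w \<in> Wds" using that(1) Cons.prems by (cases a, auto)
    have "cls [a] \<otimes>\<^bsub>A\<^esub> cls [b] = cls [b] \<otimes>\<^bsub>A\<^esub> cls [a]"
      using Cons.prems that(1) by (intro cls_letters_commute) auto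
    moreover have "cls [a] \<otimes>\<^bsub>A\<^esub> cls w = cls w \<otimes>\<^bsub>A\<^esub> cls [a]"
      using Cons by auto
    ultimately show ?case using W unfolding cls_Cons [OF Cons.prems(1)]
      by (metis A.m_assoc cls_closed)
  qed
  show ?thesis using assms
  proof (induction u rule: list.induct)
    case Nil
    then show ?case by (simp add: cls_Nil)
  next
    case (Cons a u)
    have W: "[a] \<in> Wds" "u \<in> Wds" using Cons.prems by auto
    have "cls [a] \<otimes>\<^bsub>A\<^esub> cls w = cls w \<otimes>\<^bsub>A\<^esub> cls [a]"
      using Cons.prems by (intro letter) auto
    moreover have "cls u \<otimes>\<^bsub>A\<^esub> cls w = cls w \<otimes>\<^bsub>A\<^esub> cls u"
      using Cons by auto
    ultimately show ?case using W Cons.prems(2) unfolding cls_Cons [OF Cons.prems(1)]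
      by (metis A.m_assoc cls_closed)
  qed
qed

lemma cls_cancel:
  assumes "w1 \<in> Wds" "fst a \<in> pverts G" "\<forall>z\<in>set w1. com (fst a) (fst z) \<or> fst a = fst z"
  shows "cls (a # w1 @ [inv_letter a]) = cls w1"
proof -
  have W: "[a] \<in> Wds" "[inv_letter a] \<in> Wds" using assms(2) by (cases a, auto)+
  have "cls (a # w1 @ [inv_letter a]) = (cls [a] \<otimes>\<^bsub>A\<^esub> cls w1) \<otimes>\<^bsub>A\<^esub> inv\<^bsub>A\<^esub> cls [a]"
    using W assms cls_append [of "[a] @ w1" "[inv_letter a]"] cls_append [of "[a]" w1]
    by (simp add: cls_inv_letter)
  also have "cls [a] \<otimes>\<^bsub>A\<^esub> cls w1 = cls w1 \<otimes>\<^bsub>A\<^esub> cls [a]"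
    using assms W by (intro cls_commute) auto
  finally show ?thesis using W assms(1) by (simp add: A.m_assoc)
qed

lemma shorten:
  assumes w: "w \<in> Wds" and nr: "\<not> reduced w"
  shows "\<exists>w'\<in>Wds. cls w' = cls w \<and> length w' < length w \<and> set w' \<subseteq> set w"
proof -
  obtain w0 a w1 w2 where e: "w = w0 @ a # w1 @ inv_letter a # w2"
    and c: "\<forall>z\<in>set w1. com (fst a) (fst z)"
    using nr unfolding reduced_def by blast
  have W: "w0 \<in> Wds" "w1 \<in> Wds" "w2 \<in> Wds" "fst a \<in> pverts G" using w e by auto
  then have W': "a # w1 @ [inv_letter a] \<in> Wds" by (cases a) auto
  have "cls w = cls (w0 @ (a # w1 @ [inv_letter a]) @ w2)" by (simp add: e)
  also have "\<dots> = cls w0 \<otimes>\<^bsub>A\<^esub> (cls w1 \<otimes>\<^bsub>A\<^esub> cls w2)"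
    using cls_append [OF W(1), of "(a # w1 @ [inv_letter a]) @ w2"] cls_append [OF W' W(3)] W W'
      cls_cancel [OF W(2,4)] c by simp
  also have "\<dots> = cls (w0 @ w1 @ w2)" using W by (simp add: cls_append)
  finally show ?thesis using W e by (intro bexI [of _ "w0 @ w1 @ w2"]) auto
qed

lemma reduced_representative:
  assumes "w \<in> Wds"
  shows "\<exists>w'\<in>Wds. reduced w' \<and> cls w' = cls w \<and> length w' \<le> length w \<and> set w' \<subseteq> set w"
  using assms
proof (induction "length w" arbitrary: w rule: less_induct)
  case less
  show ?case
  proof (cases "reduced w")
    case True
    then show ?thesis using less.prems by blast
  next
    case False
    then obtain w' where w': "w' \<in> Wds" "cls w' = cls w" "length w' < length w" "set w' \<subseteq> set w"
      using shorten [OF less.prems] by blast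
    obtain w'' where "w'' \<in> Wds" "reduced w''" "cls w'' = cls w'"
      "length w'' \<le> length w'" "set w'' \<subseteq> set w'"
      using less.hyps [OF w'(3,1)] by blast
    then show ?thesis using w' by (intro bexI [of _ w'']) auto
  qed
qed

text \<open>
  The defining relations hold for the action by \<open>push\<close>, so the group acts on
  \<open>states\<close>. As a reduced word sends the empty state to its own projections, these depend on the
  group element only.
\<close>

lemma cong_foldr_push:
  assumes "(u, v) \<in> presentation_cong (pverts G) (raag_relations G)" "P \<in> states"
  shows "foldr push u P = foldr push v P"
  using assms
proof (induction arbitrary: P)
  case (append u u' v v')
  then show ?case using foldr_push_states by auto
next
  case (cancel s b)
  then show ?case using push_push_inv [of P "(s, b)"] by simp
next
  case (relation l r)
  then obtain x y where "com x y" "l = [(x, True), (y, True)]" "r = [(y, True), (x, True)]"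
    by (auto simp: raag_relations_def)
  then show ?case using push_commute [of "(x, True)" "(y, True)" P] by simp
qed auto

lemma cls_foldr_push:
  "u \<in> Wds \<Longrightarrow> v \<in> Wds \<Longrightarrow> cls u = cls v \<Longrightarrow> P \<in> states \<Longrightarrow> foldr push u P = foldr push v P"
  using cls_eq_iff [of u v] cong_foldr_push [of u v P] by simp

lemma reduced_cls_projs:
  "u \<in> Wds \<Longrightarrow> v \<in> Wds \<Longrightarrow> cls u = cls v \<Longrightarrow> reduced u \<Longrightarrow> reduced v \<Longrightarrow> projs u = projs v"
  using cls_foldr_push [of u v "projs []"] foldr_push_reduced [of u] foldr_push_reduced [of v]
    projs_Nil_states by simp

lemma reduced_cls_pair_proj:
  assumes "u \<in> Wds" "v \<in> Wds" "cls u = cls v" "reduced u" "reduced v" "\<not> com x y"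
  shows "pair_proj x y u = pair_proj x y v"
  using reduced_cls_projs [OF assms(1-5)] assms(6) by (auto simp: projs_def fun_eq_iff split: if_splits)

end

section \<open>Centralisers and conjugates of generators\<close>

lemma Cons_eq_snoc_set: "b # X = X @ [b] \<Longrightarrow> set X \<subseteq> {b}"
  by (induction X) auto

context commutation
begin

lemma reduced_Cons_cases:
  assumes "reduced w"
  obtains "reduced (a # w)"
  | w1 w2 where "w = w1 @ inv_letter a # w2" "\<forall>z\<in>set w1. com (fst a) (fst z)"
  using assms unfolding reduced_Cons on_top_projs by auto

lemma reduced_snoc_cases:
  assumes "reduced w"
  obtains "reduced (w @ [a])"
  | w1 w2 where "w = w1 @ inv_letter a # w2" "\<forall>z\<in>set w2. com (fst a) (fst z)"
proof -
  have "reduced (rev w)" using assms reduced_rev by blast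
  then show ?thesis
  proof (cases rule: reduced_Cons_cases [of _ a])
    case 1
    then show ?thesis using that(1) reduced_rev [of "w @ [a]"] by simp
  next
    case (2 w1 w2)
    from arg_cong [OF 2(1), of rev] show ?thesis using that(2) [of "rev w2" "rev w1"] 2(2) by simp
  qed
qed

lemma reduced_remove_right:
  assumes "reduced (w1 @ a # w2)" "\<forall>z\<in>set w2. com (fst a) (fst z)"
  shows "reduced (w1 @ w2)"
  using reduced_remove [of "rev w2" a "rev w1"] assms reduced_rev [of "w1 @ a # w2"]
    reduced_rev [of "w1 @ w2"] by simp

text \<open>
  A cancellation in a product of two reduced words crosses the border between them.
\<close>

lemma reduced_append_cases:
  assumes "reduced u" "reduced w"
  obtains "reduced (u @ w)"
  | u1 a u2 w1 w2 where "u = u1 @ a # u2" "w = w1 @ inv_letter a # w2"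
      "\<forall>z\<in>set u2 \<union> set w1. com (fst a) (fst z)"
proof -
  have "reduced (u @ w) \<or> (\<exists>u1 a u2 w1 w2. u = u1 @ a # u2 \<and> w = w1 @ inv_letter a # w2 \<and>
      (\<forall>z\<in>set u2 \<union> set w1. com (fst a) (fst z)))" (is "_ \<or> ?Q u")
    using assms(1)
  proof (induction u)
    case Nil
    then show ?case using assms(2) by simp
  next
    case (Cons c u)
    then have r: "reduced u" by (simp add: reduced_Cons)
    show ?case
    proof (cases "reduced (u @ w)")
      case True
      then show ?thesis
      proof (cases rule: reduced_Cons_cases [of _ c])
        case (2 m1 m2)
        show ?thesis
        proof (cases "\<exists>m'. u = m1 @ inv_letter c # m'")
          case True
          then show ?thesis using Cons.prems 2(2) by (auto simp: reduced_Cons on_top_projs)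
        next
          case False
          then obtain m' where "m1 = u @ m'" "w = m' @ inv_letter c # m2"
            using 2(1) by (auto simp: append_eq_append_conv2 Cons_eq_append_conv append_eq_Cons_conv)
          then have "c # u = [] @ c # u \<and> w = m' @ inv_letter c # m2 \<and>
              (\<forall>z\<in>set u \<union> set m'. com (fst c) (fst z))" using 2(2) by auto
          then show ?thesis by blast
        qed
      qed simp
    next
      case False
      then have "?Q u" using Cons.IH r by blast
      then obtain u1 a u2 w1 w2 where "u = u1 @ a # u2" "w = w1 @ inv_letter a # w2"
        "\<forall>z\<in>set u2 \<union> set w1. com (fst a) (fst z)" by blast
      then have "c # u = (c # u1) @ a # u2 \<and> w = w1 @ inv_letter a # w2 \<and>
        (\<forall>z\<in>set u2 \<union> set w1. com (fst a) (fst z))" by simp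
      then show ?thesis by blast
    qed
  qed
  then show ?thesis using that by blast
qed

lemma reduced_inv_word: "reduced (inv_word w) \<longleftrightarrow> reduced w"
proof -
  have "reduced (map inv_letter w)" if "reduced w" for w :: "'a word"
    unfolding reduced_def
  proof clarify
    fix w0 u b w1 w2
    assume eq: "map inv_letter w = w0 @ (u, b) # w1 @ inv_letter (u, b) # w2"
      and c: "\<forall>z\<in>set w1. com (fst (u, b)) (fst z)"
    from arg_cong [OF eq, of "map inv_letter"]
    have "w = map inv_letter w0 @ (u, \<not> b) # map inv_letter w1 @ inv_letter (u, \<not> b) # map inv_letter w2"
      by (simp add: comp_def)
    from reducedD [OF that this] c show False by simp
  qed
  from this [of w] this [of "map inv_letter w"] have "reduced (map inv_letter w) \<longleftrightarrow> reduced w"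
    by (auto simp: comp_def)
  then show ?thesis by (simp add: reduced_rev)
qed

end

context pair_graph
begin

text \<open>
  Multiplying by \<open>a\<close> on the left adds or removes one letter at the front of each projection in
  which \<open>a\<close> takes part, multiplying on the right does so at the back. For the two to give the
  same result, the projection must be a power of \<open>a\<close>, so it contains no letter that does not
  commute with \<open>a\<close>.
\<close>

lemma centralizer_letter:
  assumes w: "w \<in> Wds" and r: "reduced w" and a: "fst a \<in> pverts G"
    and comm: "cls [a] \<otimes>\<^bsub>A\<^esub> cls w = cls w \<otimes>\<^bsub>A\<^esub> cls [a]"
    and z: "z \<in> set w"
  shows "fst z = fst a \<or> com (fst a) (fst z)"
proof (rule ccontr)
  assume n: "\<not> (fst z = fst a \<or> com (fst a) (fst z))"
  let ?p = "pair_proj (fst a) (fst z)"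
  have aW: "[a] \<in> Wds" using a by (cases a) auto
  obtain u where u: "u \<in> Wds" "reduced u" "cls u = cls [a] \<otimes>\<^bsub>A\<^esub> cls w"
    "?p u = a # ?p w \<or> ?p w = inv_letter a # ?p u"
    using r
  proof (cases rule: reduced_Cons_cases [of _ a])
    case 1
    then show ?thesis using that [of "a # w"] w aW cls_Cons [of a w] by auto
  next
    case (2 w1 w2)
    have nil: "?p w1 = []" using 2(2) n com_irrefl by (auto simp: pair_proj_eq_Nil)
    have W: "w1 \<in> Wds" "w2 \<in> Wds" "[inv_letter a] \<in> Wds" "a # w1 @ [inv_letter a] \<in> Wds"
      using w 2(1) aW by auto
    have "cls [a] \<otimes>\<^bsub>A\<^esub> cls w = cls ((a # w1 @ [inv_letter a]) @ w2)"
      using w aW 2(1) cls_Cons [of a w] by simp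
    also have "\<dots> = cls (w1 @ w2)"
      using cls_append [OF W(4) W(2)] cls_append [OF W(1) W(2)] cls_cancel [OF W(1) a] 2(2) by simp
    finally have "cls (w1 @ w2) = cls [a] \<otimes>\<^bsub>A\<^esub> cls w" by simp
    moreover have "reduced (w1 @ w2)" using r 2 reduced_remove [of w1 "inv_letter a" w2] by simp
    ultimately show ?thesis using that [of "w1 @ w2"] W 2(1) nil by simp
  qed
  obtain u' where u': "u' \<in> Wds" "reduced u'" "cls u' = cls w \<otimes>\<^bsub>A\<^esub> cls [a]"
    "?p u' = ?p w @ [a] \<or> ?p w = ?p u' @ [inv_letter a]"
    using r
  proof (cases rule: reduced_snoc_cases [of _ a])
    case 1
    then show ?thesis using that [of "w @ [a]"] w aW cls_append [of w "[a]"] by auto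
  next
    case (2 w1 w2)
    have nil: "?p w2 = []" using 2(2) n com_irrefl by (auto simp: pair_proj_eq_Nil)
    have W: "w1 \<in> Wds" "w2 \<in> Wds" "[inv_letter a] \<in> Wds" "inv_letter a # w2 @ [a] \<in> Wds"
      using w 2(1) aW by auto
    have "cls w \<otimes>\<^bsub>A\<^esub> cls [a] = cls (w1 @ (inv_letter a # w2 @ [a]))"
      using w aW 2(1) cls_append [of w "[a]"] by simp
    also have "\<dots> = cls (w1 @ w2)"
      using W cls_cancel [of w2 "inv_letter a"] 2(2) a by (simp add: cls_append)
    finally have "cls (w1 @ w2) = cls w \<otimes>\<^bsub>A\<^esub> cls [a]" by simp
    moreover have "reduced (w1 @ w2)" using r 2 reduced_remove_right [of w1 "inv_letter a" w2] by simp
    ultimately show ?thesis using that [of "w1 @ w2"] W 2(1) nil by simp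
  qed
  have eq: "?p u = ?p u'"
    using reduced_cls_pair_proj [OF u(1) u'(1) _ u(2) u'(2)] u(3) u'(3) comm n by simp
  have "\<exists>b. fst b = fst a \<and> set (?p w) \<subseteq> {b}"
    using u(4) u'(4)
  proof (elim disjE)
    assume "?p u = a # ?p w" "?p u' = ?p w @ [a]"
    then have "set (?p w) \<subseteq> {a}"
      using eq Cons_eq_snoc_set [of a "?p w"] by simp
    then show ?thesis by blast
  next
    assume "?p w = inv_letter a # ?p u" "?p w = ?p u' @ [inv_letter a]"
    then have "set (?p w) \<subseteq> {inv_letter a}"
      using eq Cons_eq_snoc_set [of "inv_letter a" "?p u"] by auto
    then show ?thesis by (metis fst_conv)
  next
    \<comment> \<open>one side grows and the other shrinks: the lengths do not match\<close>
    assume a: "?p u = a # ?p w" "?p w = ?p u' @ [inv_letter a]"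
    have "length (?p u) = length (?p u')" using eq by simp
    then show ?thesis unfolding a(1) by (simp add: a(2))
  next
    assume a: "?p w = inv_letter a # ?p u" "?p u' = ?p w @ [a]"
    have "length (?p u) = length (?p u')" using eq by simp
    then show ?thesis unfolding a(2) by (simp add: a(1))
  qed
  moreover have "z \<in> set (?p w)" using z by (simp add: set_pair_proj)
  ultimately show False using n by auto
qed

abbreviation vtx :: "'a \<Rightarrow> 'a word set \<Rightarrow> 'a word set" where
  "vtx v g \<equiv> conj_act A (raag_gen G v) g"

lemma gen_closed [simp]: "v \<in> pverts G \<Longrightarrow> raag_gen G v \<in> carrier A"
  by (simp add: raag_gen_cls)

lemma cls_conj: "w \<in> Wds \<Longrightarrow> v \<in> pverts G \<Longrightarrow>
    vtx v (cls w) = cls (inv_word w @ [(v, True)] @ w)"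
  using cls_append [of "inv_word w" "[(v, True)] @ w"] cls_append [of "[(v, True)]" w]
  by (simp add: conj_act_def raag_gen_cls cls_inv_word A.m_assoc del: rev_map)

lemma cls_extract:
  assumes w: "l1 @ e # l2 \<in> Wds" and c: "\<forall>z\<in>set l1. com (fst e) (fst z)"
  shows "cls (l1 @ e # l2) = cls [e] \<otimes>\<^bsub>A\<^esub> cls (l1 @ l2)"
proof -
  have W: "l1 \<in> Wds" "[e] \<in> Wds" "l2 \<in> Wds" using w by auto
  have "cls (l1 @ e # l2) = (cls l1 \<otimes>\<^bsub>A\<^esub> cls [e]) \<otimes>\<^bsub>A\<^esub> cls l2"
    using W cls_append [of "l1 @ [e]" l2] cls_append [of l1 "[e]"] by simp
  also have "cls l1 \<otimes>\<^bsub>A\<^esub> cls [e] = cls [e] \<otimes>\<^bsub>A\<^esub> cls l1"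
    using W c cls_commute [of "[e]" l1] by auto
  finally show ?thesis using W by (simp add: A.m_assoc cls_append)
qed

text \<open>
  A shortest conjugator does not start, even after commutations, with a letter from the star of
  \<open>v\<close>, since such a letter could be dropped. As a consequence nothing cancels in the word for
  the conjugate.
\<close>

lemma minimal_conjugator:
  assumes v: "v \<in> pverts G" and g: "g \<in> carrier A"
  obtains l where "l \<in> Wds" "vtx v (cls l) = vtx v g"
    "reduced (inv_word l @ [(v, True)] @ l)"
    "\<And>l1 e l2. l = l1 @ e # l2 \<Longrightarrow> \<forall>z\<in>set l1. com (fst e) (fst z) \<Longrightarrow>
       fst e \<noteq> v \<and> \<not> com v (fst e)"
proof -
  define Q where "Q l \<longleftrightarrow> l \<in> Wds \<and> vtx v (cls l) = vtx v g" for l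
  obtain l0 where "Q l0" using carrier_cls [OF g] by (auto simp: Q_def)
  then obtain l where l: "Q l" and min: "\<And>l'. Q l' \<Longrightarrow> length l \<le> length l'"
    using ex_has_least_nat [of Q l0 length] by blast
  have lW: "l \<in> Wds" and lg: "vtx v (cls l) = vtx v g" using l by (auto simp: Q_def)
  have red: "reduced l"
    using shorten [OF lW] min lg unfolding Q_def by (metis not_less)
  have star: "fst e \<noteq> v \<and> \<not> com v (fst e)"
    if e: "l = l1 @ e # l2" and c: "\<forall>z\<in>set l1. com (fst e) (fst z)" for l1 e l2
  proof (rule ccontr)
    assume "\<not> (fst e \<noteq> v \<and> \<not> com v (fst e))"
    then have ve: "com v (fst e) \<or> v = fst e" by auto
    have W: "[e] \<in> Wds" "l1 @ l2 \<in> Wds" "[(v, True)] \<in> Wds" using lW e v by auto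
    have "raag_gen G v \<otimes>\<^bsub>A\<^esub> cls [e] = cls [e] \<otimes>\<^bsub>A\<^esub> raag_gen G v"
      unfolding raag_gen_cls using W ve by (intro cls_commute) auto
    then have "vtx v (cls [e]) = raag_gen G v"
      using W v by (subst A.conj_act_fixed_iff) (auto simp: raag_gen_cls)
    moreover have "cls l = cls [e] \<otimes>\<^bsub>A\<^esub> cls (l1 @ l2)"
      using lW c unfolding e by (rule cls_extract)
    ultimately have "vtx v (cls l) = vtx v (cls (l1 @ l2))"
      using A.conj_act_mult [of "raag_gen G v" "cls [e]" "cls (l1 @ l2)"] W v by simp
    then have "Q (l1 @ l2)" using W lg by (simp add: Q_def)
    from min [OF this] show False by (simp add: e)
  qed
  have r1: "reduced ((v, True) # l)"
    using red star by (cases rule: reduced_Cons_cases [of _ "(v, True)"]) fastforce+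
  have "reduced (inv_word l)" using red reduced_inv_word by blast
  from this r1 have "reduced (inv_word l @ (v, True) # l)"
  proof (cases rule: reduced_append_cases)
    case (2 u1 a u2 w1 w2)
    show ?thesis
    proof (cases w1)
      case Nil
      then have a: "fst a = v" using 2 by auto
      from arg_cong [OF 2(1), of inv_word]
      have "l = inv_word u2 @ inv_letter a # inv_word u1" by (simp add: rev_map [symmetric] comp_def)
      from star [OF this] 2(3) a show ?thesis by auto
    next
      case (Cons b w1')
      then have "l = w1' @ inv_letter a # w2" "b = (v, True)" using 2 by auto
      from star [OF this(1)] this(2) 2(3) Cons show ?thesis by (auto dest: com_sym)
    qed
  qed
  then show ?thesis using that [of l] lW lg star by simp
qed

text \<open>
  After translation to \<open>g = \<one>\<close>, the reduced word for the conjugate of \<open>v'\<close>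
  has to be the single letter \<open>v\<close>, and \<open>g'\<close> centralises \<open>v\<close>.
\<close>

lemma vtx_eqD:
  assumes v: "v \<in> pverts G" "v' \<in> pverts G" and g: "g \<in> carrier A" "g' \<in> carrier A"
    and eq: "vtx v g = vtx v' g'"
  shows "v = v'" and "\<exists>m\<in>Wds. g' = cls m \<otimes>\<^bsub>A\<^esub> g \<and> (\<forall>z\<in>set m. fst z = v \<or> com v (fst z))"
proof -
  define k where "k = g' \<otimes>\<^bsub>A\<^esub> inv\<^bsub>A\<^esub> g"
  have k: "k \<in> carrier A" "g' = k \<otimes>\<^bsub>A\<^esub> g" using g by (auto simp: k_def A.m_assoc)
  have "conj_act A (vtx v' k) g = conj_act A (raag_gen G v) g"
    using eq v g k by (simp add: A.conj_act_mult)
  then have fix_v: "vtx v' k = raag_gen G v"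
    using A.conj_act_eq_iff [of "vtx v' k" "raag_gen G v" g] v g k by simp
  obtain l where l: "l \<in> Wds" "vtx v' (cls l) = vtx v' k" "reduced (inv_word l @ [(v', True)] @ l)"
    using minimal_conjugator [OF v(2) k(1)] .
  \<comment> \<open>a letter of \<open>l\<close> would occur twice on the left, once in \<open>l\<close> and once in its inverse\<close>
  have "pair_proj x x (inv_word l @ [(v', True)] @ l) = pair_proj x x [(v, True)]" for x
  proof (intro reduced_cls_pair_proj)
    show "inv_word l @ [(v', True)] @ l \<in> Wds" "[(v, True)] \<in> Wds" using l(1) v by auto
    show "cls (inv_word l @ [(v', True)] @ l) = cls [(v, True)]"
      using cls_conj [OF l(1) v(2)] l(2) fix_v raag_gen_cls [of v] by metis
    show "reduced (inv_word l @ [(v', True)] @ l)" by (fact l(3))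
    show "reduced [(v, True)]" by (simp add: reduced_Cons on_top_projs)
    show "\<not> com x x" by (rule com_irrefl)
  qed
  then have len: "length (pair_proj x x (inv_word l @ [(v', True)] @ l)) =
      length (pair_proj x x [(v, True)])" for x by metis
  show vv: "v = v'"
  proof (rule ccontr)
    assume "v \<noteq> v'"
    then show False using len [of v'] by simp
  qed
  obtain m where m: "m \<in> Wds" "cls m = k" "reduced m"
    using carrier_cls [OF k(1)] reduced_representative by metis
  have "\<forall>z\<in>set m. fst z = v \<or> com v (fst z)"
  proof
    fix z assume "z \<in> set m"
    moreover have "raag_gen G v \<otimes>\<^bsub>A\<^esub> k = k \<otimes>\<^bsub>A\<^esub> raag_gen G v"
      using fix_v vv v k A.conj_act_fixed_iff by simp
    ultimately show "fst z = v \<or> com v (fst z)"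
      using centralizer_letter [of m "(v, True)" z] m v by (auto simp: raag_gen_cls)
  qed
  then show "\<exists>m\<in>Wds. g' = cls m \<otimes>\<^bsub>A\<^esub> g \<and> (\<forall>z\<in>set m. fst z = v \<or> com v (fst z))"
    using m k by blast
qed

text \<open>
  After translation to \<open>g = \<one>\<close>, the reduced word of the conjugate of \<open>v'\<close> by
  a shortest conjugator \<open>l\<close> has all its letters in the star of \<open>v\<close>. If the letter
  \<open>v\<close> occurred in \<open>l\<close>, it could be moved to the front of \<open>l\<close>, where a
  shortest conjugator has no letter commuting with \<open>v'\<close>. So \<open>l\<close> commutes with
  \<open>v\<close> and conjugates both generators.
\<close>

lemma common_conjugator:
  assumes v: "v \<in> pverts G" "v' \<in> pverts G" and g: "g \<in> carrier A" "g' \<in> carrier A"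
    and comm: "vtx v g \<otimes>\<^bsub>A\<^esub> vtx v' g' = vtx v' g' \<otimes>\<^bsub>A\<^esub> vtx v g"
    and ne: "vtx v g \<noteq> vtx v' g'"
  shows "com v v'" and "\<exists>h\<in>carrier A. vtx v g = vtx v h \<and> vtx v' g' = vtx v' h"
proof -
  define k where "k = g' \<otimes>\<^bsub>A\<^esub> inv\<^bsub>A\<^esub> g"
  have k: "k \<in> carrier A" "g' = k \<otimes>\<^bsub>A\<^esub> g" using g by (auto simp: k_def A.m_assoc)
  have vk: "vtx v' g' = conj_act A (vtx v' k) g" using v g k by (simp add: A.conj_act_mult)
  have "conj_act A (raag_gen G v \<otimes>\<^bsub>A\<^esub> vtx v' k) g = conj_act A (vtx v' k \<otimes>\<^bsub>A\<^esub> raag_gen G v) g"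
    using comm v g k unfolding vk by (simp add: A.conj_act_hom)
  then have comm': "raag_gen G v \<otimes>\<^bsub>A\<^esub> vtx v' k = vtx v' k \<otimes>\<^bsub>A\<^esub> raag_gen G v"
    using v g k by (subst (asm) A.conj_act_eq_iff) auto
  obtain l where l: "l \<in> Wds" "vtx v' (cls l) = vtx v' k" "reduced (inv_word l @ [(v', True)] @ l)"
    and star: "\<And>l1 e l2. l = l1 @ e # l2 \<Longrightarrow> \<forall>z\<in>set l1. com (fst e) (fst z) \<Longrightarrow>
       fst e \<noteq> v' \<and> \<not> com v' (fst e)"
    using minimal_conjugator [OF v(2) k(1)] by blast
  let ?z = "inv_word l @ [(v', True)] @ l"
  have z: "?z \<in> Wds" using l(1) v by (auto simp del: rev_map)
  have cz: "fst y = v \<or> com v (fst y)" if "y \<in> set ?z" for y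
    using centralizer_letter [OF z l(3), of "(v, True)" y] that v comm' l
    by (simp add: raag_gen_cls [symmetric] cls_conj del: rev_map)
  have v': "v' = v \<or> com v v'" using cz [of "(v', True)"] by simp
  have "v \<notin> fst ` set l"
  proof
    assume "v \<in> fst ` set l"
    then have "\<exists>e\<in>set l. fst e = v" by auto
    then obtain l1 e l2 where e: "l = l1 @ e # l2" "fst e = v" "\<forall>y\<in>set l1. fst y \<noteq> v"
      using split_list_first_prop [of l "\<lambda>e. fst e = v"] by blast
    have "\<forall>y\<in>set l1. com (fst e) (fst y)"
    proof
      fix y assume "y \<in> set l1"
      then show "com (fst e) (fst y)" using cz [of y] e by auto
    qed
    from star [OF e(1) this] v' e(2) show False by (auto dest: com_sym)
  qed
  then have "\<forall>y\<in>set l. com v (fst y)" using cz by force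
  then have "raag_gen G v \<otimes>\<^bsub>A\<^esub> cls l = cls l \<otimes>\<^bsub>A\<^esub> raag_gen G v"
    unfolding raag_gen_cls using l(1) v by (intro cls_commute) auto
  then have fix_v: "vtx v (cls l) = raag_gen G v"
    using A.conj_act_fixed_iff v l by simp
  have "v' \<noteq> v"
  proof
    assume "v' = v"
    then have "vtx v' k = raag_gen G v" using fix_v l(2) by simp
    then show False using ne vk by simp
  qed
  then show "com v v'" using v' by simp
  have "vtx v g = vtx v (cls l \<otimes>\<^bsub>A\<^esub> g)" "vtx v' g' = vtx v' (cls l \<otimes>\<^bsub>A\<^esub> g)"
    using v g l fix_v by (simp_all add: A.conj_act_mult vk)
  then show "\<exists>h\<in>carrier A. vtx v g = vtx v h \<and> vtx v' g' = vtx v' h"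
    using l(1) g by (intro bexI [of _ "cls l \<otimes>\<^bsub>A\<^esub> g"]) auto
qed

text \<open>
  A shortest word among those representing conjugates of \<open>x\<close>: a cancellation between
  consecutive copies would allow to shorten it by conjugating with the cancelled letter. Copies further
  apart cannot interact, because a cancelling letter would have to jump over its own occurrence in a copy
  between them.
\<close>

lemma cyclic_reduction:
  assumes x: "x \<in> carrier A"
  obtains l c where "l \<in> Wds" "c \<in> carrier A" "x = conj_act A (cls l) c"
    "\<And>k. reduced (concat (replicate k l))"
proof -
  define Q where "Q l \<longleftrightarrow> l \<in> Wds \<and> (\<exists>c\<in>carrier A. x = conj_act A (cls l) c)" for l
  obtain l0 where "l0 \<in> Wds" "x = cls l0" using carrier_cls [OF x] by auto
  then have "Q l0" unfolding Q_def
    using A.conj_act_one [of "cls l0"] cls_closed [of l0] by (metis A.one_closed)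
  then obtain l where l: "Q l" and min: "\<And>l'. Q l' \<Longrightarrow> length l \<le> length l'"
    using ex_has_least_nat [of Q l0 length] by blast
  obtain c where lW: "l \<in> Wds" and c: "c \<in> carrier A" "x = conj_act A (cls l) c"
    using l by (auto simp: Q_def)
  have red: "reduced l"
    using shorten [OF lW] min c unfolding Q_def by (metis not_less)
  have "reduced (concat (replicate k l))" for k
  proof (induction k)
    case (Suc k)
    from red Suc have "reduced (l @ concat (replicate k l))"
    proof (cases rule: reduced_append_cases)
      case (2 u1 a u2 w1 w2)
      \<comment> \<open>the inverse letter is met before any other occurrence of its generator, hence within the next copy\<close>
      have nw1: "\<forall>z\<in>set w1. fst z \<noteq> fst a" using 2(3) com_irrefl by (metis UnI2)
      obtain k' where k': "concat (replicate k l) = l @ concat (replicate k' l)"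
        using 2(2) by (cases k) auto
      have "\<exists>w2'. l = w1 @ inv_letter a # w2'"
      proof (rule ccontr)
        assume n: "\<nexists>w2'. l = w1 @ inv_letter a # w2'"
        have "l @ concat (replicate k' l) = w1 @ inv_letter a # w2" using 2(2) k' by simp
        then obtain m' where "w1 = l @ m'" using n
          by (auto simp: append_eq_append_conv2 Cons_eq_append_conv append_eq_Cons_conv)
        then show False using nw1 2(1) by auto
      qed
      then obtain w2' where l2: "l = w1 @ inv_letter a # w2'" by blast
      obtain mid where mid: "u1 = w1 @ inv_letter a # mid"
      proof -
        have "u1 @ a # u2 = w1 @ inv_letter a # w2'" using 2(1) l2 by simp
        then consider m where "u1 = w1 @ m" "m @ a # u2 = inv_letter a # w2'"
          | m where "w1 = u1 @ m" "a # u2 = m @ inv_letter a # w2'"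
          by (auto simp: append_eq_append_conv2)
        then show ?thesis
        proof cases
          case 1
          then show ?thesis using that by (cases m) (auto simp: prod_eq_iff)
        next
          case 2
          then show ?thesis using nw1 by (cases m) (auto simp: prod_eq_iff)
        qed
      qed
      have le: "l = w1 @ inv_letter a # mid @ a # u2" using 2(1) mid by simp
      have W: "w1 \<in> Wds" "mid \<in> Wds" "u2 \<in> Wds" "[a] \<in> Wds" using lW le by auto
      have av: "fst a \<in> pverts G" using W(4) by auto
      have "cls l = cls [inv_letter a] \<otimes>\<^bsub>A\<^esub> cls (w1 @ mid @ a # u2)"
        using cls_extract [of w1 "inv_letter a" "mid @ a # u2"] lW 2(3) le by auto
      also have "cls (w1 @ mid @ a # u2) = cls (w1 @ mid) \<otimes>\<^bsub>A\<^esub> (cls [a] \<otimes>\<^bsub>A\<^esub> cls u2)"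
        using W cls_append [of "w1 @ mid" "a # u2"] cls_Cons [of a u2] by simp
      also have "cls [a] \<otimes>\<^bsub>A\<^esub> cls u2 = cls u2 \<otimes>\<^bsub>A\<^esub> cls [a]"
        using W 2(3) by (intro cls_commute) auto
      also have "cls [inv_letter a] \<otimes>\<^bsub>A\<^esub> (cls (w1 @ mid) \<otimes>\<^bsub>A\<^esub> (cls u2 \<otimes>\<^bsub>A\<^esub> cls [a])) =
          conj_act A (cls (w1 @ mid @ u2)) (cls [a])"
        using W av cls_append [of "w1 @ mid" u2]
        by (simp add: conj_act_def cls_inv_letter A.m_assoc)
      finally have "x = conj_act A (cls (w1 @ mid @ u2)) (cls [a] \<otimes>\<^bsub>A\<^esub> c)"
        using c W by (simp add: A.conj_act_mult)
      then have "Q (w1 @ mid @ u2)" using W c unfolding Q_def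
        by (intro conjI bexI [of _ "cls [a] \<otimes>\<^bsub>A\<^esub> c"]) auto
      from min [OF this] show ?thesis by (simp add: le)
    qed
    then show ?case by simp
  qed simp
  then show ?thesis using that lW c by blast
qed

end

section \<open>Progress along the powers of a word\<close>

definition letter_count :: "'a \<Rightarrow> 'a word \<Rightarrow> nat" where
  "letter_count x w = length (filter (\<lambda>z. fst z = x) w)"

lemma letter_count_simps [simp]:
  "letter_count x [] = 0"
  "letter_count x (a # w) = (if fst a = x then Suc (letter_count x w) else letter_count x w)"
  "letter_count x (v @ w) = letter_count x v + letter_count x w"
  by (auto simp: letter_count_def)

lemma letter_count_pair_proj [simp]:
  "letter_count x (pair_proj x y w) = letter_count x w"
  "letter_count y (pair_proj x y w) = letter_count y w"
  by (induction w) auto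

lemma letter_count_pow: "letter_count x (concat (replicate k w)) = k * letter_count x w"
  by (induction k) auto

lemma pair_proj_pow: "pair_proj x y (concat (replicate k w)) = concat (replicate k (pair_proj x y w))"
  by (induction k) auto

lemma letter_count_suffix: "suffix s t \<Longrightarrow> letter_count x s \<le> letter_count x t"
  by (auto simp: suffix_def)

lemma letter_count_pos: "letter_count x w > 0 \<longleftrightarrow> x \<in> fst ` set w"
  by (induction w) auto

lemma suffix_pow_cases:
  assumes "suffix s (concat (replicate k B))"
  shows "\<exists>t j. suffix t B \<and> s = t @ concat (replicate j B)"
  using assms
proof (induction k)
  case 0
  then show ?case by (intro exI [of _ "[]"] exI [of _ 0]) auto
next
  case (Suc k)
  then have "suffix s (B @ concat (replicate k B))" by simp
  then consider "suffix s (concat (replicate k B))" | t where "s = t @ concat (replicate k B)" "suffix t B"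
    unfolding suffix_append by blast
  then show ?case using Suc.IH by cases blast+
qed

lemma finite_centre:
  fixes X :: "real set"
  assumes "finite X" "X \<noteq> {}" "\<And>a b. a \<in> X \<Longrightarrow> b \<in> X \<Longrightarrow> \<bar>a - b\<bar> \<le> 1"
  shows "\<exists>c. \<forall>a\<in>X. \<bar>a - c\<bar> \<le> 1 / 2"
proof (intro exI ballI)
  fix a assume "a \<in> X"
  then have "Min X \<le> a" "a \<le> Max X" using assms by auto
  moreover have "\<bar>Max X - Min X\<bar> \<le> 1" using assms by (intro assms(3) Max_in Min_in) auto
  ultimately show "\<bar>a - (Max X + Min X) / 2\<bar> \<le> 1 / 2" by (auto simp: abs_le_iff field_simps)
qed

text \<open>
  Complete copies of \<open>l\<close> contribute nothing to the difference, so only suffixes of one copy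
  matter. Two of these differ by a factor of \<open>l\<close>, which contributes a number in \<open>[0,
  1]\<close> minus a number in \<open>[0, 1]\<close>.
\<close>

lemma staircase:
  fixes l :: "'a word"
  assumes "x \<in> fst ` set l" "y \<in> fst ` set l"
  shows "\<exists>c. \<forall>k s. suffix s (pair_proj x y (concat (replicate k l))) \<longrightarrow>
    \<bar>real (letter_count x s) / real (letter_count x l) - real (letter_count y s) / real (letter_count y l) - c\<bar> \<le> 1 / 2"
proof -
  let ?B = "pair_proj x y l"
  let ?d = "\<lambda>s. real (letter_count x s) / real (letter_count x l) - real (letter_count y s) / real (letter_count y l)"
  have pos: "letter_count x l > 0" "letter_count y l > 0" using assms by (auto simp: letter_count_pos)
  have app: "?d (s @ t) = ?d s + ?d t" for s t by (simp add: add_divide_distrib)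
  have "\<exists>c. \<forall>a\<in>?d ` {s. suffix s ?B}. \<bar>a - c\<bar> \<le> 1 / 2"
  proof (rule finite_centre)
    have "{s. suffix s ?B} \<subseteq> set (suffixes ?B)" by auto
    then show "finite (?d ` {s. suffix s ?B})" by (meson finite_imageI finite_set finite_subset)
    show "?d ` {s. suffix s ?B} \<noteq> {}" by auto
    have "\<bar>?d (r @ t) - ?d t\<bar> \<le> 1" if "suffix (r @ t) ?B" for r t
    proof -
      have "letter_count x r \<le> letter_count x l" "letter_count y r \<le> letter_count y l"
        using letter_count_suffix [OF that, of x] letter_count_suffix [OF that, of y] by auto
      then have "real (letter_count x r) / real (letter_count x l) \<le> 1"
        "real (letter_count y r) / real (letter_count y l) \<le> 1" using pos by auto
      moreover have "real (letter_count x r) / real (letter_count x l) \<ge> 0"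
        "real (letter_count y r) / real (letter_count y l) \<ge> 0" by auto
      ultimately show ?thesis unfolding app by linarith
    qed
    then have "\<bar>?d s - ?d t\<bar> \<le> 1" if "suffix s ?B" "suffix t ?B" for s t
      using suffix_same_cases [OF that] that by (auto simp: suffix_def abs_minus_commute)
    then show "\<bar>a - b\<bar> \<le> 1" if "a \<in> ?d ` {s. suffix s ?B}" "b \<in> ?d ` {s. suffix s ?B}" for a b
      using that by blast
  qed
  then obtain c where c: "\<And>s. suffix s ?B \<Longrightarrow> \<bar>?d s - c\<bar> \<le> 1 / 2" by blast
  have "\<bar>?d s - c\<bar> \<le> 1 / 2" if s: "suffix s (pair_proj x y (concat (replicate k l)))" for k s
  proof -
    obtain t j where tj: "suffix t ?B" "s = t @ concat (replicate j ?B)"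
      using suffix_pow_cases s unfolding pair_proj_pow by blast
    have "?d (concat (replicate j ?B)) = 0" using pos by (simp add: letter_count_pow)
    then have "?d s = ?d t" unfolding tj(2) app by simp
    then show ?thesis using c [OF tj(1)] by simp
  qed
  then show ?thesis by blast
qed

context commutation
begin

text \<open>
  The letter counts of those words that are suffixes both of the element with projections \<open>P\<close>
  and of the word \<open>L\<close>, up to commutations. Such a suffix is given by compatible suffixes of all
  projections, and these are determined by the counts.
\<close>

definition common :: "('a \<Rightarrow> 'a \<Rightarrow> 'a word) \<Rightarrow> 'a word \<Rightarrow> ('a \<Rightarrow> nat) set" where
  "common P L = {n. \<forall>x y. \<not> com x y \<longrightarrow> (\<exists>s. suffix s (P x y) \<and> suffix s (pair_proj x y L) \<and>
     letter_count x s = n x \<and> letter_count y s = n y)}"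

text \<open>
  Common suffixes are closed under union (\<open>common_max\<close>), so there is a largest one. The maximum
  is taken for each letter separately, and \<open>progress_common\<close> shows that the largest suffix
  attains all of them.
\<close>

definition progress :: "('a \<Rightarrow> 'a \<Rightarrow> 'a word) \<Rightarrow> 'a word \<Rightarrow> 'a \<Rightarrow> nat" where
  "progress P L x = Max ((\<lambda>n. n x) ` common P L)"

lemma common_bound: "n \<in> common P L \<Longrightarrow> n x \<le> letter_count x (P x x) \<and> n x \<le> letter_count x L"
proof -
  assume "n \<in> common P L"
  then obtain s where "suffix s (P x x)" "suffix s (pair_proj x x L)" "letter_count x s = n x"
    using com_irrefl unfolding common_def by blast
  then show ?thesis using letter_count_suffix [of s _ x] by fastforce
qed

lemma common_zero: "(\<lambda>_. 0) \<in> common P L"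
  unfolding common_def by (auto intro!: exI [of _ "[]"])

text \<open>
  Of two suffixes of the same word one contains the other, so for each pair the longer one realises both
  maxima.
\<close>

lemma common_max:
  assumes "n \<in> common P L" "n' \<in> common P L"
  shows "(\<lambda>x. max (n x) (n' x)) \<in> common P L"
  unfolding common_def
proof (clarify)
  fix x y assume "\<not> com x y"
  then obtain s s' where s: "suffix s (P x y)" "suffix s (pair_proj x y L)"
      "letter_count x s = n x" "letter_count y s = n y"
    and s': "suffix s' (P x y)" "suffix s' (pair_proj x y L)"
      "letter_count x s' = n' x" "letter_count y s' = n' y"
    using assms unfolding common_def by blast
  have "suffix s s' \<or> suffix s' s" using suffix_same_cases s(1) s'(1) by blast
  then have "(n x \<le> n' x \<and> n y \<le> n' y) \<or> (n' x \<le> n x \<and> n' y \<le> n y)"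
    using letter_count_suffix s s' by metis
  then show "\<exists>s. suffix s (P x y) \<and> suffix s (pair_proj x y L) \<and>
      letter_count x s = max (n x) (n' x) \<and> letter_count y s = max (n y) (n' y)"
    using s s' by (metis max_absorb1 max_absorb2)
qed

lemma finite_common_image: "finite ((\<lambda>n. n x) ` common P L)"
proof (rule finite_subset)
  show "(\<lambda>n. n x) ` common P L \<subseteq> {..letter_count x L}" using common_bound by auto
qed simp

lemma progress_ge: "n \<in> common P L \<Longrightarrow> n x \<le> progress P L x"
  unfolding progress_def by (intro Max_ge finite_common_image) auto

lemma progress_attained: "\<exists>n\<in>common P L. progress P L x = n x"
proof -
  have "progress P L x \<in> (\<lambda>n. n x) ` common P L"
    unfolding progress_def using common_zero by (intro Max_in finite_common_image) auto
  then show ?thesis by auto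
qed

lemma progress_common:
  assumes "\<not> com x y"
  shows "\<exists>s. suffix s (P x y) \<and> suffix s (pair_proj x y L) \<and>
      letter_count x s = progress P L x \<and> letter_count y s = progress P L y"
proof -
  obtain n n' where n: "n \<in> common P L" "progress P L x = n x"
    and n': "n' \<in> common P L" "progress P L y = n' y"
    using progress_attained by metis
  have "max (n x) (n' x) = progress P L x" "max (n y) (n' y) = progress P L y"
    using progress_ge [OF n(1), of y] progress_ge [OF n'(1), of x] n n' by auto
  then show ?thesis using common_max [OF n(1) n'(1)] assms unfolding common_def by fastforce
qed

text \<open>
  A new letter \<open>a\<close> on top of \<open>w\<close> can only be the topmost letter of a common
  suffix. Removing it leaves a common suffix of \<open>w\<close> with the same number of all other letters.
\<close>

lemma progress_Cons:
  assumes x: "x \<noteq> fst a"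
  shows "progress (projs (a # w)) L x = progress (projs w) L x"
proof (rule antisym)
  obtain n where n: "n \<in> common (projs w) L" "progress (projs w) L x = n x"
    using progress_attained by blast
  have "n \<in> common (projs (a # w)) L"
    unfolding common_def
  proof clarify
    fix y z assume nc: "\<not> com y z"
    then obtain s where "suffix s (pair_proj y z w)" "suffix s (pair_proj y z L)"
      "letter_count y s = n y" "letter_count z s = n z"
      using n(1) unfolding common_def projs_def by auto
    then show "\<exists>s. suffix s (projs (a # w) y z) \<and> suffix s (pair_proj y z L) \<and>
       letter_count y s = n y \<and> letter_count z s = n z"
      using nc by (intro exI [of _ s]) (auto simp: projs_def suffix_ConsI)
  qed
  then show "progress (projs w) L x \<le> progress (projs (a # w)) L x"
    using progress_ge n(2) by metis
next
  let ?u = "fst a"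
  obtain n where n: "n \<in> common (projs (a # w)) L" "progress (projs (a # w)) L x = n x"
    using progress_attained by blast
  \<comment> \<open>the counts of the suffix without a topmost letter \<open>a\<close>\<close>
  define n' where "n' = n(?u := min (n ?u) (letter_count ?u w))"
  have "n' \<in> common (projs w) L"
    unfolding common_def
  proof clarify
    fix y z assume nc: "\<not> com y z"
    obtain s where s: "suffix s (projs (a # w) y z)" "suffix s (pair_proj y z L)"
      "letter_count y s = n y" "letter_count z s = n z"
      using n(1) nc unfolding common_def by blast
    show "\<exists>s. suffix s (projs w y z) \<and> suffix s (pair_proj y z L) \<and>
       letter_count y s = n' y \<and> letter_count z s = n' z"
    proof (cases "suffix s (pair_proj y z w)")
      case True
      have "letter_count ?u s \<le> letter_count ?u w" if "?u = y \<or> ?u = z"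
        using letter_count_suffix [OF True, of ?u] that by auto
      then have "n' y = n y" "n' z = n z" using s by (auto simp: n'_def)
      then show ?thesis using s nc True by (auto simp: projs_def)
    next
      case False
      then have u: "?u = y \<or> ?u = z" and sa: "s = a # pair_proj y z w"
        using s(1) nc by (auto simp: projs_def suffix_Cons split: if_splits)
      have "letter_count y (pair_proj y z w) = n' y" "letter_count z (pair_proj y z w) = n' z"
        using u s(3,4) unfolding sa n'_def by (auto split: if_splits)
      moreover have "suffix (pair_proj y z w) (pair_proj y z L)"
        using s(2) unfolding sa by (rule suffix_ConsD)
      ultimately show ?thesis using nc by (intro exI [of _ "pair_proj y z w"]) (auto simp: projs_def)
    qed
  qed
  from progress_ge [OF this, of x] show "progress (projs (a # w)) L x \<le> progress (projs w) L x"
    using n(2) x by (simp add: n'_def)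
qed

lemma progress_push:
  assumes P: "P \<in> states" and x: "x \<noteq> fst a"
  shows "progress (push a P) L x = progress P L x"
proof -
  obtain w where w: "reduced w" and P: "P = projs w" using P by (auto simp: states_def)
  show ?thesis
  proof (cases "on_top (inv_letter a) P")
    case True
    then obtain w1 w2 where e: "w = w1 @ inv_letter a # w2" and c: "\<forall>z\<in>set w1. com (fst a) (fst z)"
      unfolding P on_top_projs by auto
    have "push a P = projs (w1 @ w2)" unfolding P e by (rule push_cancel [OF c])
    moreover have "P = projs (inv_letter a # w1 @ w2)" unfolding P e using c by (intro projs_move) auto
    ultimately show ?thesis using progress_Cons [of x "inv_letter a"] x by simp
  next
    case False
    then show ?thesis using push_cons [of a w] progress_Cons [OF x] unfolding P by simp
  qed
qed

lemma progress_foldr_push: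
  assumes P: "P \<in> states" and x: "\<forall>z\<in>set w. fst z \<noteq> x"
  shows "progress (foldr push w P) L x = progress P L x"
  using x
proof (induction w)
  case (Cons a w)
  then show ?case using progress_push [OF foldr_push_states [OF P, of w], of x a L] by fastforce
qed simp

lemma progress_Nil: "progress (projs []) L x = 0"
proof -
  obtain n where n: "n \<in> common (projs []) L" "progress (projs []) L x = n x"
    using progress_attained by blast
  have "projs [] x x = []" by (simp add: projs_def)
  then show ?thesis using common_bound [OF n(1), of x] n(2) by simp
qed

lemma progress_self: "progress (projs L) L x = letter_count x L"
proof (rule antisym)
  show "progress (projs L) L x \<le> letter_count x L"
    using progress_attained common_bound by metis
  have "(\<lambda>x. letter_count x L) \<in> common (projs L) L"
    unfolding common_def by (auto simp: projs_def intro!: exI [of _ "pair_proj _ _ L"])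
  from progress_ge [OF this] show "letter_count x L \<le> progress (projs L) L x" .
qed

text \<open>
  Each edge of the path has a centre by \<open>staircase\<close>. Summing the centres along the path gives
  offsets \<open>q\<close> for which neighbouring positions differ by at most \<open>1/2\<close>.
\<close>

lemma path_potential:
  assumes S: "\<And>i. i \<le> r \<Longrightarrow> t i \<in> fst ` set l"
    and nc: "\<And>i. i < r \<Longrightarrow> \<not> com (t i) (t (Suc i))"
  shows "\<exists>q. \<forall>k P i j. i \<le> r \<longrightarrow> j \<le> r \<longrightarrow>
    \<bar>(real (progress P (concat (replicate k l)) (t i)) / real (letter_count (t i) l) - q i) -
     (real (progress P (concat (replicate k l)) (t j)) / real (letter_count (t j) l) - q j)\<bar>
      \<le> \<bar>real i - real j\<bar> / 2"
proof -
  let ?f = "\<lambda>k P i. real (progress P (concat (replicate k l)) (t i)) / real (letter_count (t i) l)"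
  have "\<exists>c. \<forall>k P. i < r \<longrightarrow> \<bar>?f k P i - ?f k P (Suc i) - c\<bar> \<le> 1 / 2" for i
  proof (cases "i < r")
    case True
    then obtain c where c: "\<And>k s. suffix s (pair_proj (t i) (t (Suc i)) (concat (replicate k l))) \<Longrightarrow>
      \<bar>real (letter_count (t i) s) / real (letter_count (t i) l) -
       real (letter_count (t (Suc i)) s) / real (letter_count (t (Suc i)) l) - c\<bar> \<le> 1 / 2"
      using staircase [of "t i" l "t (Suc i)"] S [of i] S [of "Suc i"] by auto
    have "\<bar>?f k P i - ?f k P (Suc i) - c\<bar> \<le> 1 / 2" for k P
    proof -
      obtain s where s: "suffix s (pair_proj (t i) (t (Suc i)) (concat (replicate k l)))"
        "letter_count (t i) s = progress P (concat (replicate k l)) (t i)"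
        "letter_count (t (Suc i)) s = progress P (concat (replicate k l)) (t (Suc i))"
        using progress_common [OF nc [OF True], of P "concat (replicate k l)"] by blast
      show ?thesis using c [OF s(1)] unfolding s(2,3) .
    qed
    then show ?thesis by blast
  qed simp
  then have "\<forall>i. \<exists>c. \<forall>k P. i < r \<longrightarrow> \<bar>?f k P i - ?f k P (Suc i) - c\<bar> \<le> 1 / 2" by blast
  from choice [OF this] obtain c where
    c: "\<And>i k P. i < r \<Longrightarrow> \<bar>?f k P i - ?f k P (Suc i) - c i\<bar> \<le> 1 / 2"
    by blast
  define q where "q i = - (\<Sum>m<i. c m)" for i
  have le: "\<bar>(?f k P i - q i) - (?f k P j - q j)\<bar> \<le> (real j - real i) / 2"
    if "i \<le> j" "j \<le> r" for k P i j
    using that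
  proof (induction j rule: dec_induct)
    case (step m)
    have a: "\<bar>?f k P m - ?f k P (Suc m) - c m\<bar> \<le> 1 / 2" using c step.prems step.hyps by auto
    have b: "q (Suc m) = q m - c m" by (simp add: q_def)
    have "(?f k P i - q i) - (?f k P (Suc m) - q (Suc m)) =
        ((?f k P i - q i) - (?f k P m - q m)) + (?f k P m - ?f k P (Suc m) - c m)"
      unfolding b by (simp add: algebra_simps)
    also have "\<bar>\<dots>\<bar> \<le> (real m - real i) / 2 + 1 / 2"
      using a step.IH step.prems by (intro order_trans [OF abs_triangle_ineq] add_mono) auto
    also have "\<dots> = (real (Suc m) - real i) / 2" by simp
    finally show ?case .
  qed simp
  have "\<bar>(?f k P i - q i) - (?f k P j - q j)\<bar> \<le> \<bar>real i - real j\<bar> / 2"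
    if "i \<le> r" "j \<le> r" for k P i j
    using le [of i j] le [of j i] that
    by (cases "i \<le> j") (simp_all add: abs_minus_commute)
  then show ?thesis by blast
qed

end

context pair_graph
begin

text \<open>
  \<open>t\<close> is a path in the complement graph with vertices in \<open>S\<close>, and \<open>i
  v\<close>, \<open>j v\<close> are positions of neighbours of \<open>v\<close> on it. The progress is read
  at \<open>v\<close> as the average over the two positions, and the last condition makes this reading
  \<open>D/2\<close>-Lipschitz. With \<open>i = j\<close> it holds whenever the path has at most
  \<open>D\<close> edges.
\<close>

definition dominating_path :: "'a set \<Rightarrow> nat \<Rightarrow> bool" where
  "dominating_path S D \<longleftrightarrow> (\<exists>r t i j.
     (\<forall>m\<le>r. t m \<in> S) \<and> (\<forall>m<r. \<not> com (t m) (t (Suc m))) \<and>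
     (\<forall>v\<in>pverts G. i v \<le> r \<and> t (i v) \<noteq> v \<and> \<not> com v (t (i v)) \<and>
        j v \<le> (r::nat) \<and> t (j v) \<noteq> v \<and> \<not> com v (t (j v))) \<and>
     (\<forall>(v, v')\<in>parcs G. \<bar>real (i v) - real (i v')\<bar> + \<bar>real (j v) - real (j v')\<bar> \<le> 2 * real D))"

text \<open>
  All representing words give the same state, by \<open>cls_foldr_push\<close>.
\<close>

definition state :: "'a word set \<Rightarrow> 'a \<Rightarrow> 'a \<Rightarrow> 'a word" where
  "state g = foldr push (SOME w. w \<in> Wds \<and> cls w = g) (projs [])"

lemma state_cls: "w \<in> Wds \<Longrightarrow> state (cls w) = foldr push w (projs [])"
proof -
  assume w: "w \<in> Wds"
  let ?w = "SOME w'. w' \<in> Wds \<and> cls w' = cls w"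
  have "?w \<in> Wds \<and> cls ?w = cls w" by (rule someI [of _ w]) (simp add: w)
  then show ?thesis unfolding state_def using cls_foldr_push [of ?w w] w projs_Nil_states by blast
qed

lemma progress_state_mult:
  assumes "m \<in> Wds" "g \<in> carrier A" "\<forall>z\<in>set m. fst z \<noteq> x"
  shows "progress (state (cls m \<otimes>\<^bsub>A\<^esub> g)) L x = progress (state g) L x"
proof -
  obtain w where w: "w \<in> Wds" "g = cls w" using carrier_cls assms(2) by blast
  have "state (cls m \<otimes>\<^bsub>A\<^esub> g) = foldr push m (state g)"
    using assms(1) w cls_append [of m w] state_cls [of "m @ w"] state_cls [of w] by simp
  moreover have "state g \<in> states" using w state_cls foldr_push_states projs_Nil_states by simp
  ultimately show ?thesis using progress_foldr_push assms(3) by simp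
qed

lemma ext_vertsE:
  assumes "x \<in> ext_verts G"
  obtains v g where "v \<in> pverts G" "g \<in> carrier A" "x = vtx v g"
  using assms by (auto simp: ext_verts_def)

lemma ext_verts_vtx: "v \<in> pverts G \<Longrightarrow> g \<in> carrier A \<Longrightarrow> vtx v g \<in> ext_verts G"
  by (auto simp: ext_verts_def)

text \<open>
  The averaged reading \<open>F\<close> is well defined on the vertices of the extension graph, as
  conjugators of the same vertex differ by an element of the star subgroup, which contains none of the
  letters that are read. At an edge both ends have a common conjugator, so \<open>path_potential\<close>
  bounds the variation of \<open>F\<close> by \<open>D/2\<close>. From \<open>\<one>\<close> to the power
  \<open>l\<^sup>k\<close> every letter progresses by \<open>k\<close> periods.
\<close>

lemma ext_path_lower_bound:
  assumes l: "l \<in> Wds" "\<And>k. reduced (concat (replicate k l))"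
    and tr: "dominating_path (fst ` set l) D" and v: "v \<in> pverts G"
    and path: "(raag_gen G v, vtx v (cls l [^]\<^bsub>A\<^esub> k)) \<in> parcs (extension_graph G) ^^ m"
  shows "2 * real k \<le> real D * real m"
proof -
  obtain r t i j where
      t': "\<forall>m\<le>r. t m \<in> fst ` set l" "\<forall>m<r. \<not> com (t m) (t (Suc m))"
    and v': "\<forall>v\<in>pverts G. i v \<le> r \<and> t (i v) \<noteq> v \<and> \<not> com v (t (i v)) \<and>
        j v \<le> r \<and> t (j v) \<noteq> v \<and> \<not> com v (t (j v))"
    and e': "\<forall>(v, v')\<in>parcs G.
      \<bar>real (i v) - real (i v')\<bar> + \<bar>real (j v) - real (j v')\<bar> \<le> 2 * real D"
    using tr unfolding dominating_path_def by (elim exE conjE)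
  have t: "\<And>m. m \<le> r \<Longrightarrow> t m \<in> fst ` set l" "\<And>m. m < r \<Longrightarrow> \<not> com (t m) (t (Suc m))"
    and i: "\<And>v. v \<in> pverts G \<Longrightarrow> i v \<le> r \<and> t (i v) \<noteq> v \<and> \<not> com v (t (i v))"
    and j: "\<And>v. v \<in> pverts G \<Longrightarrow> j v \<le> r \<and> t (j v) \<noteq> v \<and> \<not> com v (t (j v))"
    and ij: "\<And>v v'. com v v' \<Longrightarrow>
      \<bar>real (i v) - real (i v')\<bar> + \<bar>real (j v) - real (j v')\<bar> \<le> 2 * real D"
    using t' v' e' by auto
  let ?L = "concat (replicate k l)"
  obtain q where q: "\<And>P i j. i \<le> r \<Longrightarrow> j \<le> r \<Longrightarrow>
    \<bar>(real (progress P ?L (t i)) / real (letter_count (t i) l) - q i) -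
     (real (progress P ?L (t j)) / real (letter_count (t j) l) - q j)\<bar> \<le> \<bar>real i - real j\<bar> / 2"
    using path_potential [of r t l, OF t] by blast
  define p where "p i g = real (progress (state g) ?L (t i)) / real (letter_count (t i) l) - q i" for i g
  define F where "F v g = (p (i v) g + p (j v) g) / 2" for v g
  \<comment> \<open>the reading only depends on the vertex of the extension graph\<close>
  have F_eq: "F v g = F v' g'"
    if vg: "v \<in> pverts G" "v' \<in> pverts G" "g \<in> carrier A" "g' \<in> carrier A" "vtx v g = vtx v' g'" for v v' g g'
  proof -
    obtain m where m: "v = v'" "m \<in> Wds" "g' = cls m \<otimes>\<^bsub>A\<^esub> g" "\<forall>z\<in>set m. fst z = v \<or> com v (fst z)"
      using vtx_eqD [OF vg] by blast
    have "\<forall>z\<in>set m. fst z \<noteq> t (i v)" "\<forall>z\<in>set m. fst z \<noteq> t (j v)"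
      using m(4) i [OF vg(1)] j [OF vg(1)] by auto
    then show ?thesis using m(1-3) vg(3) by (simp add: F_def p_def progress_state_mult)
  qed
  \<comment> \<open>adjacent vertices: both readings are made at a common conjugator\<close>
  have F_edge: "\<bar>F v g - F v' g'\<bar> \<le> real D / 2"
    if vg: "v \<in> pverts G" "v' \<in> pverts G" "g \<in> carrier A" "g' \<in> carrier A"
      "(vtx v g, vtx v' g') \<in> parcs (extension_graph G)" for v v' g g'
  proof -
    have c: "vtx v g \<otimes>\<^bsub>A\<^esub> vtx v' g' = vtx v' g' \<otimes>\<^bsub>A\<^esub> vtx v g" "vtx v g \<noteq> vtx v' g'"
      using vg(5) by (auto simp: extension_graph_def)
    obtain h where h: "h \<in> carrier A" "vtx v g = vtx v h" "vtx v' g' = vtx v' h" and vv: "com v v'"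
      using common_conjugator [OF vg(1-4) c] by blast
    have "F v g = F v h" "F v' g' = F v' h" using F_eq vg h by blast+
    moreover have "\<bar>F v h - F v' h\<bar> \<le> real D / 2"
    proof -
      have "\<bar>p (i v) h - p (i v') h\<bar> \<le> \<bar>real (i v) - real (i v')\<bar> / 2"
        "\<bar>p (j v) h - p (j v') h\<bar> \<le> \<bar>real (j v) - real (j v')\<bar> / 2"
        unfolding p_def using q i j vg by blast+
      moreover have "F v h - F v' h = ((p (i v) h - p (i v') h) + (p (j v) h - p (j v') h)) / 2"
        by (simp add: F_def field_simps)
      moreover have avg: "\<bar>(x + y) / 2\<bar> \<le> d / 2"
        if "\<bar>x\<bar> \<le> a / 2" "\<bar>y\<bar> \<le> b / 2" "a + b \<le> 2 * d" for x y a b d :: real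
      proof -
        have "\<bar>x + y\<bar> \<le> a / 2 + b / 2" using abs_triangle_ineq [of x y] that(1,2) by linarith
        then show ?thesis using that(3) by simp
      qed
      ultimately show ?thesis using ij [OF vv] by (simp only:)
    qed
    ultimately show ?thesis by simp
  qed
  have F_path: "\<bar>F v' g' - F v \<one>\<^bsub>A\<^esub>\<bar> \<le> real m * (real D / 2)"
    if "v' \<in> pverts G" "g' \<in> carrier A" "(raag_gen G v, vtx v' g') \<in> parcs (extension_graph G) ^^ m" for m v' g'
    using that
  proof (induction m arbitrary: v' g')
    case 0
    then have "vtx v \<one>\<^bsub>A\<^esub> = vtx v' g'" using v by simp
    then show ?case using F_eq [OF v 0(1) _ 0(2)] by simp
  next
    case (Suc m)
    then obtain z where z: "(raag_gen G v, z) \<in> parcs (extension_graph G) ^^ m"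
      "(z, vtx v' g') \<in> parcs (extension_graph G)" by auto
    then have "z \<in> ext_verts G" by (auto simp: extension_graph_def)
    then obtain u h where u: "u \<in> pverts G" "h \<in> carrier A" "z = vtx u h" by (rule ext_vertsE)
    have "\<bar>F u h - F v \<one>\<^bsub>A\<^esub>\<bar> \<le> real m * (real D / 2)" using Suc.IH u z by blast
    moreover have "\<bar>F u h - F v' g'\<bar> \<le> real D / 2" using F_edge u z Suc.prems by blast
    moreover have "F v' g' - F v \<one>\<^bsub>A\<^esub> = (F u h - F v \<one>\<^bsub>A\<^esub>) - (F u h - F v' g')" by simp
    then have "\<bar>F v' g' - F v \<one>\<^bsub>A\<^esub>\<bar> \<le> \<bar>F u h - F v \<one>\<^bsub>A\<^esub>\<bar> + \<bar>F u h - F v' g'\<bar>"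
      using abs_triangle_ineq4 [of "F u h - F v \<one>\<^bsub>A\<^esub>" "F u h - F v' g'"] by simp
    ultimately show ?case by (simp add: algebra_simps)
  qed
  have LW: "?L \<in> Wds" using l(1) by simp
  have p1: "p m \<one>\<^bsub>A\<^esub> = - q m" for m
    using state_cls [of "[]"] by (simp add: p_def cls_Nil progress_Nil)
  have pk: "p m (cls ?L) = real k - q m" if "m \<le> r" for m
  proof -
    have "letter_count (t m) l > 0" using t(1) [OF that] letter_count_pos [of "t m" l] by blast
    moreover have "state (cls ?L) = projs ?L"
      using state_cls [OF LW] foldr_push_reduced [OF l(2) [of k]] by (simp only:)
    then have "progress (state (cls ?L)) ?L (t m) = k * letter_count (t m) l"
      by (simp only: progress_self letter_count_pow)
    ultimately show ?thesis unfolding p_def by (simp only: of_nat_mult) simp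
  qed
  have "p (i v) (cls ?L) = real k - q (i v)" "p (j v) (cls ?L) = real k - q (j v)"
    using pk i [OF v] j [OF v] by blast+
  then have "F v (cls ?L) - F v \<one>\<^bsub>A\<^esub> = real k"
    unfolding F_def p1 by (simp only:) (simp add: field_simps)
  moreover have "\<bar>F v (cls ?L) - F v \<one>\<^bsub>A\<^esub>\<bar> \<le> real m * (real D / 2)"
    using F_path [OF v cls_closed [OF LW] path [unfolded cls_pow [OF l(1)]]] .
  ultimately show ?thesis by (simp add: field_simps)
qed

end

section \<open>The metric on the extension graph and translation lengths\<close>

lemma (in pair_wf_digraph) awalk_relpow:
  "u \<in> pverts G \<Longrightarrow> (u, v) \<in> parcs G ^^ m \<longleftrightarrow> (\<exists>p. awalk u p v \<and> length p = m)"
proof (induction m arbitrary: u)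
  case 0
  then show ?case by (auto simp: awalk_Nil_iff)
next
  case (Suc m)
  have "(u, v) \<in> parcs G ^^ Suc m \<longleftrightarrow> (\<exists>w. (u, w) \<in> parcs G \<and> (\<exists>p. awalk w p v \<and> length p = m))"
  proof
    assume "(u, v) \<in> parcs G ^^ Suc m"
    from relpow_Suc_D2 [OF this] obtain w where "(u, w) \<in> parcs G" "(w, v) \<in> parcs G ^^ m" by blast
    then show "\<exists>w. (u, w) \<in> parcs G \<and> (\<exists>p. awalk w p v \<and> length p = m)"
      using Suc.IH [OF in_arcsD2] by blast
  next
    assume "\<exists>w. (u, w) \<in> parcs G \<and> (\<exists>p. awalk w p v \<and> length p = m)"
    then obtain w where "(u, w) \<in> parcs G" "(w, v) \<in> parcs G ^^ m"
      using Suc.IH [OF in_arcsD2] by blast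
    then show "(u, v) \<in> parcs G ^^ Suc m" by (rule relpow_Suc_I2)
  qed
  also have "\<dots> \<longleftrightarrow> (\<exists>p. awalk u p v \<and> length p = Suc m)"
  proof
    assume "\<exists>w. (u, w) \<in> parcs G \<and> (\<exists>p. awalk w p v \<and> length p = m)"
    then obtain w p where "(u, w) \<in> parcs G" "awalk w p v" "length p = m" by blast
    then have "awalk u ((u, w) # p) v \<and> length ((u, w) # p) = Suc m" by (simp add: awalk_Cons_iff)
    then show "\<exists>p. awalk u p v \<and> length p = Suc m" by blast
  next
    assume "\<exists>p. awalk u p v \<and> length p = Suc m"
    then obtain e p where "awalk u (e # p) v" "length p = m" by (auto simp: length_Suc_conv)
    then have "(u, snd e) \<in> parcs G" "awalk (snd e) p v" by (auto simp: awalk_Cons_iff)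
    then show "\<exists>w. (u, w) \<in> parcs G \<and> (\<exists>p. awalk w p v \<and> length p = m)"
      using \<open>length p = m\<close> by blast
  qed
  finally show ?case .
qed

lemma (in pair_wf_digraph) graph_dist_eq:
  assumes u: "u \<in> pverts G" and m: "(u, v) \<in> parcs G ^^ m"
  shows "graph_dist G u v = ereal (real (LEAST k. (u, v) \<in> parcs G ^^ k))"
proof -
  let ?k = "LEAST k. (u, v) \<in> parcs G ^^ k"
  have len: "awalk_cost (\<lambda>_. 1) p = real (length p)" for p :: "('a \<times> 'a) list"
    by (induction p) auto
  obtain p where p: "awalk u p v" "length p = ?k"
    using LeastI [of "\<lambda>k. (u, v) \<in> parcs G ^^ k", OF m] awalk_relpow [OF u] by blast
  have "(INF p\<in>{p. awalk u p v}. ereal (awalk_cost (\<lambda>_. 1) p)) = ereal (real ?k)"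
  proof (rule antisym)
    show "(INF p\<in>{p. awalk u p v}. ereal (awalk_cost (\<lambda>_. 1) p)) \<le> ereal (real ?k)"
      using p by (intro INF_lower2 [of p]) (auto simp: len)
    show "ereal (real ?k) \<le> (INF p\<in>{p. awalk u p v}. ereal (awalk_cost (\<lambda>_. 1) p))"
    proof (rule INF_greatest)
      fix p assume "p \<in> {p. awalk u p v}"
      then have "(u, v) \<in> parcs G ^^ length p" using awalk_relpow [OF u] by auto
      then show "ereal (real ?k) \<le> ereal (awalk_cost (\<lambda>_. 1) p)" by (simp add: len Least_le)
    qed
  qed
  then show ?thesis by (simp add: graph_dist_def \<mu>_def)
qed

lemma subadditive_mult_add:
  fixes f :: "nat \<Rightarrow> real"
  assumes sub: "\<And>m n. f (m + n) \<le> f m + f n"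
  shows "f (q * m + r) \<le> real q * f m + f r"
proof (induction q)
  case (Suc q)
  have "f (Suc q * m + r) = f (m + (q * m + r))" by (simp add: algebra_simps)
  also have "\<dots> \<le> f m + (real q * f m + f r)" using sub [of m "q * m + r"] Suc by linarith
  finally show ?case by (simp add: algebra_simps)
qed simp

text \<open>
  Fekete's lemma: \<open>f k / k\<close> tends to its infimum, because for fixed \<open>m\<close> division
  with remainder gives \<open>f k / k \<le> f m / m + O(1/k)\<close>.
\<close>

lemma fekete:
  fixes f :: "nat \<Rightarrow> real"
  assumes sub: "\<And>m n. f (m + n) \<le> f m + f n" and nonneg: "\<And>n. 0 \<le> f n"
  shows "\<exists>t. (\<lambda>k. f k / real k) \<longlonglongrightarrow> t \<and> (\<forall>k>0. t \<le> f k / real k)"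
proof (intro exI conjI allI impI)
  define X where "X = (\<lambda>k. f k / real k) ` {0<..}"
  have bdd: "bdd_below X" using nonneg by (auto simp: X_def intro!: bdd_belowI [of _ 0])
  show le: "Inf X \<le> f k / real k" if "k > 0" for k
    using that bdd by (auto simp: X_def intro!: cInf_lower)
  show "(\<lambda>k. f k / real k) \<longlonglongrightarrow> Inf X"
  proof (rule order_tendstoI)
    fix a assume "a < Inf X"
    then show "\<forall>\<^sub>F k in sequentially. a < f k / real k"
      using le by (intro eventually_sequentiallyI [of 1]) (auto intro: less_le_trans)
  next
    fix a assume "Inf X < a"
    then obtain m where m: "m > 0" "f m / real m < a"
      using cInf_lessD [of X a] by (auto simp: X_def)
    define C where "C = Max (f ` {..<m})"
    have C: "f r \<le> C" if "r < m" for r using that by (auto simp: C_def)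
    have "(\<lambda>k. f m / real m + C / real k) \<longlonglongrightarrow> f m / real m + 0"
      by (intro tendsto_intros lim_const_over_n)
    then have "\<forall>\<^sub>F k in sequentially. f m / real m + C / real k < a"
      using m by (intro order_tendstoD) auto
    then show "\<forall>\<^sub>F k in sequentially. f k / real k < a"
      using eventually_gt_at_top [of 0]
    proof eventually_elim
      case (elim k)
      have "f k \<le> real (k div m) * f m + f (k mod m)"
        using subadditive_mult_add [of f "k div m" m "k mod m"] sub by simp
      also have "\<dots> \<le> real k / real m * f m + C"
      proof (intro add_mono mult_right_mono C nonneg)
        have "real (k div m * m) \<le> real k" by (simp only: of_nat_le_iff div_times_less_eq_dividend)
        then show "real (k div m) \<le> real k / real m" using m by (simp add: field_simps)
        show "k mod m < m" using m by simp
      qed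
      finally have "f k / real k \<le> (real k / real m * f m + C) / real k"
        by (rule divide_right_mono) simp
      also have "\<dots> = f m / real m + C / real k" using elim by (simp add: field_simps)
      finally show ?case using elim by simp
    qed
  qed
qed

locale connected_pair_graph = pair_graph +
  assumes nonempty: "pverts G \<noteq> {}"
    and connected_arcs: "u \<in> pverts G \<Longrightarrow> v \<in> pverts G \<Longrightarrow> (u, v) \<in> (parcs G)\<^sup>*"
begin

abbreviation E :: "'a word set rel" where
  "E \<equiv> parcs (extension_graph G)"

abbreviation X :: "'a word set set" where
  "X \<equiv> ext_verts G"

lemma X_carrier: "x \<in> X \<Longrightarrow> x \<in> carrier A"
  by (auto elim!: ext_vertsE)

lemma X_conj: "x \<in> X \<Longrightarrow> g \<in> carrier A \<Longrightarrow> conj_act A x g \<in> X"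
  by (elim ext_vertsE) (simp add: A.conj_act_mult [symmetric] ext_verts_vtx)

lemma X_nonempty: "X \<noteq> {}"
  using nonempty ext_verts_vtx A.one_closed by blast

sublocale ext: pair_wf_digraph "extension_graph G"
  by unfold_locales (auto simp: extension_graph_def)

lemma E_iff: "(x, y) \<in> E \<longleftrightarrow> x \<in> X \<and> y \<in> X \<and> x \<noteq> y \<and> x \<otimes>\<^bsub>A\<^esub> y = y \<otimes>\<^bsub>A\<^esub> x"
  by (simp add: extension_graph_def)

lemma commute_E: "x \<in> X \<Longrightarrow> y \<in> X \<Longrightarrow> x \<otimes>\<^bsub>A\<^esub> y = y \<otimes>\<^bsub>A\<^esub> x \<Longrightarrow> (x, y) \<in> E\<^sup>="
  by (auto simp: E_iff)

lemma E_sym: "(x, y) \<in> E \<Longrightarrow> (y, x) \<in> E"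
  by (auto simp: E_iff)

lemma E_conj: "(x, y) \<in> E \<Longrightarrow> g \<in> carrier A \<Longrightarrow> (conj_act A x g, conj_act A y g) \<in> E"
  by (simp add: E_iff X_conj X_carrier A.conj_act_eq_iff A.conj_act_hom [symmetric])

lemma relpow_conj: "(x, y) \<in> E ^^ m \<Longrightarrow> g \<in> carrier A \<Longrightarrow> (conj_act A x g, conj_act A y g) \<in> E ^^ m"
  by (induction m arbitrary: y) (auto intro: E_conj)

lemma relpow_sym: "(x, y) \<in> E ^^ m \<Longrightarrow> (y, x) \<in> E ^^ m"
proof (induction m arbitrary: y)
  case (Suc m)
  then obtain z where z: "(x, z) \<in> E ^^ m" "(z, y) \<in> E" by auto
  show ?case by (rule relpow_Suc_I2 [OF E_sym [OF z(2)] Suc.IH [OF z(1)]])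
qed simp

lemma gen_commute:
  "com u v \<Longrightarrow> raag_gen G u \<otimes>\<^bsub>A\<^esub> raag_gen G v = raag_gen G v \<otimes>\<^bsub>A\<^esub> raag_gen G u"
  unfolding raag_gen_cls by (rule cls_letters_commute) (auto dest: in_arcsD1 in_arcsD2)

lemma vtx_commute:
  assumes "com u v" "g \<in> carrier A"
  shows "(vtx u g, vtx v g) \<in> E\<^sup>="
proof -
  have V: "u \<in> pverts G" "v \<in> pverts G" using assms(1) by (auto dest: in_arcsD1 in_arcsD2)
  have "vtx u g \<otimes>\<^bsub>A\<^esub> vtx v g = vtx v g \<otimes>\<^bsub>A\<^esub> vtx u g"
    unfolding A.conj_act_hom [OF gen_closed [OF V(1)] gen_closed [OF V(2)] assms(2), symmetric]
      A.conj_act_hom [OF gen_closed [OF V(2)] gen_closed [OF V(1)] assms(2), symmetric]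
      gen_commute [OF assms(1)] ..
  then show ?thesis by (intro commute_E ext_verts_vtx V assms(2))
qed

lemma vtx_same_conjugator:
  assumes "u \<in> pverts G" "v \<in> pverts G" "g \<in> carrier A"
  shows "(vtx u g, vtx v g) \<in> E\<^sup>*"
  using connected_arcs [OF assms(1,2)]
proof induction
  case (step y z)
  have "(vtx y g, vtx z g) \<in> E\<^sup>*" 
    using r_into_rtrancl [OF vtx_commute [OF step(2) assms(3)]] unfolding rtrancl_reflcl .
  then show ?case using step(3) by (rule rtrancl_trans [rotated])
qed simp

text \<open>
  The letter \<open>a\<close> fixes its own vertex, so the conjugates by \<open>w\<close> and by \<open>a
  w\<close> of the graph \<open>\<Gamma>\<close> share a vertex.
\<close>

lemma vtx_connected:
  assumes v: "v \<in> pverts G" and w: "w \<in> Wds"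
  shows "(raag_gen G v, vtx v (cls w)) \<in> E\<^sup>*"
  using w
proof (induction w rule: list.induct)
  case Nil
  then show ?case using v by (simp add: cls_Nil)
next
  case (Cons a w)
  have W: "w \<in> Wds" "[a] \<in> Wds" "fst a \<in> pverts G" using Cons.prems by auto
  have "raag_gen G (fst a) \<otimes>\<^bsub>A\<^esub> cls [a] = cls [a] \<otimes>\<^bsub>A\<^esub> raag_gen G (fst a)"
    unfolding raag_gen_cls using W by (intro cls_letters_commute) auto
  then have "vtx (fst a) (cls [a]) = raag_gen G (fst a)"
    using W by (subst A.conj_act_fixed_iff) auto
  then have same: "vtx (fst a) (cls (a # w)) = vtx (fst a) (cls w)"
    using W cls_Cons [OF Cons.prems] by (simp add: A.conj_act_mult)
  have "(raag_gen G v, vtx v (cls w)) \<in> E\<^sup>*" using Cons.IH W by simp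
  also have "(vtx v (cls w), vtx (fst a) (cls w)) \<in> E\<^sup>*"
    using v W by (intro vtx_same_conjugator) auto
  also have "vtx (fst a) (cls w) = vtx (fst a) (cls (a # w))" using same by simp
  also have "(vtx (fst a) (cls (a # w)), vtx v (cls (a # w))) \<in> E\<^sup>*"
    using v W Cons.prems by (intro vtx_same_conjugator) auto
  finally show ?case .
qed

lemma ext_connected:
  assumes "x \<in> X" "y \<in> X"
  shows "\<exists>m. (x, y) \<in> E ^^ m"
proof -
  obtain u g where x: "u \<in> pverts G" "g \<in> carrier A" "x = vtx u g" by (rule ext_vertsE [OF assms(1)])
  obtain v h where y: "v \<in> pverts G" "h \<in> carrier A" "y = vtx v h" by (rule ext_vertsE [OF assms(2)])
  have "sym E" by (rule symI) (rule E_sym)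
  then have s: "sym (E\<^sup>*)" by (rule sym_rtrancl)
  have "(raag_gen G u, x) \<in> E\<^sup>*" using carrier_cls vtx_connected x by blast
  then have "(x, raag_gen G u) \<in> E\<^sup>*" using s by (rule symD [rotated])
  also have "(raag_gen G u, raag_gen G v) \<in> E\<^sup>*"
    using vtx_same_conjugator [OF x(1) y(1) A.one_closed] x y by simp
  also have "(raag_gen G v, y) \<in> E\<^sup>*" using carrier_cls vtx_connected y by blast
  finally show ?thesis by (rule rtrancl_imp_relpow)
qed

abbreviation d :: "'a word set \<Rightarrow> 'a word set \<Rightarrow> real" where
  "d \<equiv> ext_dist G"

lemma d_eq:
  assumes "x \<in> X" "(x, y) \<in> E ^^ m"
  shows "d x y = real (LEAST k. (x, y) \<in> E ^^ k)"
proof -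
  have "x \<in> pverts (extension_graph G)" using assms(1) by (simp add: extension_graph_def)
  from ext.graph_dist_eq [OF this assms(2)] show ?thesis by (simp add: ext_dist_def)
qed

lemma d_le: "x \<in> X \<Longrightarrow> (x, y) \<in> E ^^ m \<Longrightarrow> d x y \<le> real m"
  by (simp only: d_eq of_nat_le_iff) (rule Least_le)

lemma d_attained:
  assumes "x \<in> X" "y \<in> X"
  shows "\<exists>m. (x, y) \<in> E ^^ m \<and> d x y = real m"
proof -
  obtain m where m: "(x, y) \<in> E ^^ m" using ext_connected [OF assms] by blast
  have "(x, y) \<in> E ^^ (LEAST k. (x, y) \<in> E ^^ k)" using m by (rule LeastI)
  with d_eq [OF assms(1) m] show ?thesis by blast
qed

lemma d_nonneg: "x \<in> X \<Longrightarrow> y \<in> X \<Longrightarrow> 0 \<le> d x y"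
  using d_attained [of x y] by auto

lemma d_triangle:
  assumes "x \<in> X" "y \<in> X" "z \<in> X"
  shows "d x z \<le> d x y + d y z"
proof -
  obtain m where m: "(x, y) \<in> E ^^ m" "d x y = real m" using d_attained [OF assms(1,2)] by blast
  obtain n where n: "(y, z) \<in> E ^^ n" "d y z = real n" using d_attained [OF assms(2,3)] by blast
  have "(x, z) \<in> E ^^ (m + n)" unfolding relpow_add using m(1) n(1) by (rule relcompI)
  from d_le [OF assms(1) this] show ?thesis using m(2) n(2) by simp
qed

lemma d_sym:
  assumes "x \<in> X" "y \<in> X"
  shows "d x y = d y x"
proof -
  have le: "d x y \<le> d y x" if xy: "x \<in> X" "y \<in> X" for x y
  proof -
    obtain m where m: "(y, x) \<in> E ^^ m" "d y x = real m" using d_attained [OF xy(2,1)] by blast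
    show ?thesis unfolding m(2) by (rule d_le [OF xy(1) relpow_sym [OF m(1)]])
  qed
  show ?thesis by (rule antisym [OF le [OF assms] le [OF assms(2,1)]])
qed

lemma d_conj:
  assumes "x \<in> X" "y \<in> X" "g \<in> carrier A"
  shows "d (conj_act A x g) (conj_act A y g) = d x y"
proof (rule antisym)
  have le: "d (conj_act A x g) (conj_act A y g) \<le> d x y" if xy: "x \<in> X" "y \<in> X" "g \<in> carrier A" for x y g
  proof -
    obtain m where m: "(x, y) \<in> E ^^ m" "d x y = real m" using d_attained [OF xy(1,2)] by blast
    show ?thesis unfolding m(2) by (rule d_le [OF X_conj [OF xy(1,3)] relpow_conj [OF m(1) xy(3)]])
  qed
  show "d (conj_act A x g) (conj_act A y g) \<le> d x y" by (rule le [OF assms])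
  have undo: "conj_act A (conj_act A z g) (inv\<^bsub>A\<^esub> g) = z" if "z \<in> X" for z
    unfolding A.conj_act_mult [OF X_carrier [OF that] assms(3) A.inv_closed [OF assms(3)], symmetric]
    using X_carrier [OF that] assms(3) by simp
  show "d x y \<le> d (conj_act A x g) (conj_act A y g)"
    using le [OF X_conj [OF assms(1,3)] X_conj [OF assms(2,3)] A.inv_closed [OF assms(3)]]
    unfolding undo [OF assms(1)] undo [OF assms(2)] .
qed

abbreviation tau :: "'a word set \<Rightarrow> real" where
  "tau \<equiv> asymp_translation_length A X d (conj_act A)"

text \<open>
  The limit exists by Fekete's lemma. It does not depend on the base point as \<open>d\<close> is invariant,
  so that the displacements at \<open>x\<close> and \<open>y\<close> differ by at most \<open>2 d x
  y\<close>.
\<close>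

lemma translation_length:
  assumes g: "g \<in> carrier A"
  shows "\<And>x. x \<in> X \<Longrightarrow> (\<lambda>k. d (conj_act A x (g [^]\<^bsub>A\<^esub> k)) x / real k) \<longlonglongrightarrow> tau g" (is "\<And>x. _ \<Longrightarrow> ?L x")
    and "\<And>x k. x \<in> X \<Longrightarrow> k > 0 \<Longrightarrow> tau g \<le> d (conj_act A x (g [^]\<^bsub>A\<^esub> k)) x / real k"
proof -
  let ?f = "\<lambda>x (k::nat). d (conj_act A x (g [^]\<^bsub>A\<^esub> k)) x"
  have Xk: "conj_act A x (g [^]\<^bsub>A\<^esub> (k::nat)) \<in> X" if "x \<in> X" for x k using X_conj that g by simp
  have "\<exists>t. (\<lambda>k. ?f x k / real k) \<longlonglongrightarrow> t \<and> (\<forall>k>0. t \<le> ?f x k / real k)" if x: "x \<in> X" for x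
  proof (rule fekete)
    fix m n :: nat
    have "conj_act A x (g [^]\<^bsub>A\<^esub> (m + n)) = conj_act A (conj_act A x (g [^]\<^bsub>A\<^esub> m)) (g [^]\<^bsub>A\<^esub> n)"
      using X_carrier x g by (simp add: A.conj_act_mult A.nat_pow_mult [symmetric])
    then have "d (conj_act A x (g [^]\<^bsub>A\<^esub> (m + n))) (conj_act A x (g [^]\<^bsub>A\<^esub> n)) = ?f x m"
      using d_conj [OF Xk [OF x] x, of "g [^]\<^bsub>A\<^esub> n" m] g by simp
    then show "?f x (m + n) \<le> ?f x m + ?f x n"
      using d_triangle [OF Xk [OF x] Xk [OF x] x, of "m + n" n] by simp
    show "0 \<le> ?f x n" by (rule d_nonneg [OF Xk [OF x] x])
  qed
  then have "\<forall>x\<in>X. \<exists>t. (\<lambda>k. ?f x k / real k) \<longlonglongrightarrow> t \<and> (\<forall>k>0. t \<le> ?f x k / real k)" by blast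
  from bchoice [OF this] obtain t where
    t: "\<And>x. x \<in> X \<Longrightarrow> (\<lambda>k. ?f x k / real k) \<longlonglongrightarrow> t x"
      "\<And>x k. x \<in> X \<Longrightarrow> k > 0 \<Longrightarrow> t x \<le> ?f x k / real k" by blast
  have same: "t x \<le> t y" if x: "x \<in> X" and y: "y \<in> X" for x y
  proof -
    have "(\<lambda>k. ?f y k / real k + 2 * d x y / real k) \<longlonglongrightarrow> t y + 0"
      by (intro tendsto_add t y lim_const_over_n)
    moreover have "?f x k / real k \<le> ?f y k / real k + 2 * d x y / real k" for k
    proof -
      have "?f x k \<le> d (conj_act A x (g [^]\<^bsub>A\<^esub> k)) (conj_act A y (g [^]\<^bsub>A\<^esub> k)) +
          d (conj_act A y (g [^]\<^bsub>A\<^esub> k)) x"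
        by (rule d_triangle [OF Xk [OF x] Xk [OF y] x])
      also have "\<dots> \<le> d x y + (?f y k + d y x)"
        using d_triangle [OF Xk [OF y] y x, of k] d_conj [OF x y] g by simp
      finally have "?f x k \<le> ?f y k + 2 * d x y" using d_sym [OF x y] by simp
      from divide_right_mono [OF this, of "real k"] show ?thesis by (simp add: add_divide_distrib)
    qed
    ultimately show ?thesis using LIMSEQ_le [OF t(1) [OF x]] by simp
  qed
  obtain x0 where x0: "x0 \<in> X" using X_nonempty by blast
  have eq: "t x = t x0" if "x \<in> X" for x using same [of x x0] same [of x0 x] that x0 by auto
  have "tau g = t x0"
    unfolding asymp_translation_length_def
  proof (rule the_equality)
    show "\<forall>x\<in>X. (\<lambda>k. ?f x k / real k) \<longlonglongrightarrow> t x0"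
    proof
      fix x assume x: "x \<in> X"
      show "(\<lambda>k. ?f x k / real k) \<longlonglongrightarrow> t x0" using t(1) [OF x] unfolding eq [OF x] .
    qed
    show "t' = t x0" if "\<forall>x\<in>X. (\<lambda>k. ?f x k / real k) \<longlonglongrightarrow> t'" for t'
      using that t(1) [OF x0] x0 LIMSEQ_unique by blast
  qed
  then have tx: "tau g = t x" if "x \<in> X" for x using eq [OF that] by simp
  show "?L x" if "x \<in> X" for x unfolding tx [OF that] by (rule t(1) [OF that])
  show "tau g \<le> ?f x k / real k" if "x \<in> X" "k > 0" for x k
    unfolding tx [OF that(1)] by (rule t(2) [OF that])
qed

lemma tau_conj:
  assumes g: "g \<in> carrier A" and c: "c \<in> carrier A"
  shows "tau (conj_act A g c) = tau g"
proof -
  obtain x where x: "x \<in> X" using X_nonempty by blast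
  have pow: "conj_act A g c [^]\<^bsub>A\<^esub> k = conj_act A (g [^]\<^bsub>A\<^esub> k) c" for k :: nat
  proof (induction k)
    case 0
    show ?case using c by (simp add: conj_act_def)
  next
    case (Suc k)
    then show ?case using g c by (simp add: A.conj_act_hom)
  qed
  have shift: "conj_act A (conj_act A x c) (conj_act A g c [^]\<^bsub>A\<^esub> k) =
      conj_act A (conj_act A x (g [^]\<^bsub>A\<^esub> k)) c" for k :: nat
  proof -
    have "c \<otimes>\<^bsub>A\<^esub> conj_act A (g [^]\<^bsub>A\<^esub> k) c = g [^]\<^bsub>A\<^esub> k \<otimes>\<^bsub>A\<^esub> c"
      unfolding conj_act_def using g c by (simp add: A.m_assoc [symmetric])
    then show ?thesis unfolding pow using g c X_carrier [OF x]
      by (simp only: A.conj_act_mult [symmetric] A.conj_act_closed A.nat_pow_closed)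
  qed
  have "d (conj_act A (conj_act A x c) (conj_act A g c [^]\<^bsub>A\<^esub> k)) (conj_act A x c) =
      d (conj_act A x (g [^]\<^bsub>A\<^esub> k)) x" for k :: nat
    unfolding shift by (rule d_conj [OF X_conj [OF x A.nat_pow_closed [OF g]] x c])
  then have "(\<lambda>k. d (conj_act A x (g [^]\<^bsub>A\<^esub> k)) x / real k) \<longlonglongrightarrow> tau (conj_act A g c)"
    using translation_length(1) [OF A.conj_act_closed [OF g c] X_conj [OF x c]] by (simp only:)
  then show ?thesis using translation_length(1) [OF g x] by (rule LIMSEQ_unique)
qed

lemma tau_bounded_orbit:
  assumes g: "g \<in> carrier A" and x: "x \<in> X" and C: "\<And>k. d (conj_act A x (g [^]\<^bsub>A\<^esub> (k::nat))) x \<le> C"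
  shows "tau g \<le> 0"
proof -
  have "(\<lambda>k. C / real k) \<longlonglongrightarrow> 0" by (rule lim_const_over_n)
  moreover have "d (conj_act A x (g [^]\<^bsub>A\<^esub> k)) x / real k \<le> C / real k" for k :: nat
    using C by (rule divide_right_mono) simp
  ultimately show ?thesis using LIMSEQ_le [OF translation_length(1) [OF g x]] by blast
qed

lemma tau_lower:
  assumes l: "l \<in> Wds" "\<And>k. reduced (concat (replicate k l))"
    and tr: "dominating_path (fst ` set l) D" and D: "D > 0"
  shows "2 / real D \<le> tau (cls l)"
proof -
  obtain v where v: "v \<in> pverts G" using nonempty by blast
  have x: "raag_gen G v \<in> X" using ext_verts_vtx [OF v A.one_closed] unfolding A.conj_act_one [OF gen_closed [OF v]] .
  let ?y = "\<lambda>k::nat. vtx v (cls l [^]\<^bsub>A\<^esub> k)"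
  have "2 / real D \<le> d (?y k) (raag_gen G v) / real k" if k: "k > 0" for k
  proof -
    have y: "?y k \<in> X" using l v by (simp add: ext_verts_vtx)
    obtain m where m: "(raag_gen G v, ?y k) \<in> E ^^ m" "d (raag_gen G v) (?y k) = real m"
      using d_attained [OF x y] by blast
    have "2 * real k \<le> real D * real m" by (rule ext_path_lower_bound [OF l tr v m(1)])
    then show ?thesis using k D m(2) d_sym [OF x y] by (simp add: field_simps)
  qed
  moreover have "(\<lambda>k. d (?y k) (raag_gen G v) / real k) \<longlonglongrightarrow> tau (cls l)"
    using translation_length(1) x l by simp
  ultimately show ?thesis by (intro LIMSEQ_le_const) (auto intro!: exI [of _ 1])
qed

end

section \<open>A criterion for the value of the minimal translation length\<close>

lemma (in commutation) reduced_positive: "\<forall>a\<in>set w. snd a \<Longrightarrow> reduced w"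
  unfolding reduced_def by auto

context pair_graph
begin

definition dominating :: "'a set \<Rightarrow> bool" where
  "dominating S \<longleftrightarrow> (\<forall>v\<in>pverts G. \<exists>s\<in>S. s \<noteq> v \<and> \<not> com v s)"

definition is_join :: "'a set \<Rightarrow> bool" where
  "is_join S \<longleftrightarrow> (\<exists>B C. B \<noteq> {} \<and> C \<noteq> {} \<and> S = B \<union> C \<and> (\<forall>b\<in>B. \<forall>c\<in>C. com b c))"

lemma vtx_fixed:
  assumes "v \<in> pverts G" "w \<in> Wds" "\<forall>z\<in>set w. com v (fst z) \<or> v = fst z"
  shows "vtx v (cls w) = raag_gen G v"
proof -
  have "raag_gen G v \<otimes>\<^bsub>A\<^esub> cls w = cls w \<otimes>\<^bsub>A\<^esub> raag_gen G v"
    unfolding raag_gen_cls using assms by (intro cls_commute) auto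
  then show ?thesis using A.conj_act_fixed_iff [OF gen_closed cls_closed] assms by blast
qed

text \<open>
  Letters outside \<open>B\<close> are moved to the left past those in \<open>B\<close>.
\<close>

lemma cls_filter:
  assumes "w \<in> Wds" "\<forall>a\<in>set w. \<forall>b\<in>set w. \<not> fst a \<in> B \<longrightarrow> fst b \<in> B \<longrightarrow> com (fst a) (fst b)"
  shows "cls w = cls (filter (\<lambda>a. \<not> fst a \<in> B) w) \<otimes>\<^bsub>A\<^esub> cls (filter (\<lambda>a. fst a \<in> B) w)"
  using assms
proof (induction w rule: list.induct)
  case Nil
  show ?case by (simp add: cls_Nil)
next
  case (Cons a w)
  let ?n = "filter (\<lambda>a. \<not> fst a \<in> B) w" and ?m = "filter (\<lambda>a. fst a \<in> B) w"
  have W: "[a] \<in> Wds" "w \<in> Wds" "?n \<in> Wds" "?m \<in> Wds" using Cons.prems(1) by auto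
  have IH: "cls w = cls ?n \<otimes>\<^bsub>A\<^esub> cls ?m" using Cons W by auto
  have e: "cls (a # w) = cls [a] \<otimes>\<^bsub>A\<^esub> (cls ?n \<otimes>\<^bsub>A\<^esub> cls ?m)"
    unfolding cls_Cons [OF Cons.prems(1)] IH ..
  show ?case
  proof (cases "fst a \<in> B")
    case True
    have "cls [a] \<otimes>\<^bsub>A\<^esub> cls ?n = cls ?n \<otimes>\<^bsub>A\<^esub> cls [a]"
      using W True Cons.prems(2) com_sym by (intro cls_commute) auto
    then have "cls (a # w) = cls ?n \<otimes>\<^bsub>A\<^esub> (cls [a] \<otimes>\<^bsub>A\<^esub> cls ?m)"
      unfolding e using W by (simp add: A.m_assoc [symmetric])
    also have "cls [a] \<otimes>\<^bsub>A\<^esub> cls ?m = cls (a # ?m)" using cls_append [OF W(1,4)] by simp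
    finally show ?thesis using True by simp
  next
    case False
    have "cls (a # w) = (cls [a] \<otimes>\<^bsub>A\<^esub> cls ?n) \<otimes>\<^bsub>A\<^esub> cls ?m"
      unfolding e using W by (simp add: A.m_assoc)
    also have "cls [a] \<otimes>\<^bsub>A\<^esub> cls ?n = cls (a # ?n)" using cls_append [OF W(1,3)] by simp
    finally show ?thesis using False by simp
  qed
qed

end

context connected_pair_graph
begin

lemma gen_X: "v \<in> pverts G \<Longrightarrow> raag_gen G v \<in> X"
  using ext_verts_vtx [OF _ A.one_closed] A.conj_act_one gen_closed by metis

lemma d_le_1: "x \<in> X \<Longrightarrow> (x, y) \<in> E\<^sup>= \<Longrightarrow> d x y \<le> 1"
  using d_le [of x y 0] d_le [of x y 1] by auto

text \<open>
  Such a generator \<open>v\<close> is a fixed point.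
\<close>

lemma tau_not_dominating:
  assumes l: "l \<in> Wds" and v: "v \<in> pverts G" "\<forall>s\<in>fst ` set l. com v s \<or> v = s"
  shows "tau (cls l) \<le> 0"
proof (rule tau_bounded_orbit [OF cls_closed [OF l] gen_X [OF v(1)]])
  fix k :: nat
  have "vtx v (cls l [^]\<^bsub>A\<^esub> k) = raag_gen G v"
    unfolding cls_pow [OF l] using l v by (intro vtx_fixed) auto
  then show "d (vtx v (cls l [^]\<^bsub>A\<^esub> k)) (raag_gen G v) \<le> 0"
    using d_le [OF gen_X [OF v(1)], of _ 0] by simp
qed

text \<open>
  For commuting parts \<open>B\<close>, \<open>C\<close> of the support, a power of \<open>l\<close> acts on
  a generator \<open>b\<close> from \<open>B\<close> as its \<open>B\<close>-part, and the result still
  commutes with every \<open>c\<close> from \<open>C\<close>. So the orbit of \<open>b\<close> stays within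
  distance 1 of \<open>c\<close>.
\<close>

lemma tau_join:
  assumes l: "l \<in> Wds" and join: "is_join (fst ` set l)"
  shows "tau (cls l) \<le> 0"
proof -
  obtain B C where BC: "B \<noteq> {}" "C \<noteq> {}" "fst ` set l = B \<union> C" "\<forall>b\<in>B. \<forall>c\<in>C. com b c"
    using join unfolding is_join_def by (elim exE conjE)
  obtain b c where bc: "b \<in> B" "c \<in> C" using BC by blast
  have V: "b \<in> pverts G" "c \<in> pverts G" "com b c" using bc BC(4) by (auto dest: in_arcsD1 in_arcsD2)
  show ?thesis
  proof (rule tau_bounded_orbit [OF cls_closed [OF l] gen_X [OF V(1)]])
    fix k :: nat
    let ?w = "concat (replicate k l)"
    let ?n = "filter (\<lambda>a. \<not> fst a \<in> B) ?w" and ?m = "filter (\<lambda>a. fst a \<in> B) ?w"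
    have W: "?w \<in> Wds" using l by simp
    have W': "?n \<in> Wds" "?m \<in> Wds" using W by auto
    have "fst ` set ?w \<subseteq> fst ` set l" by auto
    then have "fst ` set ?w \<subseteq> B \<union> C" unfolding BC(3) .
    then have nC: "\<forall>a\<in>set ?n. fst a \<in> C" by (auto simp del: set_concat set_replicate)
    have split: "cls ?w = cls ?n \<otimes>\<^bsub>A\<^esub> cls ?m"
    proof (rule cls_filter [OF W], intro ballI impI)
      fix a a' assume "a \<in> set ?w" "a' \<in> set ?w" "\<not> fst a \<in> B" "fst a' \<in> B"
      then have "fst a \<in> C" using \<open>fst ` set ?w \<subseteq> B \<union> C\<close> by auto
      then show "com (fst a) (fst a')" using BC(4) \<open>fst a' \<in> B\<close> com_sym by blast
    qed
    have "vtx b (cls ?n) = raag_gen G b" using V W' nC bc BC(4) by (intro vtx_fixed) auto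
    then have eb: "vtx b (cls ?w) = vtx b (cls ?m)"
      unfolding split A.conj_act_mult [OF gen_closed [OF V(1)] cls_closed [OF W'(1)] cls_closed [OF W'(2)]]
      by simp
    have "\<forall>z\<in>set ?m. com c (fst z) \<or> c = fst z" using bc BC(4) com_sym by auto
    then have ec: "vtx c (cls ?m) = raag_gen G c" using V W' by (intro vtx_fixed)
    have x: "vtx b (cls ?m) \<in> X" by (rule ext_verts_vtx [OF V(1) cls_closed [OF W'(2)]])
    have "d (vtx b (cls ?m)) (raag_gen G c) \<le> 1"
      using d_le_1 [OF x vtx_commute [OF V(3) cls_closed [OF W'(2)]]] unfolding ec .
    moreover have "d (raag_gen G c) (raag_gen G b) \<le> 1"
      using d_le_1 [OF gen_X [OF V(2)]] vtx_commute [OF com_sym [OF V(3)] A.one_closed] V by simp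
    ultimately show "d (vtx b (cls l [^]\<^bsub>A\<^esub> k)) (raag_gen G b) \<le> 2"
      unfolding cls_pow [OF l] eb using d_triangle [OF x gen_X [OF V(2)] gen_X [OF V(1)]] by simp
  qed
qed

text \<open>
  The generator \<open>u\<close> is moved by \<open>g\<^sup>D\<close> by at most 2: since \<open>b\<close>
  fixes \<open>u\<close> and \<open>a\<close> fixes \<open>v\<close>, the images of \<open>v\<close> under
  \<open>b\<close> and under \<open>a b\<close> agree, and they are adjacent to \<open>u\<close> and to the
  image of \<open>u\<close>.
\<close>

lemma tau_upper:
  assumes g: "g \<in> carrier A" and D: "D > 0" and ab: "a \<in> Wds" "b \<in> Wds"
    and pow: "g [^]\<^bsub>A\<^esub> D = cls a \<otimes>\<^bsub>A\<^esub> cls b" and uv: "com u v"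
    and a: "\<forall>z\<in>set a. com v (fst z) \<or> v = fst z"
    and b: "\<forall>z\<in>set b. com u (fst z) \<or> u = fst z"
  shows "tau g \<le> 2 / real D"
proof -
  have V: "u \<in> pverts G" "v \<in> pverts G" using uv by (auto dest: in_arcsD1 in_arcsD2)
  have C: "cls a \<in> carrier A" "cls b \<in> carrier A" using ab by auto
  let ?h = "cls a \<otimes>\<^bsub>A\<^esub> cls b"
  have h: "?h \<in> carrier A" using C by simp
  have ub: "vtx u (cls b) = raag_gen G u" by (rule vtx_fixed [OF V(1) ab(2) b])
  have vh: "vtx v ?h = vtx v (cls b)"
    unfolding A.conj_act_mult [OF gen_closed [OF V(2)] C] vtx_fixed [OF V(2) ab(1) a] ..
  have x: "vtx u ?h \<in> X" "vtx v ?h \<in> X" using ext_verts_vtx V h by blast+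
  have "d (vtx u ?h) (vtx v ?h) \<le> 1" by (rule d_le_1 [OF x(1) vtx_commute [OF uv h]])
  moreover have "d (vtx v ?h) (raag_gen G u) \<le> 1"
    using d_le_1 [OF _ vtx_commute [OF com_sym [OF uv] C(2)]] x(2) unfolding ub vh by blast
  ultimately have "d (vtx u ?h) (raag_gen G u) \<le> 2"
    using d_triangle [OF x gen_X [OF V(1)]] by simp
  then have "d (vtx u (g [^]\<^bsub>A\<^esub> D)) (raag_gen G u) / real D \<le> 2 / real D"
    unfolding pow by (rule divide_right_mono) simp
  then show ?thesis using translation_length(2) [OF g gen_X [OF V(1)] D] by linarith
qed

text \<open>
  An element of positive translation length is conjugate to a cyclically reduced word, whose support is
  dominating and not a join, so the lower bound applies to it. The word \<open>l\<close> attains the bound.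
\<close>

theorem min_translation_length_eq:
  assumes D: "D > 0"
    and S: "\<And>S. S \<subseteq> pverts G \<Longrightarrow> dominating S \<Longrightarrow> \<not> is_join S \<Longrightarrow> dominating_path S D"
    and l: "l \<in> Wds" "\<forall>a\<in>set l. snd a" "dominating_path (fst ` set l) D"
    and ab: "a \<in> Wds" "b \<in> Wds" "cls l [^]\<^bsub>A\<^esub> D = cls a \<otimes>\<^bsub>A\<^esub> cls b"
    and uv: "com u v" "\<forall>z\<in>set a. com v (fst z) \<or> v = fst z" "\<forall>z\<in>set b. com u (fst z) \<or> u = fst z"
  shows "raag_min_translation_length G = 2 / real D"
proof -
  have "reduced (concat (replicate k l))" for k using l(2) by (intro reduced_positive) auto
  then have "2 / real D \<le> tau (cls l)" using tau_lower [OF l(1) _ l(3) D] by blast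
  moreover have "tau (cls l) \<le> 2 / real D"
    by (rule tau_upper [OF cls_closed [OF l(1)] D ab uv])
  ultimately have attained: "tau (cls l) = 2 / real D" by simp
  have lower: "2 / real D \<le> tau g" if g: "g \<in> carrier A" and pos: "tau g > 0" for g
  proof -
    obtain m c where m: "m \<in> Wds" "c \<in> carrier A" "g = conj_act A (cls m) c"
      and red: "\<And>k. reduced (concat (replicate k m))"
      using cyclic_reduction [OF g] by blast
    have tg: "tau g = tau (cls m)" unfolding m(3) by (rule tau_conj [OF cls_closed [OF m(1)] m(2)])
    have "fst ` set m \<subseteq> pverts G" using m(1) by auto
    moreover have "dominating (fst ` set m)"
    proof (rule ccontr)
      assume "\<not> dominating (fst ` set m)"
      then obtain v where v: "v \<in> pverts G" "\<not> (\<exists>s\<in>fst ` set m. s \<noteq> v \<and> \<not> com v s)"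
        unfolding dominating_def by auto
      have "\<forall>s\<in>fst ` set m. com v s \<or> v = s" using v(2) by auto
      from tau_not_dominating [OF m(1) v(1) this] show False using pos tg by simp
    qed
    moreover have "\<not> is_join (fst ` set m)" using tau_join [OF m(1)] pos tg by auto
    ultimately have "dominating_path (fst ` set m) D" by (rule S)
    from tau_lower [OF m(1) red this D] show ?thesis unfolding tg .
  qed
  have "pverts (extension_graph G) = X" by (simp add: extension_graph_def)
  then have "raag_min_translation_length G = (LEAST t. t \<in> {tau g | g. g \<in> carrier A \<and> tau g > 0})"
    unfolding raag_min_translation_length_def min_asymp_translation_length_def by simp
  also have "\<dots> = 2 / real D"
  proof (rule Least_equality)
    have "tau (cls l) > 0" using attained D by simp
    then show "2 / real D \<in> {tau g | g. g \<in> carrier A \<and> tau g > 0}"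
      using attained cls_closed [OF l(1)] by (intro CollectI exI [of _ "cls l"]) simp
    show "2 / real D \<le> t" if "t \<in> {tau g | g. g \<in> carrier A \<and> tau g > 0}" for t
      using that lower by blast
  qed
  finally show ?thesis .
qed

end

section \<open>Graphs of diameter two given by noncommutation\<close>

context pair_graph
begin

lemma diameter_two:
  assumes two: "\<And>u v. u \<in> pverts G \<Longrightarrow> v \<in> pverts G \<Longrightarrow> u \<noteq> v \<Longrightarrow> \<not> com u v \<Longrightarrow> \<exists>w. com u w \<and> com w v"
    and far: "p \<in> pverts G" "q \<in> pverts G" "p \<noteq> q" "\<not> com p q"
  shows "\<And>u v. u \<in> pverts G \<Longrightarrow> v \<in> pverts G \<Longrightarrow> (u, v) \<in> (parcs G)\<^sup>*"
    and "Digraph_Component.connected (with_proj G)" and "diam G = 2"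
proof -
  have short: "\<exists>m\<le>2. (u, v) \<in> parcs G ^^ m" if uv: "u \<in> pverts G" "v \<in> pverts G" for u v
  proof -
    consider "u = v" | "com u v" | w where "com u w" "com w v" using two [OF uv] by blast
    then show ?thesis
    proof cases
      case 1
      then show ?thesis by (intro exI [of _ 0]) simp
    next
      case 2
      then show ?thesis by (intro exI [of _ 1]) simp
    next
      case 3
      then show ?thesis by (intro exI [of _ 2]) (auto simp: numeral_2_eq_2)
    qed
  qed
  then show path: "(u, v) \<in> (parcs G)\<^sup>*" if "u \<in> pverts G" "v \<in> pverts G" for u v
    using that relpow_imp_rtrancl by blast
  have "parcs (mk_symmetric (with_proj G)) = parcs G"
    by (auto simp: parcs_mk_symmetric intro: arcs_symmetric)
  moreover have "(u, v) \<in> rtrancl_on (pverts G) (parcs G)" if "u \<in> pverts G" "v \<in> pverts G" for u v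
    using path [OF that] that(1)
    by (induction rule: rtrancl_induct) (auto intro: rtrancl_on_into_rtrancl_on dest: in_arcsD2)
  ultimately show "Digraph_Component.connected (with_proj G)"
    using far(1) by (auto simp: Digraph_Component.connected_def strongly_connected_def reachable_def)
  have dist: "\<exists>k\<le>2. graph_dist G u v = ereal (real k) \<and> (u, v) \<in> parcs G ^^ k"
    if uv: "u \<in> pverts G" "v \<in> pverts G" for u v
  proof -
    obtain m where m: "m \<le> 2" "(u, v) \<in> parcs G ^^ m" using short [OF uv] by blast
    let ?k = "LEAST k. (u, v) \<in> parcs G ^^ k"
    have "?k \<le> 2" using Least_le [of "\<lambda>k. (u, v) \<in> parcs G ^^ k", OF m(2)] m(1) by simp
    moreover have "(u, v) \<in> parcs G ^^ ?k" using m(2) by (rule LeastI)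
    moreover have "graph_dist G u v = ereal (real ?k)" by (rule graph_dist_eq [OF uv(1) m(2)])
    ultimately show ?thesis by blast
  qed
  show "diam G = 2" unfolding diam_def
  proof (rule Max_eqI)
    have "{graph_dist G u v | u v. u \<in> pverts G \<and> v \<in> pverts G} =
        (\<lambda>(u, v). graph_dist G u v) ` (pverts G \<times> pverts G)" by auto
    then show "finite {graph_dist G u v | u v. u \<in> pverts G \<and> v \<in> pverts G}"
      using pair_finite_verts by simp
    show "x \<le> 2" if x: "x \<in> {graph_dist G u v | u v. u \<in> pverts G \<and> v \<in> pverts G}" for x
    proof -
      obtain u v where "u \<in> pverts G" "v \<in> pverts G" "x = graph_dist G u v" using x by blast
      then obtain k where "k \<le> 2" "x = ereal (real k)" using dist by blast
      then show ?thesis by simp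
    qed
    obtain k where k: "k \<le> 2" "graph_dist G p q = ereal (real k)" "(p, q) \<in> parcs G ^^ k"
      using dist [OF far(1,2)] by blast
    have "k \<noteq> 0" using k(3) far(3) by (metis relpow_0_E)
    moreover have "k \<noteq> 1" using k(3) far(4) by (metis relpow_1)
    ultimately have "k = 2" using k(1) by simp
    then have "graph_dist G p q = 2" using k(2) by simp
    then show "2 \<in> {graph_dist G u v | u v. u \<in> pverts G \<and> v \<in> pverts G}" using far by force
  qed
qed

end

definition graph_on :: "nat \<Rightarrow> (nat \<Rightarrow> nat \<Rightarrow> bool) \<Rightarrow> nat pair_pre_digraph" where
  "graph_on m R = \<lparr>pverts = {..<m}, parcs = {(u, v). u < m \<and> v < m \<and> u \<noteq> v \<and> R u v}\<rparr>"

lemma graph_on_simps [simp]: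
  "pverts (graph_on m R) = {..<m}"
  "(u, v) \<in> parcs (graph_on m R) \<longleftrightarrow> u < m \<and> v < m \<and> u \<noteq> v \<and> R u v"
  by (auto simp: graph_on_def)

lemma pair_graph_graph_on:
  assumes "\<And>u v. R u v \<Longrightarrow> R v u"
  shows "pair_graph (graph_on m R)"
proof
  show "finite (parcs (graph_on m R))"
    by (rule finite_subset [of _ "{..<m} \<times> {..<m}"]) auto
  show "symmetric (with_proj (graph_on m R))"
    using assms by (auto simp: symmetric_def intro!: symI)
qed auto

lemma complement_graph_on: "complement_graph (graph_on m (\<lambda>u v. \<not> R u v)) = graph_on m R"
  by (auto simp: complement_graph_def graph_on_def)

text \<open>
  The criterion in terms of the complement graph \<open>R\<close>. For \<open>\<Gamma>\<close> and for its
  complement, diameter two means that nonadjacent vertices have a common neighbour and that some distinct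
  vertices are not adjacent.
\<close>

lemma raag_from_noncommutation:
  assumes sym: "\<And>u v. R u v \<Longrightarrow> R v u" and D: "D > 0"
    and diam1: "\<And>u v. u < m \<Longrightarrow> v < m \<Longrightarrow> u \<noteq> v \<Longrightarrow> \<not> R u v \<Longrightarrow> \<exists>w<m. R u w \<and> R w v \<and> w \<noteq> u \<and> w \<noteq> v"
    and diam2: "\<And>u v. u < m \<Longrightarrow> v < m \<Longrightarrow> u \<noteq> v \<Longrightarrow> R u v \<Longrightarrow> \<exists>w<m. \<not> R u w \<and> \<not> R w v \<and> w \<noteq> u \<and> w \<noteq> v"
    and p: "p < m" "q < m" "p \<noteq> q" "R p q" and p': "p' < m" "q' < m" "p' \<noteq> q'" "\<not> R p' q'"
    and Gamma: "\<Gamma> = graph_on m (\<lambda>u v. \<not> R u v)"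
    and S: "\<And>S. S \<subseteq> {..<m} \<Longrightarrow> pair_graph.dominating \<Gamma> S \<Longrightarrow> \<not> pair_graph.is_join \<Gamma> S \<Longrightarrow>
      pair_graph.dominating_path \<Gamma> S D"
    and l: "l \<in> words {..<m}" "\<forall>a\<in>set l. snd a" "pair_graph.dominating_path \<Gamma> (fst ` set l) D"
    and ab: "a \<in> words {..<m}" "b \<in> words {..<m}"
      "pair_graph.cls \<Gamma> l [^]\<^bsub>raag \<Gamma>\<^esub> D = pair_graph.cls \<Gamma> a \<otimes>\<^bsub>raag \<Gamma>\<^esub> pair_graph.cls \<Gamma> b"
    and uv: "u < m" "v < m" "u \<noteq> v" "\<not> R u v"
    and av: "\<forall>z\<in>fst ` set a. z = v \<or> \<not> R v z" and bu: "\<forall>z\<in>fst ` set b. z = u \<or> \<not> R u z"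
  shows "pair_graph \<Gamma> \<and> biconnected \<Gamma> \<and> card (pverts \<Gamma>) = m \<and> diam \<Gamma> = 2 \<and>
    diam (complement_graph \<Gamma>) = 2 \<and> raag_min_translation_length \<Gamma> = 2 / real D"
proof -
  have comp: "complement_graph \<Gamma> = graph_on m R" unfolding Gamma by (rule complement_graph_on)
  interpret C: pair_graph "graph_on m R" using sym by (rule pair_graph_graph_on)
  interpret G: pair_graph \<Gamma> unfolding Gamma using sym by (intro pair_graph_graph_on) blast
  have twoC: "\<exists>w. (u, w) \<in> parcs (graph_on m R) \<and> (w, v) \<in> parcs (graph_on m R)"
    if "u \<in> pverts (graph_on m R)" "v \<in> pverts (graph_on m R)" "u \<noteq> v" "(u, v) \<notin> parcs (graph_on m R)" for u v
    using diam1 [of u v] that by auto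
  have twoG: "\<exists>w. (u, w) \<in> parcs \<Gamma> \<and> (w, v) \<in> parcs \<Gamma>"
    if "u \<in> pverts \<Gamma>" "v \<in> pverts \<Gamma>" "u \<noteq> v" "(u, v) \<notin> parcs \<Gamma>" for u v
    using diam2 [of u v] that unfolding Gamma by auto
  have farC: "p' \<in> pverts (graph_on m R)" "q' \<in> pverts (graph_on m R)" "p' \<noteq> q'" "(p', q') \<notin> parcs (graph_on m R)"
    using p' by auto
  have farG: "p \<in> pverts \<Gamma>" "q \<in> pverts \<Gamma>" "p \<noteq> q" "(p, q) \<notin> parcs \<Gamma>"
    using p unfolding Gamma by auto
  note dC = C.diameter_two [OF twoC farC] and dG = G.diameter_two [OF twoG farG]
  interpret G: connected_pair_graph \<Gamma>
    by unfold_locales (use dG(1) farG(1) in auto)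
  have V: "pverts \<Gamma> = {..<m}" unfolding Gamma by simp
  have W: "z < m" if "w \<in> words {..<m}" "z \<in> fst ` set w" for z w using that by auto
  have "raag_min_translation_length \<Gamma> = 2 / real D"
  proof (rule G.min_translation_length_eq [OF D _ _ l(2,3) _ _ ab(3)])
    show "G.dominating_path S D" if "S \<subseteq> pverts \<Gamma>" "G.dominating S" "\<not> G.is_join S" for S
      using S that unfolding V by blast
    show "l \<in> words (pverts \<Gamma>)" "a \<in> words (pverts \<Gamma>)" "b \<in> words (pverts \<Gamma>)"
      unfolding V using l ab by auto
    show "(u, v) \<in> parcs \<Gamma>" using uv unfolding Gamma by simp
    show "\<forall>z\<in>set a. (v, fst z) \<in> parcs \<Gamma> \<or> v = fst z"
      using av W [OF ab(1)] uv unfolding Gamma by auto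
    show "\<forall>z\<in>set b. (u, fst z) \<in> parcs \<Gamma> \<or> u = fst z"
      using bu W [OF ab(2)] uv unfolding Gamma by auto
  qed
  then show ?thesis
    using dC(2,3) dG(2,3) G.pair_graph V unfolding biconnected_def comp by simp
qed


section \<open>Finding dominating paths\<close>

locale noncommutation =
  fixes m :: nat and R :: "nat \<Rightarrow> nat \<Rightarrow> bool"
  assumes R_sym: "R u v \<Longrightarrow> R v u"
begin

abbreviation \<Gamma> :: "nat pair_pre_digraph" where
  "\<Gamma> \<equiv> graph_on m (\<lambda>u v. \<not> R u v)"

sublocale G: pair_graph \<Gamma>
  by (rule pair_graph_graph_on) (blast intro: R_sym)

lemma dominatingD:
  assumes "G.dominating S" "S \<subseteq> {..<m}" "v < m"
  shows "\<exists>s\<in>S. s \<noteq> v \<and> R v s"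
proof -
  have "\<exists>s\<in>S. s \<noteq> v \<and> (v, s) \<notin> parcs \<Gamma>"
    using assms(1,3) unfolding G.dominating_def by simp
  then obtain s where s: "s \<in> S" "s \<noteq> v" "(v, s) \<notin> parcs \<Gamma>" by blast
  then have "R v s" using assms(2,3) by auto
  then show ?thesis using s by blast
qed

lemma dominating_pathI:
  assumes "\<And>i. i \<le> r \<Longrightarrow> t i \<in> S" "\<And>i. i < r \<Longrightarrow> R (t i) (t (Suc i))"
    and dom: "\<And>v. v < m \<Longrightarrow> \<exists>i\<le>r. t i \<noteq> v \<and> R v (t i)" and r: "r \<le> D"
  shows "G.dominating_path S D"
proof -
  from dom have "\<forall>v\<in>{..<m}. \<exists>i. i \<le> r \<and> t i \<noteq> v \<and> R v (t i)" by blast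
  from bchoice [OF this] obtain f where f: "\<And>v. v < m \<Longrightarrow> f v \<le> r \<and> t (f v) \<noteq> v \<and> R v (t (f v))"
    by auto
  have "\<bar>real (f v) - real (f v')\<bar> + \<bar>real (f v) - real (f v')\<bar> \<le> 2 * real D" if "v < m" "v' < m" for v v'
    using f [OF that(1)] f [OF that(2)] r by (auto simp: abs_if)
  then show ?thesis unfolding G.dominating_path_def
    using assms(1,2) f by (intro exI [of _ r] exI [of _ t] exI [of _ f]) auto
qed

lemma dominating_cherryI:
  assumes "x \<in> S" "c \<in> S" "y \<in> S" "R x c" "R c y" "D \<ge> 2"
    and "\<And>v. v < m \<Longrightarrow> x \<noteq> v \<and> R v x \<or> c \<noteq> v \<and> R v c \<or> y \<noteq> v \<and> R v y"
  shows "G.dominating_path S D"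
proof (rule dominating_pathI [where r = 2 and t = "\<lambda>i. if i = 0 then x else if i = 1 then c else y"])
  fix v assume "v < m"
  then consider "x \<noteq> v \<and> R v x" | "c \<noteq> v \<and> R v c" | "y \<noteq> v \<and> R v y" using assms(7) by blast
  then show "\<exists>i\<le>2::nat. (if i = 0 then x else if i = 1 then c else y) \<noteq> v \<and>
      R v (if i = 0 then x else if i = 1 then c else y)"
  proof cases
    case 1
    then show ?thesis by (intro exI [of _ 0]) simp
  next
    case 2
    then show ?thesis by (intro exI [of _ 1]) simp
  next
    case 3
    then show ?thesis by (intro exI [of _ 2]) simp
  qed
qed (use assms in \<open>auto simp: less_2_cases_iff\<close>)

text \<open>
  The position is averaged over the first and the last neighbour of a vertex on the path \<open>x, c,
  y\<close>. By the assumption \<open>edge\<close>, commuting vertices are then on average at most one edge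
  apart, although the path has two.
\<close>

lemma averaged_cherryI:
  assumes S: "x \<in> S" "c \<in> S" "y \<in> S" "R x c" "R c y"
    and dom: "\<And>v. v < m \<Longrightarrow> R v x \<or> R v c \<or> R v y"
    and irrefl: "\<And>v. \<not> R v v"
  defines "f v \<equiv> if R v x then 0 else if R v c then 1 else (2::nat)"
    and "g v \<equiv> if R v y then 2 else if R v c then 1 else (0::nat)"
  assumes edge: "\<And>v v'. v < m \<Longrightarrow> v' < m \<Longrightarrow> v \<noteq> v' \<Longrightarrow> \<not> R v v' \<Longrightarrow>
      (f v - f v') + (f v' - f v) + (g v - g v') + (g v' - g v) \<le> 2"
  shows "G.dominating_path S 1"
proof -
  define t :: "nat \<Rightarrow> nat" where "t i = (if i = 0 then x else if i = 1 then c else y)" for i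
  have real_edge: "\<bar>real (f v) - real (f v')\<bar> + \<bar>real (g v) - real (g v')\<bar> \<le> 2 * real 1"
    if "(v, v') \<in> parcs \<Gamma>" for v v'
  proof -
    have "\<bar>real i - real j\<bar> = real ((i - j) + (j - i))" for i j :: nat by (auto simp: of_nat_diff)
    then show ?thesis using edge [of v v'] that
      by (simp only: of_nat_add [symmetric] of_nat_le_iff) (simp flip: of_nat_add)
  qed
  have "f v \<le> 2" "g v \<le> 2" for v by (auto simp: f_def g_def)
  moreover have "R v (t (f v)) \<and> R v (t (g v))" if "v < m" for v
    using dom [OF that] by (auto simp: f_def g_def t_def)
  moreover from this have "t (f v) \<noteq> v \<and> t (g v) \<noteq> v" if "v < m" for v
    using that irrefl by metis
  moreover have "\<forall>i<2. R (t i) (t (Suc i))" "\<forall>i\<le>2. t i \<in> S"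
    using S by (auto simp: t_def less_2_cases_iff)
  ultimately show ?thesis unfolding G.dominating_path_def
    using real_edge by (intro exI [of _ 2] exI [of _ t] exI [of _ f] exI [of _ g]) auto
qed

end

section \<open>A pentagon with a doubled vertex\<close>

text \<open>
  The pentagon \<open>0, 1, 2, 3, 4\<close> and a twin \<open>5\<close> of the vertex \<open>4\<close>, that
  is, a vertex with the same neighbours.
\<close>

definition twin_pentagon :: "nat \<Rightarrow> nat \<Rightarrow> bool" where
  "twin_pentagon u v \<longleftrightarrow> (u, v) \<in> set [(0,1),(1,0),(1,2),(2,1),(2,3),(3,2),(0,4),(4,0),(3,4),(4,3),(0,5),(5,0),(3,5),(5,3)]"

interpretation twin: noncommutation 6 twin_pentagon
  by unfold_locales (auto simp: twin_pentagon_def)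

lemma less_6: "(v::nat) < 6 \<longleftrightarrow> v \<in> set [0, 1, 2, 3, 4, 5]"
  by auto

lemma twin_pentagon_nbrs:
  "twin_pentagon 0 v \<longleftrightarrow> v = 1 \<or> v = 4 \<or> v = 5"
  "twin_pentagon 1 v \<longleftrightarrow> v = 0 \<or> v = 2"
  "twin_pentagon 2 v \<longleftrightarrow> v = 1 \<or> v = 3"
  "twin_pentagon 3 v \<longleftrightarrow> v = 2 \<or> v = 4 \<or> v = 5"
  "twin_pentagon 4 v \<longleftrightarrow> v = 0 \<or> v = 3"
  by (auto simp: twin_pentagon_def)

text \<open>
  Paths with two edges, at least one of them in each dominating set: the five paths of the pentagon
  \<open>0, 1, 2, 3, 4\<close>, and those obtained from them by replacing \<open>4\<close> by its twin.
\<close>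

definition pentagon_cherries :: "(nat \<times> nat \<times> nat) list" where
  "pentagon_cherries = [(0,1,2), (4,0,1), (5,0,1), (0,4,3), (0,5,3), (3,2,1), (4,3,2), (5,3,2)]"

lemma pentagon_cherries_dominating:
  "\<forall>(x, c, y)\<in>set pentagon_cherries. twin_pentagon x c \<and> twin_pentagon c y \<and>
     (\<forall>v\<in>set [0, 1, 2, 3, 4, 5]. twin_pentagon v x \<or> twin_pentagon v c \<or> twin_pentagon v y)"
  by code_simp

lemma pentagon_cherries_lipschitz:
  "\<forall>(x, c, y)\<in>set pentagon_cherries. \<forall>v\<in>set [0, 1, 2, 3, 4, 5]. \<forall>v'\<in>set [0, 1, 2, 3, 4, 5].
    v \<noteq> v' \<longrightarrow> \<not> twin_pentagon v v' \<longrightarrow>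
    ((if twin_pentagon v x then 0 else if twin_pentagon v c then 1 else 2) - (if twin_pentagon v' x then 0 else if twin_pentagon v' c then 1 else 2)) +
    ((if twin_pentagon v' x then 0 else if twin_pentagon v' c then 1 else 2) - (if twin_pentagon v x then 0 else if twin_pentagon v c then 1 else 2)) +
    ((if twin_pentagon v y then 2 else if twin_pentagon v c then 1 else 0) - (if twin_pentagon v' y then 2 else if twin_pentagon v' c then 1 else 0)) +
    ((if twin_pentagon v' y then 2 else if twin_pentagon v' c then 1 else 0) - (if twin_pentagon v y then 2 else if twin_pentagon v c then 1 else 0)) \<le> (2::nat)"
  by code_simp

lemma twin_pentagon_diameters:
  "\<forall>u\<in>set [0, 1, 2, 3, 4, 5]. \<forall>v\<in>set [0, 1, 2, 3, 4, 5]. u \<noteq> v \<longrightarrow>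
     (twin_pentagon u v \<or> (\<exists>w\<in>set [0, 1, 2, 3, 4, 5]. twin_pentagon u w \<and> twin_pentagon w v \<and> w \<noteq> u \<and> w \<noteq> v)) \<and>
     (\<not> twin_pentagon u v \<or> (\<exists>w\<in>set [0, 1, 2, 3, 4, 5]. \<not> twin_pentagon u w \<and> \<not> twin_pentagon w v \<and> w \<noteq> u \<and> w \<noteq> v))"
  by code_simp

lemma twin_pentagon_cherry:
  assumes S: "x \<in> S" "c \<in> S" "y \<in> S" and xcy: "(x, c, y) \<in> set pentagon_cherries"
  shows "twin.G.dominating_path S 1"
proof (rule twin.averaged_cherryI [OF S])
  show "twin_pentagon x c" "twin_pentagon c y" using pentagon_cherries_dominating xcy by auto
  show "twin_pentagon v x \<or> twin_pentagon v c \<or> twin_pentagon v y" if "v < 6" for v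
    using pentagon_cherries_dominating xcy that unfolding less_6 by blast
  show "\<not> twin_pentagon v v" for v by (auto simp: twin_pentagon_def)
qed (use pentagon_cherries_lipschitz xcy in \<open>unfold less_6, blast\<close>)

lemma twin_pentagon_dominating_path:
  assumes S: "S \<subseteq> {..<6}" and dom: "twin.G.dominating S"
  shows "twin.G.dominating_path S 1"
proof -
  note D = twin.dominatingD [OF dom S]
  have d0: "1 \<in> S \<or> 4 \<in> S \<or> 5 \<in> S" using D [of 0] unfolding twin_pentagon_nbrs by auto
  have d1: "0 \<in> S \<or> 2 \<in> S" using D [of 1] unfolding twin_pentagon_nbrs by auto
  have d2: "1 \<in> S \<or> 3 \<in> S" using D [of 2] unfolding twin_pentagon_nbrs by auto
  have d3: "2 \<in> S \<or> 4 \<in> S \<or> 5 \<in> S" using D [of 3] unfolding twin_pentagon_nbrs by auto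
  have d4: "0 \<in> S \<or> 3 \<in> S" using D [of 4] unfolding twin_pentagon_nbrs by auto
  have "\<exists>(x, c, y)\<in>set pentagon_cherries. x \<in> S \<and> c \<in> S \<and> y \<in> S"
    unfolding pentagon_cherries_def using d0 d1 d2 d3 d4 by auto
  then show ?thesis using twin_pentagon_cherry by blast
qed

section \<open>A path with two cone points\<close>

text \<open>
  A path \<open>0, \<dots>, M\<close>, a vertex \<open>M + 1\<close> joined to the path except for
  \<open>2\<close>, and a vertex \<open>M + 2\<close> joined to the path except for \<open>1\<close> and
  \<open>3\<close>. The added vertices make the diameter small. They miss vertices of the path so that the
  complement has diameter two as well: \<open>M + 1\<close> reaches \<open>1\<close> and \<open>3\<close>
  through \<open>M + 2\<close>, and the remaining path vertices through \<open>2\<close>.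
\<close>

definition cone_adj :: "nat \<Rightarrow> nat \<Rightarrow> nat \<Rightarrow> bool" where
  "cone_adj M u v \<longleftrightarrow> (let E = \<lambda>u v. u \<le> M \<and>
     (v \<le> M \<and> v = Suc u \<or> v = M + 1 \<and> u \<noteq> 2 \<or> v = M + 2 \<and> u \<noteq> 1 \<and> u \<noteq> 3) in E u v \<or> E v u)"

locale coned_path =
  fixes M :: nat
  assumes M: "M \<ge> 4"
begin

abbreviation R :: "nat \<Rightarrow> nat \<Rightarrow> bool" where
  "R \<equiv> cone_adj M"

sublocale noncommutation "M + 3" R
  by unfold_locales (auto simp: cone_adj_def Let_def)

lemma R_path: "u \<le> M \<Longrightarrow> v \<le> M \<Longrightarrow> R u v \<longleftrightarrow> v = Suc u \<or> u = Suc v"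
  by (auto simp: cone_adj_def Let_def)

lemma R_a: "R (Suc M) v \<longleftrightarrow> v \<le> M \<and> v \<noteq> 2" "R v (Suc M) \<longleftrightarrow> v \<le> M \<and> v \<noteq> 2"
  by (auto simp: cone_adj_def Let_def)

lemma R_b: "R (Suc (Suc M)) v \<longleftrightarrow> v \<le> M \<and> v \<noteq> 1 \<and> v \<noteq> 3" "R v (Suc (Suc M)) \<longleftrightarrow> v \<le> M \<and> v \<noteq> 1 \<and> v \<noteq> 3"
  by (auto simp: cone_adj_def Let_def)

lemma vertex_cases:
  assumes "v < M + 3"
  obtains "v \<le> M" | "v = Suc M" | "v = Suc (Suc M)"
  using assms by linarith

lemma whole_path_dominates:
  assumes "{1..<M} \<subseteq> S"
  shows "G.dominating_path S (M - 2)"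
proof (rule dominating_pathI [where r = "M - 2" and t = Suc])
  show "Suc i \<in> S" if "i \<le> M - 2" for i using that M assms by auto
  show "R (Suc i) (Suc (Suc i))" if "i < M - 2" for i using that M by (subst R_path) auto
  show "\<exists>i\<le>M - 2. Suc i \<noteq> v \<and> R v (Suc i)" if "v < M + 3" for v
    using that
  proof (cases v rule: vertex_cases)
    case 1
    show ?thesis
    proof (cases "v \<le> M - 2")
      case True
      then show ?thesis using M by (intro exI [of _ v]) (auto simp: R_path)
    next
      case False
      then show ?thesis using M 1 by (intro exI [of _ "v - 2"]) (auto simp: R_path)
    qed
  next
    case 2
    then show ?thesis using M by (intro exI [of _ 0]) (auto simp: R_a)
  next
    case 3
    then show ?thesis using M by (intro exI [of _ 1]) (auto simp: R_b)
  qed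
qed simp

lemma cherry:
  assumes "x \<in> S" "c \<in> S" "y \<in> S" "R x c" "R c y"
    and "\<And>v. v \<le> M \<Longrightarrow> x \<noteq> v \<and> R v x \<or> c \<noteq> v \<and> R v c \<or> y \<noteq> v \<and> R v y"
    and "R (Suc M) x \<or> R (Suc M) c \<or> R (Suc M) y" "R (Suc (Suc M)) x \<or> R (Suc (Suc M)) c \<or> R (Suc (Suc M)) y"
  shows "G.dominating_path S (M - 2)"
proof (rule dominating_cherryI [OF assms(1-5)])
  show "2 \<le> M - 2" using M by simp
  show "x \<noteq> v \<and> R v x \<or> c \<noteq> v \<and> R v c \<or> y \<noteq> v \<and> R v y" if "v < M + 3" for v
    using that
  proof (cases v rule: vertex_cases)
    case 1
    then show ?thesis by (rule assms(6))
  next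
    case 2
    then show ?thesis using assms(7) unfolding 2 R_a by auto
  next
    case 3
    then show ?thesis using assms(8) unfolding 3 R_b by auto
  qed
qed

text \<open>
  With a cone point in \<open>S\<close>, two more vertices suffice to dominate: the cone point has only
  three or four non-neighbours, and domination by \<open>S\<close> provides neighbours for these. Without
  cone points, \<open>S\<close> contains \<open>1\<close> and \<open>M - 1\<close>, the only neighbours of
  \<open>0\<close> and \<open>M\<close> that remain, and a gap in between would split \<open>S\<close> into
  two commuting parts.
\<close>

lemma dominating_path_exists:
  assumes S: "S \<subseteq> {..<M + 3}" and dom: "G.dominating S" and nj: "\<not> G.is_join S"
  shows "G.dominating_path S (M - 2)"
proof -
  note D = dominatingD [OF dom S]
  have V: "s \<le> M \<or> s = Suc M \<or> s = Suc (Suc M)" if "s \<in> S" for s using S that by fastforce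
  obtain z where z: "z \<in> S" "z \<le> M" "z \<noteq> 2" using D [of "Suc M"] by (auto simp: R_a)
  obtain z' where z': "z' \<in> S" "z' \<le> M" "z' \<noteq> 1" "z' \<noteq> 3" using D [of "Suc (Suc M)"] by (auto simp: R_b)
  consider (a) "Suc M \<in> S" | (b) "Suc M \<notin> S" "Suc (Suc M) \<in> S" | (none) "Suc M \<notin> S" "Suc (Suc M) \<notin> S" by blast
  then show ?thesis
  proof cases
    case a
    show ?thesis
    proof (cases "1 \<in> S \<or> 3 \<in> S")
      case True
      then obtain y where y: "y \<in> S" "y = 1 \<or> y = 3" by blast
      show ?thesis
      proof (cases "z' = 2")
        case True
        show ?thesis
          by (rule cherry [OF a y(1) z'(1)]) (use y M True in \<open>auto simp: R_a R_b R_path\<close>)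
      next
        case False
        show ?thesis
          by (rule cherry [OF y(1) a z'(1)]) (use y M z' False in \<open>auto simp: R_a R_b R_path\<close>)
      qed
    next
      case False
      have "Suc (Suc M) \<in> S"
      proof -
        obtain s where s: "s \<in> S" "R 2 s" using D [of 2] M by auto
        from V [OF s(1)] show ?thesis
        proof (elim disjE)
          assume "s \<le> M"
          then have "s = 3 \<or> s = 1" using s(2) M by (auto simp: R_path)
          then show ?thesis using s(1) False by auto
        next
          assume "s = Suc M"
          then show ?thesis using s(2) by (simp add: R_a)
        next
          assume "s = Suc (Suc M)"
          then show ?thesis using s(1) by simp
        qed
      qed
      then show ?thesis
        by (intro cherry [OF a z(1)]) (use z M False in \<open>auto simp: R_a R_b R_path\<close>)
    qed
  next
    case b
    show ?thesis
    proof (cases "2 \<in> S")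
      case True
      show ?thesis
      proof (cases "z = 1 \<or> z = 3")
        case True
        show ?thesis
          by (rule cherry [OF b(2) \<open>2 \<in> S\<close> z(1)]) (use z M True in \<open>auto simp: R_a R_b R_path\<close>)
      next
        case False
        show ?thesis
          by (rule cherry [OF z(1) b(2) \<open>2 \<in> S\<close>]) (use z M False in \<open>auto simp: R_a R_b R_path\<close>)
      qed
    next
      case False
      have "0 \<in> S"
      proof -
        obtain s where s: "s \<in> S" "R 1 s" using D [of 1] by auto
        have "s \<le> M" using V [OF s(1)] s b M by (auto simp: R_b)
        then have "s = 2 \<or> s = 0" using s(2) M by (auto simp: R_path)
        then show ?thesis using s(1) False by auto
      qed
      moreover have "4 \<in> S"
      proof -
        obtain s where s: "s \<in> S" "R 3 s" using D [of 3] M by auto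
        have "s \<le> M" using V [OF s(1)] s b M by (auto simp: R_b)
        then have "s = 4 \<or> s = 2" using s(2) M by (auto simp: R_path)
        then show ?thesis using s(1) False by auto
      qed
      ultimately show ?thesis
        by (rule cherry [OF _ b(2)]) (use M in \<open>auto simp: R_a R_b R_path\<close>)
    qed
  next
    case none
    then have SM: "s \<le> M" if "s \<in> S" for s using V [OF that] that by auto
    have one: "1 \<in> S"
    proof -
      obtain s where s: "s \<in> S" "R 0 s" using D [of 0] by auto
      then show ?thesis using SM [OF s(1)] by (auto simp: R_path)
    qed
    have last: "M - 1 \<in> S"
    proof -
      obtain s where s: "s \<in> S" "s \<noteq> M" "R M s" using D [of M] by auto
      then show ?thesis using SM [OF s(1)] by (auto simp: R_path)
    qed
    have "{1..<M} \<subseteq> S"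
    proof
      fix k assume k: "k \<in> {1..<M}"
      show "k \<in> S"
      proof (rule ccontr)
        assume nk: "k \<notin> S"
        have "G.is_join S" unfolding G.is_join_def
        proof (intro exI conjI ballI)
          have "k \<noteq> 1" "k \<noteq> M - 1" using one last nk by auto
          then have "1 < k" "k < M - 1" using k by auto
          then show "{x \<in> S. x < k} \<noteq> {}" "{x \<in> S. x > k} \<noteq> {}" using one last by blast+
          have "x < k \<or> k < x" if "x \<in> S" for x using that nk by (metis nat_neq_iff)
          then show "S = {x \<in> S. x < k} \<union> {x \<in> S. x > k}" by blast
          show "(u, v) \<in> parcs \<Gamma>" if "u \<in> {x \<in> S. x < k}" "v \<in> {x \<in> S. x > k}" for u v
            using that SM [of u] SM [of v] by (auto simp: R_path)
        qed
        then show False using nj by simp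
      qed
    qed
    then show ?thesis by (rule whole_path_dominates)
  qed
qed

abbreviation letters :: "nat \<Rightarrow> nat \<Rightarrow> nat word" where
  "letters i j \<equiv> map (\<lambda>v. (v, True)) [i..<j]"

lemma letters_words: "j \<le> M \<Longrightarrow> letters i j \<in> words {..<M + 3}"
  by auto

text \<open>
  Let \<open>g = 1 2 \<cdots> (M - 1)\<close> and \<open>g\<^sup>j = a b\<close>, where \<open>b\<close>
  only has letters \<open>\<ge> M - j\<close>. In \<open>a b g\<close>, the initial part \<open>1 \<cdots>
  (M - j - 2)\<close> of \<open>g\<close> commutes with \<open>b\<close> and is moved to \<open>a\<close>;
  the rest of \<open>g\<close> is added to \<open>b\<close>, which gains one new letter. For \<open>j = M -
  2\<close> the letter \<open>1\<close> still does not occur in \<open>b\<close>.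
\<close>

lemma path_power:
  assumes "j \<le> M - 2"
  shows "\<exists>a b. a \<in> words {..<M + 3} \<and> b \<in> words {..<M + 3} \<and>
    G.cls (letters 1 M) [^]\<^bsub>raag \<Gamma>\<^esub> j = G.cls a \<otimes>\<^bsub>raag \<Gamma>\<^esub> G.cls b \<and>
    fst ` set a \<subseteq> {1..M - 2} \<and> fst ` set b \<subseteq> {M - j..<M}"
  using assms
proof (induction j)
  case 0
  show ?case by (intro exI [of _ "[]"]) (simp add: G.cls_Nil)
next
  case (Suc j)
  then obtain a b where ab: "a \<in> words {..<M + 3}" "b \<in> words {..<M + 3}"
    and e: "G.cls (letters 1 M) [^]\<^bsub>raag \<Gamma>\<^esub> j = G.cls a \<otimes>\<^bsub>raag \<Gamma>\<^esub> G.cls b"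
    and s: "fst ` set a \<subseteq> {1..M - 2}" "fst ` set b \<subseteq> {M - j..<M}" by auto
  let ?p = "letters 1 (M - Suc j)" and ?s = "letters (M - Suc j) M"
  have V: "words (pverts \<Gamma>) = words {..<M + 3}" by simp
  have ps: "?p \<in> words {..<M + 3}" "?s \<in> words {..<M + 3}" by (rule letters_words, simp)+
  have "letters 1 M = ?p @ ?s"
    using upt_add_eq_append [of 1 "M - Suc j" "Suc j"] Suc.prems M by simp
  then have l: "G.cls (letters 1 M) = G.cls ?p \<otimes>\<^bsub>raag \<Gamma>\<^esub> G.cls ?s"
    using G.cls_append [of ?p ?s] ps unfolding V by simp
  have comm: "G.cls b \<otimes>\<^bsub>raag \<Gamma>\<^esub> G.cls ?p = G.cls ?p \<otimes>\<^bsub>raag \<Gamma>\<^esub> G.cls b"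
  proof (rule G.cls_commute)
    show "b \<in> words (pverts \<Gamma>)" "?p \<in> words (pverts \<Gamma>)" unfolding V using ab ps by auto
    show "\<forall>x\<in>set b. \<forall>y\<in>set ?p. (fst x, fst y) \<in> parcs \<Gamma> \<or> fst x = fst y"
    proof (intro ballI)
      fix x y assume "x \<in> set b" "y \<in> set ?p"
      then have "M - j \<le> fst x" "fst x < M" "fst y < M - Suc j" using s(2) by fastforce+
      then show "(fst x, fst y) \<in> parcs \<Gamma> \<or> fst x = fst y" by (auto simp: R_path)
    qed
  qed
  have cl: "G.cls w \<in> carrier (raag \<Gamma>)" if "w \<in> words {..<M + 3}" for w
    using G.cls_closed [of w] that by simp
  have c: "G.cls a \<in> carrier (raag \<Gamma>)" "G.cls b \<in> carrier (raag \<Gamma>)" "G.cls ?p \<in> carrier (raag \<Gamma>)"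
    "G.cls ?s \<in> carrier (raag \<Gamma>)" using cl ab ps by blast+
  have "G.cls (letters 1 M) [^]\<^bsub>raag \<Gamma>\<^esub> Suc j =
      (G.cls a \<otimes>\<^bsub>raag \<Gamma>\<^esub> G.cls b) \<otimes>\<^bsub>raag \<Gamma>\<^esub> G.cls (letters 1 M)"
    by (simp only: G.A.nat_pow_Suc e)
  also have "\<dots> = (G.cls a \<otimes>\<^bsub>raag \<Gamma>\<^esub> G.cls b) \<otimes>\<^bsub>raag \<Gamma>\<^esub> (G.cls ?p \<otimes>\<^bsub>raag \<Gamma>\<^esub> G.cls ?s)"
    by (simp only: l)
  also have "\<dots> = G.cls a \<otimes>\<^bsub>raag \<Gamma>\<^esub> (G.cls b \<otimes>\<^bsub>raag \<Gamma>\<^esub> G.cls ?p) \<otimes>\<^bsub>raag \<Gamma>\<^esub> G.cls ?s"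
    using c by (simp only: G.A.m_assoc G.A.m_closed)
  also have "\<dots> = (G.cls a \<otimes>\<^bsub>raag \<Gamma>\<^esub> G.cls ?p) \<otimes>\<^bsub>raag \<Gamma>\<^esub> (G.cls b \<otimes>\<^bsub>raag \<Gamma>\<^esub> G.cls ?s)"
    unfolding comm using c by (simp only: G.A.m_assoc G.A.m_closed)
  also have "\<dots> = G.cls (a @ ?p) \<otimes>\<^bsub>raag \<Gamma>\<^esub> G.cls (b @ ?s)"
    using ab ps G.cls_append unfolding V by simp
  finally have "G.cls (letters 1 M) [^]\<^bsub>raag \<Gamma>\<^esub> Suc j = G.cls (a @ ?p) \<otimes>\<^bsub>raag \<Gamma>\<^esub> G.cls (b @ ?s)" .
  moreover have "fst ` set (a @ ?p) \<subseteq> {1..M - 2}" "fst ` set (b @ ?s) \<subseteq> {M - Suc j..<M}"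
    using s Suc.prems by fastforce+
  moreover have "a @ ?p \<in> words {..<M + 3}" "b @ ?s \<in> words {..<M + 3}" using ab ps by simp_all
  ultimately show ?case by blast
qed

lemma common_noncommuting:
  assumes "u < M + 3" "v < M + 3" "u \<noteq> v" "\<not> R u v"
  shows "\<exists>w<M + 3. R u w \<and> R w v \<and> w \<noteq> u \<and> w \<noteq> v"
proof -
  have wlog: "\<exists>w<M + 3. R u w \<and> R w v \<and> w \<noteq> u \<and> w \<noteq> v"
    if uv: "u < v" "v < M + 3" "\<not> R u v" for u v
  proof -
    have "u \<le> M \<or> u = Suc M" "v \<le> M \<or> v = Suc M \<or> v = Suc (Suc M)" using uv(1,2) by auto
    then have "u \<le> M \<and> v \<le> M \<and> u \<noteq> 2 \<and> v \<noteq> 2 \<or> u \<le> M \<and> v \<le> M \<and> (u = 2 \<or> v = 2) \<or>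
        u = 2 \<and> v = Suc M \<or> (u = 1 \<or> u = 3) \<and> v = Suc (Suc M) \<or> u = Suc M \<and> v = Suc (Suc M)"
    proof (elim disjE)
      assume "u \<le> M" "v \<le> M"
      then show ?thesis by blast
    next
      assume "u \<le> M" "v = Suc M"
      then show ?thesis using uv(3) by (simp add: R_a)
    next
      assume "u \<le> M" "v = Suc (Suc M)"
      then show ?thesis using uv(3) by (simp add: R_b)
    qed (use uv(1) in simp_all)
    then consider "u \<le> M" "v \<le> M" "u \<noteq> 2" "v \<noteq> 2" | "u \<le> M" "v \<le> M" "u = 2 \<or> v = 2"
      | "u = 2" "v = Suc M" | "u = 1 \<or> u = 3" "v = Suc (Suc M)" | "u = Suc M" "v = Suc (Suc M)"
      by blast
    then show ?thesis
    proof cases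
      case 1
      then show ?thesis by (intro exI [of _ "Suc M"]) (auto simp: R_a)
    next
      case 2
      then show ?thesis using uv M
        by (intro exI [of _ "Suc (Suc M)"]) (auto simp: R_b R_path)
    next
      case 3
      then show ?thesis using M by (intro exI [of _ 1]) (auto simp: R_a R_path)
    next
      case 4
      then show ?thesis using M by (intro exI [of _ 2]) (auto simp: R_b R_path)
    next
      case 5
      then show ?thesis by (intro exI [of _ 0]) (auto simp: R_a R_b)
    qed
  qed
  show ?thesis
  proof (cases "u < v")
    case True
    then show ?thesis by (rule wlog [OF _ assms(2,4)])
  next
    case False
    then have "v < u" using assms(3) by simp
    moreover have "\<not> R v u" using assms(4) by (rule contrapos_nn) (erule R_sym)
    ultimately have "\<exists>w<M + 3. R v w \<and> R w u \<and> w \<noteq> v \<and> w \<noteq> u" using assms(1) by (intro wlog)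
    then obtain w where w: "w < M + 3" "R v w" "R w u" "w \<noteq> v" "w \<noteq> u" by (elim exE conjE)
    show ?thesis using w(1,4,5) R_sym [OF w(2)] R_sym [OF w(3)] by (intro exI [of _ w] conjI)
  qed
qed

lemma common_commuting:
  assumes "u < M + 3" "v < M + 3" "u \<noteq> v" "R u v"
  shows "\<exists>w<M + 3. \<not> R u w \<and> \<not> R w v \<and> w \<noteq> u \<and> w \<noteq> v"
proof -
  have wlog: "\<exists>w<M + 3. \<not> R u w \<and> \<not> R w v \<and> w \<noteq> u \<and> w \<noteq> v"
    if uv: "u < v" "v < M + 3" "R u v" for u v
  proof -
    have "u \<le> M \<or> u = Suc M" "v \<le> M \<or> v = Suc M \<or> v = Suc (Suc M)" using uv(1,2) by auto
    then have "v = Suc u \<and> v \<le> M \<or> u \<le> M \<and> u \<noteq> 2 \<and> v = Suc M \<or>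
        u \<le> M \<and> u \<noteq> 1 \<and> u \<noteq> 3 \<and> v = Suc (Suc M)"
      using uv(1,3) M by (auto simp: R_a R_b R_path)
    then consider "v = Suc u" "v \<le> M" | "u \<le> M" "u \<noteq> 2" "v = Suc M"
      | "u \<le> M" "u \<noteq> 1" "u \<noteq> 3" "v = Suc (Suc M)"
      by blast
    then show ?thesis
    proof cases
      case 1
      show ?thesis
      proof (cases "u \<ge> 2")
        case True
        then show ?thesis using 1 by (intro exI [of _ 0]) (auto simp: R_path)
      next
        case False
        then show ?thesis using 1 M by (intro exI [of _ M]) (auto simp: R_path)
      qed
    next
      case 2
      show ?thesis
      proof (cases "u = 1 \<or> u = 3")
        case True
        then show ?thesis using 2 M by (intro exI [of _ "Suc (Suc M)"]) (auto simp: R_b)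
      next
        case False
        then show ?thesis using 2 M by (intro exI [of _ 2]) (auto simp: R_a R_path)
      qed
    next
      case 3
      consider "u = 0" | "u = 2" | "u \<ge> 4" using 3 by linarith
      then show ?thesis
      proof cases
        case 1
        then show ?thesis using 3 M by (intro exI [of _ 3]) (auto simp: R_b R_path)
      next
        case 2
        then show ?thesis using 3 M by (intro exI [of _ "Suc M"]) (auto simp: R_a R_b)
      next
        case 3
        then show ?thesis using \<open>v = Suc (Suc M)\<close> \<open>u \<le> M\<close> M by (intro exI [of _ 1]) (auto simp: R_b R_path)
      qed
    qed
  qed
  show ?thesis
  proof (cases "u < v")
    case True
    then show ?thesis by (rule wlog [OF _ assms(2,4)])
  next
    case False
    then have "v < u" using assms(3) by simp
    then have "\<exists>w<M + 3. \<not> R v w \<and> \<not> R w u \<and> w \<noteq> v \<and> w \<noteq> u"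
      using assms(1) R_sym [OF assms(4)] by (intro wlog)
    then obtain w where w: "w < M + 3" "\<not> R v w" "\<not> R w u" "w \<noteq> v" "w \<noteq> u" by (elim exE conjE)
    have "\<not> R u w" using w(3) by (rule contrapos_nn) (erule R_sym)
    moreover have "\<not> R w v" using w(2) by (rule contrapos_nn) (erule R_sym)
    ultimately show ?thesis using w(1,4,5) by (intro exI [of _ w] conjI)
  qed
qed

lemma coned_path_raag:
  "pair_graph \<Gamma> \<and> biconnected \<Gamma> \<and> card (pverts \<Gamma>) = M + 3 \<and> diam \<Gamma> = 2 \<and>
    diam (complement_graph \<Gamma>) = 2 \<and> raag_min_translation_length \<Gamma> = 2 / real (M - 2)"
proof -
  obtain a b where ab: "a \<in> words {..<M + 3}" "b \<in> words {..<M + 3}"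
    "G.cls (letters 1 M) [^]\<^bsub>raag \<Gamma>\<^esub> (M - 2) = G.cls a \<otimes>\<^bsub>raag \<Gamma>\<^esub> G.cls b"
    and s: "fst ` set a \<subseteq> {1..M - 2}" "fst ` set b \<subseteq> {M - (M - 2)..<M}"
    using path_power [OF order_refl] by (elim exE conjE)
  show ?thesis
  proof (rule raag_from_noncommutation
      [of R "M - 2" "M + 3" 0 1 0 2 \<Gamma> "letters 1 M" a b 0 M])
    show "R v u" if "R u v" for u v using that by (rule R_sym)
    show "\<exists>w<M + 3. R u w \<and> R w v \<and> w \<noteq> u \<and> w \<noteq> v"
      if "u < M + 3" "v < M + 3" "u \<noteq> v" "\<not> R u v" for u v
      using that by (rule common_noncommuting)
    show "\<exists>w<M + 3. \<not> R u w \<and> \<not> R w v \<and> w \<noteq> u \<and> w \<noteq> v"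
      if "u < M + 3" "v < M + 3" "u \<noteq> v" "R u v" for u v
      using that by (rule common_commuting)
    show "G.dominating_path S (M - 2)" if "S \<subseteq> {..<M + 3}" "G.dominating S" "\<not> G.is_join S" for S
      using that by (rule dominating_path_exists)
    show "\<Gamma> = \<Gamma>" ..
    show "a \<in> words {..<M + 3}" "b \<in> words {..<M + 3}"
      "G.cls (letters 1 M) [^]\<^bsub>raag \<Gamma>\<^esub> (M - 2) = G.cls a \<otimes>\<^bsub>raag \<Gamma>\<^esub> G.cls b" by (rule ab)+
    show "M - 2 > 0" "0 < M + 3" "1 < M + 3" "2 < M + 3" "M < M + 3" "(0::nat) \<noteq> 1" "(0::nat) \<noteq> 2"
      "0 \<noteq> M" using M by simp_all
    show "R 0 1" "\<not> R 0 2" "\<not> R 0 M" using M by (simp_all add: R_path)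
    show "letters 1 M \<in> words {..<M + 3}" by (rule letters_words) simp
    show "\<forall>a\<in>set (letters 1 M). snd a" by auto
    show "G.dominating_path (fst ` set (letters 1 M)) (M - 2)" by (rule whole_path_dominates) force
    show "\<forall>z\<in>fst ` set a. z = M \<or> \<not> R M z"
    proof
      fix z assume "z \<in> fst ` set a"
      then have "z \<le> M - 2" using s(1) by auto
      then show "z = M \<or> \<not> R M z" using M by (auto simp: R_path)
    qed
    show "\<forall>z\<in>fst ` set b. z = 0 \<or> \<not> R 0 z"
    proof
      fix z assume "z \<in> fst ` set b"
      then have "2 \<le> z" "z \<le> M" using s(2) M by auto
      then show "z = 0 \<or> \<not> R 0 z" using M by (simp add: R_path)
    qed
  qed (use M in simp_all)
qed

end

lemma twin_pentagon_raag:
  "pair_graph twin.\<Gamma> \<and> biconnected twin.\<Gamma> \<and> card (pverts twin.\<Gamma>) = 6 \<and> diam twin.\<Gamma> = 2 \<and>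
    diam (complement_graph twin.\<Gamma>) = 2 \<and> raag_min_translation_length twin.\<Gamma> = 2 / real 1"
proof (rule raag_from_noncommutation
    [of twin_pentagon 1 6 0 1 0 2 twin.\<Gamma> "[(1, True), (0, True), (2, True)]" "[(1, True), (0, True)]" "[(2, True)]" 0 3])
  show "twin_pentagon v u" if "twin_pentagon u v" for u v using that by (rule twin.R_sym)
  show "\<exists>w<6. twin_pentagon u w \<and> twin_pentagon w v \<and> w \<noteq> u \<and> w \<noteq> v" if "u < 6" "v < 6" "u \<noteq> v" "\<not> twin_pentagon u v" for u v
    using that twin_pentagon_diameters unfolding less_6 by blast
  show "\<exists>w<6. \<not> twin_pentagon u w \<and> \<not> twin_pentagon w v \<and> w \<noteq> u \<and> w \<noteq> v" if "u < 6" "v < 6" "u \<noteq> v" "twin_pentagon u v" for u v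
    using that twin_pentagon_diameters unfolding less_6 by blast
  show "twin.G.dominating_path S 1" if "S \<subseteq> {..<6}" "twin.G.dominating S" "\<not> twin.G.is_join S" for S
    using that(1,2) by (rule twin_pentagon_dominating_path)
  show "twin.G.dominating_path (fst ` set [(1, True), (0, True), (2, True)]) 1"
    by (rule twin_pentagon_cherry [of 0 _ 1 2]) (simp_all add: pentagon_cherries_def)
  have W: "[(1, True), (0, True)] \<in> words (pverts twin.\<Gamma>)" "[(2, True)] \<in> words (pverts twin.\<Gamma>)"
    "[(1, True), (0, True), (2, True)] \<in> words (pverts twin.\<Gamma>)" by auto
  have "twin.G.cls [(1, True), (0, True), (2, True)] [^]\<^bsub>raag twin.\<Gamma>\<^esub> (1::nat) =
      twin.G.cls [(1, True), (0, True), (2, True)]"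
    using twin.G.cls_closed [OF W(3)] by simp
  also have "\<dots> = twin.G.cls [(1, True), (0, True)] \<otimes>\<^bsub>raag twin.\<Gamma>\<^esub> twin.G.cls [(2, True)]"
    using twin.G.cls_append [OF W(1,2)] by simp
  finally show "twin.G.cls [(1, True), (0, True), (2, True)] [^]\<^bsub>raag twin.\<Gamma>\<^esub> (1::nat) =
      twin.G.cls [(1, True), (0, True)] \<otimes>\<^bsub>raag twin.\<Gamma>\<^esub> twin.G.cls [(2, True)]" .
  show "\<forall>z\<in>fst ` set [(1, True), (0, True)]. z = 3 \<or> \<not> twin_pentagon 3 z"
    "\<forall>z\<in>fst ` set [(2, True)]. z = 0 \<or> \<not> twin_pentagon 0 z"
    "twin_pentagon 0 1" "\<not> twin_pentagon 0 2" "\<not> twin_pentagon 0 3" by (simp_all add: twin_pentagon_nbrs)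
qed simp_all

theorem theoremC:
  fixes n :: nat
  assumes "n \<ge> 4"
  shows "\<exists>\<Gamma> :: nat pair_pre_digraph.
    pair_graph \<Gamma> \<and> biconnected \<Gamma> \<and>
    card (pverts \<Gamma>) = n + 2 \<and>
    diam \<Gamma> = 2 \<and> diam (complement_graph \<Gamma>) = 2 \<and>
    raag_min_translation_length \<Gamma> \<le> 2 / (real n - 3)"
proof (cases "n = 4")
  case True
  then show ?thesis using twin_pentagon_raag by (intro exI [of _ twin.\<Gamma>]) simp
next
  case False
  then interpret coned_path "n - 1" using assms by unfold_locales simp
  have "n - 1 + 3 = n + 2" "real (n - 1 - 2) = real n - 3" using assms False by simp_all
  then show ?thesis using coned_path_raag by (intro exI [of _ \<Gamma>]) simp
qed

end
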